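(* Let $\mu$ be a measure on the Borel subsets of $(0,\infty)$ such that $$0 < \int_0^{\infty} \frac{\lambda}{\lambda+1}\, d\mu(\lambda) < \infty ,$$ let $\delta>0$, and let $\nu$ be the measure on Borel subsets $E\subseteq(0,\infty)$ defined by $\nu(E)=\mu(\delta E)$, where $\delta E=\{\delta x: x\in E\}$. With $f_\mu$, $H_\nu$, $M(\lambda,z)$ and $\widehat M(\lambda,t)$ as defined in the context, the following hold. (i) The real entire function $z\mapsto H_\nu(\delta z)$ has exponential type at most $2\pi\delta$. (ii) For all real $x$ the function $\lambda\mapsto M(\delta^{-1}\lambda,\delta x)-e^{-\lambda|x|}$ is nonnegative and integrable on $(0,\infty)$ with respect to $\mu$. (iii) For all real $x$, $$0\le H_\nu(\delta x)+f_\mu(\delta^{-1})-f_\mu(x)=\int_0^\infty\{M(\delta^{-1}\lambda,\delta x)-e^{-\lambda|x|}\}\,d\mu(\lambda).$$ (iv) The nonnegative function $x\mapsto H_\nu(\delta x)+f_\mu(\delta^{-1})-f_\mu(x)$ is integrable on $\mathbb{R}$, and $$\int_{-\infty}^\infty\{H_\nu(\delta x)+f_\mu(\delta^{-1})-f_\mu(x)\}\,dx=\int_0^\infty\left\{\tfrac1\delta\coth\left(\tfrac{\lambda}{2\delta}\right)-\tfrac2\lambda\right\}d\mu(\lambda).$$ (v) If $t\ne0$ then $$\int_{-\infty}^\infty\{H_\nu(\delta x)+f_\mu(\delta^{-1})-f_\mu(x)\}e(-tx)\,dx=\delta^{-1}\int_0^\infty\widehat M(\delta^{-1}\lambda,\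delta^{-1}t)\,d\mu(\lambda)-\int_0^\infty\frac{2\lambda}{\lambda^2+4\pi^2t^2}\,d\mu(\lambda).$$
   Context: Conventions: a real entire function is an entire function taking real values on $\mathbb{R}$. An entire function $F$ has exponential type at most $\tau$ if for every $\varepsilon>0$ there is $C_\varepsilon$ with $|F(z)|\le C_\varepsilon e^{(\tau+\varepsilon)|z|}$ for all $z\in\mathbb{C}$. Write $e(z)=e^{2\pi i z}$, and $\operatorname{sgn}(x)=1,0,-1$ according as $x>0$, $x=0$, $x<0$. For $\lambda>0$ define the entire function (with removable singularities removed) $$M(\lambda,z)=\left(\frac{\sin\pi z}{\pi}\right)^2\left\{\sum_{k\in\mathbb{Z}}\frac{e^{-\lambda|k|}}{(z-k)^2}-\lambda\sum_{l\in\mathbb{Z}}\frac{\operatorname{sgn}(l)e^{-\lambda|l|}}{z-l}\right\}.$$ It is real entire of exponential type $2\pi$, bounded and integrable on $\mathbb{R}$, and $\widehat M(\lambda,t)=\int_{-\infty}^\infty M(\lambda,x)e(-tx)\,dx$, which is continuous in $t$ and supported on $[-1,1]$. For a measure $\rho$ on the Borel subsets of $(0,\infty)$ with $0<\int_0^\infty\frac{\lambda}{\lambda+1}\,d\rho(\lambda)<\infty$ (this holds for $\rho=\mu$ and for $\rho=\nu$), define $f_\rho:\mathbb{R}\to\mathbb{R}$ by $$f_\rho(x)=\int_0^\infty\{e^{-\lambda|x|}-e^{-\lambda}\}\,d\rho(\lambda).$$ For $x\ne0$, $f_\rho$ is smooth and $f_\rho'(x)=-\operatorname{sgn}(x)\int_0^\infty\lambda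 e^{-\lambda|x|}\,d\rho(\lambda)$. Define $H_\rho:\mathbb{C}\to\mathbb{C}$ by $$H_\rho(z)=\lim_{N\to\infty}\left(\frac{\sin\pi z}{\pi}\right)^2\left\{\sum_{|n|\le N}\frac{f_\rho(n)}{(z-n)^2}+\sum_{1\le|n|\le N}\frac{f_\rho'(n)}{z-n}\right\};$$ the limit converges uniformly on compact subsets of $\mathbb{C}$ and defines a real entire function. *)

theory Defs
  imports "HOL-Complex_Analysis.Complex_Analysis"
begin

definition real_entire :: "(complex \<Rightarrow> complex) \<Rightarrow> bool" where
  "real_entire F \<longleftrightarrow> F holomorphic_on UNIV \<and> (\<forall>x::real. F (of_real x) \<in> \<real>)"

definition exp_type_at_most :: "(complex \<Rightarrow> complex) \<Rightarrow> real \<Rightarrow> bool" where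
  "exp_type_at_most F \<tau> \<longleftrightarrow> F holomorphic_on UNIV \<and>
     (\<forall>\<epsilon>>0. \<exists>C::real. \<forall>z. norm (F z) \<le> C * exp ((\<tau> + \<epsilon>) * norm z))"

definition e_char :: "complex \<Rightarrow> complex" where
  "e_char z = exp (2 * of_real pi * \<i> * z)"

definition coth :: "real \<Rightarrow> real" where
  "coth x = cosh x / sinh x"

text \<open>The formula below has removable singularities at the integers, where Isabelle's convention
  for division by zero gives it the wrong values; \<^const>\<open>remove_sings\<close> replaces these by the
  limits.\<close>

definition M_fun :: "real \<Rightarrow> complex \<Rightarrow> complex" where
  "M_fun l = remove_sings (\<lambda>z. (sin (of_real pi * z) / of_real pi)\<^sup>2 *
     ((\<Sum>\<^sub>\<infinity>k::int. of_real (exp (- l * \<bar>of_int k\<bar>)) / (z - of_int k)\<^sup>2)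
      - of_real l * (\<Sum>\<^sub>\<infinity>j::int. of_real (sgn (of_int j) * exp (- l * \<bar>of_int j\<bar>)) / (z - of_int j))))"

definition M_hat :: "real \<Rightarrow> real \<Rightarrow> complex" where
  "M_hat l t = (LINT x|lborel. M_fun l (of_real x) * e_char (of_real (- t * x)))"

text \<open>Measures on the Borel subsets of $(0,\infty)$ are modelled with \<^term>\<open>{0<..} :: real set\<close> as
  their space, so integrals over $(0,\infty)$ are integrals over the whole space.\<close>

definition borel_measure_pos :: "real measure \<Rightarrow> bool" where
  "borel_measure_pos \<rho> \<longleftrightarrow> sets \<rho> = sets (restrict_space borel {0<..})"

definition f_fun :: "real measure \<Rightarrow> real \<Rightarrow> real" where
  "f_fun \<rho> x = (LINT l|\<rho>. exp (- l * \<bar>x\<bar>) - exp (- l))"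

definition H_partial :: "real measure \<Rightarrow> nat \<Rightarrow> complex \<Rightarrow> complex" where
  "H_partial \<rho> N = remove_sings (\<lambda>z. (sin (of_real pi * z) / of_real pi)\<^sup>2 *
     ((\<Sum>n | \<bar>n\<bar> \<le> int N. of_real (f_fun \<rho> (of_int n)) / (z - of_int n)\<^sup>2)
      + (\<Sum>n | 1 \<le> \<bar>n\<bar> \<and> \<bar>n\<bar> \<le> int N. of_real (deriv (f_fun \<rho>) (of_int n)) / (z - of_int n))))"

definition H_fun :: "real measure \<Rightarrow> complex \<Rightarrow> complex" where
  "H_fun \<rho> z = lim (\<lambda>N. H_partial \<rho> N z)"

end

theory Submission
  imports Defs "HOL-Real_Asymp.Real_Asymp"
begin

text \<open>
  On the real line \<open>H\<^sub>\<nu>(x) - f\<^sub>\<nu>(x)\<close> is the \<open>\<nu>\<close>-average of \<open>M(\<lambda>, x) - exp (- \<lambda> \<bar>x\<bar>)\<close>, and \<open>\<nu>\<close>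
  is the image of \<open>\<mu>\<close> under \<open>\<lambda> \<mapsto> \<lambda> / \<delta>\<close>, so everything follows from the case \<open>\<delta> = 1\<close>, the
  nonnegativity of the averaged function and Fubini's theorem. Nonnegativity: dividing by
  \<open>(sin \<pi>x / \<pi>)\<^sup>2\<close> turns the function, for \<open>x > 0\<close>, into the Laplace transform at \<open>x\<close> of
  \<open>B(t + \<lambda>) - \<lambda> - B(t - \<lambda>)\<close> with \<open>B(u) = u / (1 - exp (- u))\<close>, which is nonnegative because
  \<open>u coth (u / 2)\<close> increases in \<open>\<bar>u\<bar>\<close>. Convergence and growth of \<open>H\<^sub>\<nu>\<close>: pairing the nodes \<open>n\<close> and
  \<open>- n\<close> and combining the terms with \<open>f\<close> and \<open>f'\<close> gives terms whose sum is at most a constant times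
  \<open>(1 + \<bar>z\<bar>)\<^sup>4 exp (2\<pi> \<bar>Im z\<bar>) \<lambda> / (\<lambda> + 1)\<close>, uniformly in \<open>\<lambda>\<close>.
\<close>

section \<open>Fejer kernels\<close>

text \<open>The normalisation \<open>exp (- l * |x|) - exp (- l)\<close> exists because the measure
  may have infinite mass near 0, where only a weight comparable to \<open>l\<close> is integrable.
  Subtracting this constant commutes with interpolation because the translates of the Fejer kernel
  sum to 1, which is the partial fraction expansion of \<open>1 / sin^2\<close>; the same expansion
  writes \<open>exp (- l * x)\<close> as a series over the nodes, so that it can be compared with
  the series of the majorant. The Laplace comparison is carried out with nonnegative integrals, so
  every interchange of sum and integral is free, and the point \<open>t = l\<close>, where
  \<open>B (t - l)\<close> has its removable singularity, is a null set. Nonnegativity pays a second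
  time in Fubini's theorem: absolute integrability on the product space reduces to the single
  integral \<open>coth (l / 2) - 2 / l\<close>, which is at most \<open>l / (l + 1)\<close>. The
  transform of \<open>M\<close> and the transform of the exponential are separated only for nonzero
  \<open>t\<close>, since at \<open>t = 0\<close> they need not be integrable one by one.\<close>

definition nsinc :: "'a::{real_normed_field,banach} \<Rightarrow> 'a" where
  "nsinc w = (if w = 0 then 1 else sin (of_real pi * w) / (of_real pi * w))"

text \<open>\<open>fejer\<close> and \<open>hfejer\<close> are the Hermite basis at the integers: at
  0 the first has value 1 and slope 0, the second value 0 and slope 1, and both vanish to second
  order at the other integers.\<close>

definition fejer :: "'a::{real_normed_field,banach} \<Rightarrow> 'a" where
  "fejer w = (nsinc w)\<^sup>2"

definition hfejer :: "'a::{real_normed_field,banach} \<Rightarrow> 'a" where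
  "hfejer w = w * (nsinc w)\<^sup>2"

text \<open>The index \<open>n\<close> stands for the node \<open>n + 1\<close>. The plus sign here
  and the minus sign in \<open>hfejer_pair\<close> match even values and odd slopes.\<close>

definition fejer_pair :: "nat \<Rightarrow> 'a::{real_normed_field,banach} \<Rightarrow> 'a" where
  "fejer_pair n z = fejer (z - of_nat (Suc n)) + fejer (z + of_nat (Suc n))"

definition hfejer_pair :: "nat \<Rightarrow> 'a::{real_normed_field,banach} \<Rightarrow> 'a" where
  "hfejer_pair n z = hfejer (z - of_nat (Suc n)) - hfejer (z + of_nat (Suc n))"

lemma nsinc_0 [simp]: "nsinc 0 = 1"
  by (simp add: nsinc_def)

lemma mult_nsinc: "w * nsinc w = sin (of_real pi * w) / of_real pi"
  by (simp add: nsinc_def)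

lemma nsinc_minus [simp]: "nsinc (- w) = nsinc w"
  by (simp add: nsinc_def)

lemma fejer_minus [simp]: "fejer (- w) = fejer w"
  by (simp add: fejer_def)

lemma hfejer_minus [simp]: "hfejer (- w) = - hfejer w"
  by (simp add: hfejer_def)

lemma mult_fejer: "w\<^sup>2 * fejer w = (sin (of_real pi * w) / of_real pi)\<^sup>2"
  by (simp add: fejer_def mult_nsinc flip: power_mult_distrib)

lemma mult_hfejer: "w * hfejer w = (sin (of_real pi * w) / of_real pi)\<^sup>2"
  using mult_fejer[of w] by (simp add: fejer_def hfejer_def power2_eq_square mult_ac)

lemma sin_sq_add_nat:
  fixes z :: "'a::{real_normed_field,banach}"
  shows "(sin (of_real pi * (z + of_nat m)))\<^sup>2 = (sin (of_real pi * z))\<^sup>2"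
proof (induction m)
  case (Suc m)
  have "sin (of_real pi * (z + of_nat (Suc m))) = sin (of_real pi * (z + of_nat m) + of_real pi)"
    by (simp add: algebra_simps)
  also have "\<dots> = - sin (of_real pi * (z + of_nat m))"
    by (simp add: sin_add sin_of_real cos_of_real)
  finally show ?case using Suc by simp
qed simp

lemma sin_sq_diff_nat:
  fixes z :: "'a::{real_normed_field,banach}"
  shows "(sin (of_real pi * (z - of_nat m)))\<^sup>2 = (sin (of_real pi * z))\<^sup>2"
  using sin_sq_add_nat[of "z - of_nat m" m] by simp

lemma sin_sq_diff_int:
  fixes z :: "'a::{real_normed_field,banach}"
  shows "(sin (of_real pi * (z - of_int k)))\<^sup>2 = (sin (of_real pi * z))\<^sup>2"
  by (cases k rule: int_cases2) (simp_all add: sin_sq_add_nat sin_sq_diff_nat)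

lemma fejer_of_real: "fejer (of_real x) = of_real (fejer x)"
  by (simp add: fejer_def nsinc_def sin_of_real flip: of_real_mult)

lemma hfejer_of_real: "hfejer (of_real x) = of_real (hfejer x)"
proof -
  have "nsinc (of_real x :: 'a) = of_real (nsinc x)"
    by (simp add: nsinc_def sin_of_real flip: of_real_mult)
  then show ?thesis by (simp add: hfejer_def)
qed

lemma fejer_pair_of_real: "fejer_pair n (of_real x) = of_real (fejer_pair n x)"
proof -
  have "of_real x - of_nat (Suc n) = (of_real (x - of_nat (Suc n)) :: 'a)"
    "of_real x + of_nat (Suc n) = (of_real (x + of_nat (Suc n)) :: 'a)" by simp_all
  then show ?thesis
    unfolding fejer_pair_def by (simp only: fejer_of_real flip: of_real_add)
qed

lemma hfejer_pair_of_real: "hfejer_pair n (of_real x) = of_real (hfejer_pair n x)"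
proof -
  have "of_real x - of_nat (Suc n) = (of_real (x - of_nat (Suc n)) :: 'a)"
    "of_real x + of_nat (Suc n) = (of_real (x + of_nat (Suc n)) :: 'a)" by simp_all
  then show ?thesis
    unfolding hfejer_pair_def by (simp only: hfejer_of_real flip: of_real_diff)
qed

lemma fejer_pair_minus [simp]: "fejer_pair n (- z) = fejer_pair n z"
proof -
  have "- z - of_nat (Suc n) = - (z + of_nat (Suc n))" "- z + of_nat (Suc n) = - (z - of_nat (Suc n))"
    by simp_all
  then show ?thesis unfolding fejer_pair_def by (metis add.commute fejer_minus)
qed

lemma hfejer_pair_minus [simp]: "hfejer_pair n (- z) = hfejer_pair n z"
proof -
  have "- z - of_nat (Suc n) = - (z + of_nat (Suc n))" "- z + of_nat (Suc n) = - (z - of_nat (Suc n))"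
    by simp_all
  then have "hfejer_pair n (- z) = - hfejer (z + of_nat (Suc n)) - - hfejer (z - of_nat (Suc n))"
    unfolding hfejer_pair_def by (simp only: hfejer_minus)
  then show ?thesis by (simp add: hfejer_pair_def)
qed

lemma holomorphic_nsinc: "(nsinc :: complex \<Rightarrow> complex) holomorphic_on UNIV"
proof -
  define g where "g = (\<lambda>w::complex. sin (of_real pi * w) / of_real pi)"
  have g: "g holomorphic_on UNIV"
    unfolding g_def by (intro holomorphic_intros) auto
  have "(g has_field_derivative 1) (at 0)"
    unfolding g_def by (auto intro!: derivative_eq_intros)
  then have "deriv g 0 = 1"
    by (rule DERIV_imp_deriv)
  \<comment> \<open>The value 1 at 0 is the derivative of \<open>g\<close> there, so
    \<open>nsinc\<close> is the completed difference quotient treated by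
    \<open>pole_lemma\<close>.\<close>
  then have "nsinc = (\<lambda>z. if z = 0 then deriv g 0 else (g z - g 0) / (z - 0))"
    by (auto simp: nsinc_def g_def)
  with pole_lemma[OF g, of 0] show ?thesis
    by simp
qed

lemma holomorphic_nsinc' [holomorphic_intros]:
  "f holomorphic_on A \<Longrightarrow> (\<lambda>z. nsinc (f z :: complex)) holomorphic_on A"
  using holomorphic_on_compose[of f A nsinc] holomorphic_nsinc
  by (auto simp: o_def intro: holomorphic_on_subset)

lemma holomorphic_fejer_intros [holomorphic_intros]:
  "f holomorphic_on A \<Longrightarrow> (\<lambda>z. fejer (f z :: complex)) holomorphic_on A"
  "f holomorphic_on A \<Longrightarrow> (\<lambda>z. hfejer (f z :: complex)) holomorphic_on A"
  "f holomorphic_on A \<Longrightarrow> (\<lambda>z. fejer_pair n (f z :: complex)) holomorphic_on A"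
  "f holomorphic_on A \<Longrightarrow> (\<lambda>z. hfejer_pair n (f z :: complex)) holomorphic_on A"
  unfolding fejer_def hfejer_def fejer_pair_def hfejer_pair_def
  by (intro holomorphic_intros; assumption)+

section \<open>Exponential bounds on the kernels\<close>

lemma norm_cos_le_exp: "norm (cos (z::complex)) \<le> exp \<bar>Im z\<bar>"
proof -
  have "norm (cos z) = norm (exp (\<i> * z) + exp (- (\<i> * z))) / 2"
    by (simp add: cos_exp_eq norm_divide)
  also have "\<dots> \<le> (norm (exp (\<i> * z)) + norm (exp (- (\<i> * z)))) / 2"
    by (intro divide_right_mono norm_triangle_ineq) auto
  also have "\<dots> \<le> (exp \<bar>Im z\<bar> + exp \<bar>Im z\<bar>) / 2"
    by (intro divide_right_mono add_mono) (auto simp: norm_exp_eq_Re)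
  finally show ?thesis by simp
qed

lemma norm_sin_le_exp: "norm (sin (z::complex)) \<le> exp \<bar>Im z\<bar>"
  using norm_cos_le_exp[of "of_real (pi / 2) - z"]
  by (simp add: cos_diff cos_of_real sin_of_real del: of_real_divide)

lemma norm_sin_le: "norm (sin (z::complex)) \<le> norm z * exp \<bar>Im z\<bar>"
proof -
  have "norm (sin z - sin 0) \<le> exp \<bar>Im z\<bar> * norm (z - 0)"
  proof (rule field_differentiable_bound[where S = "closed_segment 0 z" and f' = cos])
    fix w assume "w \<in> closed_segment 0 z"
    then obtain u where u: "0 \<le> u" "u \<le> 1" "w = u *\<^sub>R z"
      by (auto simp: in_segment)
    then have "\<bar>Im w\<bar> \<le> \<bar>Im z\<bar>"
      by (auto simp: abs_mult intro: mult_left_le_one_le)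
    with norm_cos_le_exp[of w] show "norm (cos w) \<le> exp \<bar>Im z\<bar>"
      by (meson exp_le_cancel_iff order_trans)
  qed (auto intro!: derivative_eq_intros)
  then show ?thesis by (simp add: mult.commute)
qed

text \<open>The factor \<open>norm w\<close> in \<open>norm_sin_le\<close> cancels the denominator.
  The bound sees only \<open>Im w\<close>, so it is unchanged by integer translations and serves all
  nodes at once.\<close>

lemma norm_nsinc_le: "norm (nsinc (w::complex)) \<le> exp (pi * \<bar>Im w\<bar>)"
proof (cases "w = 0")
  case False
  have "norm (sin (of_real pi * w)) \<le> pi * norm w * exp (pi * \<bar>Im w\<bar>)"
    using norm_sin_le[of "of_real pi * w"] by (simp add: norm_mult abs_mult)
  then show ?thesis
    using False by (simp add: nsinc_def norm_divide norm_mult field_simps)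
qed simp

lemma norm_mult_nsinc_le: "norm (w * nsinc (w::complex)) \<le> exp (pi * \<bar>Im w\<bar>)"
proof -
  have "norm (w * nsinc w) \<le> exp (pi * \<bar>Im w\<bar>) / pi"
    unfolding mult_nsinc using norm_sin_le_exp[of "of_real pi * w"]
    by (simp add: norm_divide abs_mult divide_right_mono)
  also have "\<dots> \<le> exp (pi * \<bar>Im w\<bar>) / 1"
    by (intro divide_left_mono) (use pi_gt3 in auto)
  finally show ?thesis by simp
qed

lemma norm_fejer_le: "norm (fejer (w::complex)) \<le> exp (2 * pi * \<bar>Im w\<bar>)"
  unfolding fejer_def norm_power
  using power_mono[OF norm_nsinc_le[of w], of 2] by (simp add: mult_ac flip: exp_double)

lemma norm_hfejer_le: "norm (hfejer (w::complex)) \<le> exp (2 * pi * \<bar>Im w\<bar>)"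
proof -
  have "norm (hfejer w) = norm (w * nsinc w) * norm (nsinc w)"
    by (simp add: hfejer_def norm_mult power2_eq_square)
  also have "\<dots> \<le> exp (pi * \<bar>Im w\<bar>) * exp (pi * \<bar>Im w\<bar>)"
    by (intro mult_mono norm_mult_nsinc_le norm_nsinc_le) auto
  finally show ?thesis by (simp add: mult.assoc flip: exp_add)
qed

lemma norm_sin_pi_sq_le:
  "norm ((sin (of_real pi * w) / of_real pi)\<^sup>2 :: complex) \<le> exp (2 * pi * \<bar>Im w\<bar>)"
  unfolding mult_nsinc[symmetric] norm_power
  using power_mono[OF norm_mult_nsinc_le[of w], of 2] by (simp add: mult_ac flip: exp_double)

text \<open>Since \<open>w * hfejer w\<close> takes the same value at all integer translates of
  \<open>z\<close>, a factor \<open>m\<close> can be traded for a factor \<open>z\<close>. This and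
  the next two identities produce the decay in the node.\<close>

lemma hfejer_sum_eq:
  fixes z :: "'a::{real_normed_field,banach}"
  shows "of_nat m * (hfejer (z - of_nat m) + hfejer (z + of_nat m)) =
         z * (hfejer (z - of_nat m) - hfejer (z + of_nat m))"
proof -
  have "(z - of_nat m) * hfejer (z - of_nat m) = (z + of_nat m) * hfejer (z + of_nat m)"
    by (simp add: mult_hfejer sin_sq_add_nat sin_sq_diff_nat power_divide)
  then show ?thesis by (simp add: algebra_simps)
qed

lemma hfejer_diff_eq:
  fixes z :: "'a::{real_normed_field,banach}"
  shows "of_nat m * (hfejer (z - of_nat m) - hfejer (z + of_nat m)) =
         z * (hfejer (z - of_nat m) + hfejer (z + of_nat m)) - 2 * (sin (of_real pi * z) / of_real pi)\<^sup>2"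
proof -
  have "(z - of_nat m) * hfejer (z - of_nat m) + (z + of_nat m) * hfejer (z + of_nat m)
     = 2 * (sin (of_real pi * z) / of_real pi)\<^sup>2"
    by (simp add: mult_hfejer sin_sq_add_nat sin_sq_diff_nat power_divide)
  then show ?thesis by (simp add: algebra_simps)
qed

lemma fejer_sum_eq:
  fixes z :: "'a::{real_normed_field,banach}"
  shows "(of_nat m)\<^sup>2 * (fejer (z - of_nat m) + fejer (z + of_nat m)) =
         2 * (sin (of_real pi * z) / of_real pi)\<^sup>2 - 2 * z * (hfejer (z - of_nat m) + hfejer (z + of_nat m))
           + z\<^sup>2 * (fejer (z - of_nat m) + fejer (z + of_nat m))"
proof -
  have "(z - of_nat m)\<^sup>2 * fejer (z - of_nat m) + (z + of_nat m)\<^sup>2 * fejer (z + of_nat m)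
     = 2 * (sin (of_real pi * z) / of_real pi)\<^sup>2"
    by (simp add: mult_fejer sin_sq_add_nat sin_sq_diff_nat power_divide)
  moreover have "hfejer w = w * fejer w" for w :: 'a
    by (simp add: hfejer_def fejer_def)
  ultimately show ?thesis by (simp add: algebra_simps power2_eq_square)
qed

text \<open>The fourth power comes from two successive trades of powers of the node for powers of
  \<open>norm z\<close> in the sharpest remainder estimate below; the exponential comes from the
  squared sinc. The \<epsilon> in the definition of exponential type absorbs the polynomial
  factor.\<close>

definition growth :: "complex \<Rightarrow> real" where
  "growth z = (1 + norm z) ^ 4 * exp (2 * pi * \<bar>Im z\<bar>)"

lemma growth_nonneg: "0 \<le> growth z"
  by (simp add: growth_def)

lemma exp_le_growth: "k \<le> 4 \<Longrightarrow> (1 + norm z) ^ k * exp (2 * pi * \<bar>Im z\<bar>) \<le> growth z"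
  unfolding growth_def by (intro mult_right_mono power_increasing) auto

lemma norm_sin_pi_sq_le_growth:
  "norm ((sin (of_real pi * z) / of_real pi)\<^sup>2 :: complex) \<le> growth z"
  using norm_sin_pi_sq_le[of z] exp_le_growth[of 0 z] by simp

lemma norm_fejer_le_growth: "norm (fejer z) \<le> growth z"
  using norm_fejer_le[of z] exp_le_growth[of 0 z] by simp

text \<open>The leading terms \<open>2 * P / m^2\<close> and \<open>- 2 * P / m\<close> are isolated
  because they nearly cancel in \<open>norm_H_term_le\<close>; each remainder has one more power of
  \<open>m\<close> in the denominator.\<close>

lemma
  fixes z :: complex and n :: nat
  defines "m \<equiv> real (Suc n)" and "P \<equiv> (sin (of_real pi * z) / of_real pi)\<^sup>2"
  shows norm_fejer_pair_le: "norm (fejer_pair n z) \<le> 2 * growth z / m\<^sup>2"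
    and norm_fejer_pair_minus_le: "norm (fejer_pair n z - 2 * P / of_real (m\<^sup>2)) \<le> 6 * growth z / m ^ 3"
    and norm_hfejer_pair_plus_le: "norm (hfejer_pair n z + 2 * P / of_real m) \<le> 2 * growth z / m\<^sup>2"
proof -
  define e where "e = exp (2 * pi * \<bar>Im z\<bar>)"
  define r where "r = norm z"
  define f where "f = fejer_pair n z"
  define h where "h = hfejer_pair n z"
  define s where "s = hfejer (z - of_nat (Suc n)) + hfejer (z + of_nat (Suc n))"
  have m: "m \<ge> 1" and m0: "m > 0" by (auto simp: m_def)
  have e: "e > 0" and r: "r \<ge> 0" by (auto simp: e_def r_def)
  have nm: "norm (complex_of_nat (Suc n)) = m"
    unfolding m_def by (rule norm_of_nat)
  have P: "norm P \<le> e" unfolding P_def e_def by (rule norm_sin_pi_sq_le)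
  have f: "norm f \<le> 2 * e"
    unfolding f_def fejer_pair_def e_def
    by (rule order_trans[OF norm_triangle_ineq]) (use norm_fejer_le[of "z - of_nat (Suc n)"] norm_fejer_le[of "z + of_nat (Suc n)"] in simp)
  have h: "norm h \<le> 2 * e"
    unfolding h_def hfejer_pair_def e_def
    by (rule order_trans[OF norm_triangle_ineq4]) (use norm_hfejer_le[of "z - of_nat (Suc n)"] norm_hfejer_le[of "z + of_nat (Suc n)"] in simp)
  have s2: "norm s \<le> 2 * e"
    unfolding s_def e_def
    by (rule order_trans[OF norm_triangle_ineq]) (use norm_hfejer_le[of "z - of_nat (Suc n)"] norm_hfejer_le[of "z + of_nat (Suc n)"] in simp)
  \<comment> \<open>The sum of the two \<open>hfejer\<close> translates gains a factor
    \<open>1 / m\<close> over the trivial bound \<open>s2\<close>.\<close>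
  have "m * norm s = r * norm h"
    using arg_cong[OF hfejer_sum_eq[of "Suc n" z], of norm]
    unfolding s_def h_def hfejer_pair_def norm_mult nm r_def by simp
  also have "\<dots> \<le> r * (2 * e)" using h r by (intro mult_left_mono)
  finally have s: "m * norm s \<le> 2 * r * e" by simp
  have g: "(1 + r) ^ k * e \<le> growth z" if "k \<le> 4" for k
    unfolding r_def e_def using exp_le_growth[OF that] .
  have "r\<^sup>2 * e \<le> (1 + r)\<^sup>2 * e"
    using r e by (intro mult_right_mono power_mono) auto
  with g[of 2] have r2: "r\<^sup>2 * e \<le> growth z" by simp
  have fe: "of_real (m\<^sup>2) * f = 2 * P - 2 * z * s + z\<^sup>2 * f"
    using fejer_sum_eq[of "Suc n" z] unfolding f_def fejer_pair_def P_def s_def m_def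
    by (simp add: power2_eq_square)
  have "m\<^sup>2 * norm f = norm (2 * P - 2 * z * s + z\<^sup>2 * f)"
    using arg_cong[OF fe, of norm] m0 by (simp add: norm_mult norm_power)
  also have "\<dots> \<le> norm (2 * P) + norm (2 * z * s) + norm (z\<^sup>2 * f)"
    by (meson add_mono norm_triangle_ineq norm_triangle_ineq4 order_refl order_trans)
  also have "\<dots> \<le> 2 * e + 2 * r * (2 * e) + r\<^sup>2 * (2 * e)"
    unfolding norm_mult norm_power r_def[symmetric]
    using P s2 f r by (intro add_mono mult_mono) auto
  also have "\<dots> = 2 * ((1 + r)\<^sup>2 * e)"
    by (simp add: algebra_simps power2_eq_square)
  finally have mf: "m\<^sup>2 * norm f \<le> 2 * ((1 + r)\<^sup>2 * e)" .
  with g[of 2] have "m\<^sup>2 * norm f \<le> 2 * growth z" by simp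
  then show "norm (fejer_pair n z) \<le> 2 * growth z / m\<^sup>2"
    using m0 by (simp add: f_def field_simps)
  have "m\<^sup>2 * norm (f - 2 * P / of_real (m\<^sup>2)) = norm (of_real (m\<^sup>2) * (f - 2 * P / of_real (m\<^sup>2)))"
    using m0 by (simp add: norm_mult norm_power)
  also have "of_real (m\<^sup>2) * (f - 2 * P / of_real (m\<^sup>2)) = z\<^sup>2 * f - 2 * z * s"
    using fe m0 by (simp add: algebra_simps)
  also have "norm \<dots> \<le> norm (z\<^sup>2 * f) + norm (2 * z * s)"
    by (rule norm_triangle_ineq4)
  also have "\<dots> = r\<^sup>2 * norm f + 2 * r * norm s"
    by (simp add: norm_mult norm_power r_def)
  finally have "m\<^sup>2 * norm (f - 2 * P / of_real (m\<^sup>2)) \<le> r\<^sup>2 * norm f + 2 * r * norm s" .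
  \<comment> \<open>One more factor \<open>m\<close> is spent: on \<open>norm f\<close>, which could
    even afford \<open>m^2\<close>, and on the decay of \<open>norm s\<close>. The constant 6 is 2 +
    4.\<close>
  then have "m * (m\<^sup>2 * norm (f - 2 * P / of_real (m\<^sup>2))) \<le> m * (r\<^sup>2 * norm f + 2 * r * norm s)"
    using m0 by (intro mult_left_mono) auto
  also have "\<dots> = r\<^sup>2 * (m * norm f) + 2 * r * (m * norm s)"
    by (simp add: algebra_simps)
  also have "\<dots> \<le> (1 + r)\<^sup>2 * (2 * ((1 + r)\<^sup>2 * e)) + 2 * r * (2 * r * e)"
  proof -
    have "m * norm f \<le> m\<^sup>2 * norm f"
      using m by (intro mult_right_mono) (auto simp: power2_eq_square)
    with mf have "m * norm f \<le> 2 * ((1 + r)\<^sup>2 * e)" by simp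
    moreover have "r\<^sup>2 \<le> (1 + r)\<^sup>2" using r by (intro power_mono) auto
    ultimately have "r\<^sup>2 * (m * norm f) \<le> (1 + r)\<^sup>2 * (2 * ((1 + r)\<^sup>2 * e))"
      using m0 by - (rule mult_mono, auto)
    moreover have "2 * r * (m * norm s) \<le> 2 * r * (2 * r * e)"
      using s r by (intro mult_left_mono) auto
    ultimately show ?thesis by (rule add_mono)
  qed
  also have "\<dots> = 2 * ((1 + r) ^ 4 * e) + 4 * (r\<^sup>2 * e)"
    by (simp add: algebra_simps power2_eq_square power4_eq_xxxx)
  also have "\<dots> \<le> 6 * growth z"
    using g[of 4] r2 by simp
  finally show "norm (fejer_pair n z - 2 * P / of_real (m\<^sup>2)) \<le> 6 * growth z / m ^ 3"
    using m0 by (simp add: f_def field_simps power3_eq_cube power2_eq_square)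
  have he: "of_real m * h = z * s - 2 * P"
    using hfejer_diff_eq[of "Suc n" z] unfolding h_def hfejer_pair_def P_def s_def m_def
    by simp
  have "m * norm (h + 2 * P / of_real m) = norm (of_real m * (h + 2 * P / of_real m))"
    using m0 by (simp add: norm_mult)
  also have "of_real m * (h + 2 * P / of_real m) = z * s"
    using he m0 by (simp add: algebra_simps)
  \<comment> \<open>The two factors \<open>m\<close> are used separately, one inside
    \<open>he\<close> and one for the decay of \<open>s\<close>.\<close>
  finally have "m * (m * norm (h + 2 * P / of_real m)) = r * (m * norm s)"
    by (simp add: norm_mult r_def)
  also have "\<dots> \<le> r * (2 * r * e)"
    using s r by (intro mult_left_mono)
  also have "\<dots> \<le> 2 * growth z"
    using r2 by (simp add: power2_eq_square)
  finally show "norm (hfejer_pair n z + 2 * P / of_real m) \<le> 2 * growth z / m\<^sup>2"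
    using m0 by (simp add: h_def field_simps power2_eq_square)
qed

section \<open>The majorant as a series\<close>

lemma has_sum_int_split:
  fixes f :: "int \<Rightarrow> 'a::banach"
  assumes "(f has_sum S) UNIV"
  shows "(\<lambda>n. f (int (Suc n)) + f (- int (Suc n))) sums (S - f 0)"
proof -
  have s: "f summable_on A" for A
    using assms by (meson has_sum_imp_summable subset_UNIV summable_on_subset_banach)
  define P where "P = infsum f {1..}"
  define N where "N = infsum f {..-1}"
  have "(f has_sum (P + f 0 + N)) ({1..} \<union> {0} \<union> {..-1})"
    unfolding P_def N_def by (intro has_sum_Un_disjoint has_sum_infsum s) (auto intro: has_sum_finiteI)
  moreover have "{1..} \<union> {0} \<union> {..-1} = (UNIV :: int set)" by auto
  ultimately have S: "S = P + f 0 + N"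
    using assms has_sum_unique by metis
  have "((\<lambda>n. f (int (Suc n))) has_sum P) UNIV \<longleftrightarrow> (f has_sum P) {1..}"
    by (rule has_sum_reindex_bij_witness[of _ "\<lambda>k. nat (k - 1)" "\<lambda>n. int (Suc n)"]) auto
  then have 1: "(\<lambda>n. f (int (Suc n))) sums P"
    using s by (auto simp: P_def intro: has_sum_imp_sums)
  have "((\<lambda>n. f (- int (Suc n))) has_sum N) UNIV \<longleftrightarrow> (f has_sum N) {..-1}"
    by (rule has_sum_reindex_bij_witness[of _ "\<lambda>k. nat (- k - 1)" "\<lambda>n. - int (Suc n)"]) auto
  then have "(\<lambda>n. f (- int (Suc n))) sums N"
    using s by (auto simp: N_def intro: has_sum_imp_sums)
  from sums_add[OF 1 this] show ?thesis by (simp add: S)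
qed

lemma summable_on_int_norm:
  fixes f :: "int \<Rightarrow> 'a::banach"
  assumes "summable (\<lambda>n. norm (f (int n)))" "summable (\<lambda>n. norm (f (- int n)))"
  shows "f summable_on UNIV"
proof -
  have "((\<lambda>n. f (int n)) summable_on UNIV) \<longleftrightarrow> f summable_on {0..}"
    by (rule summable_on_reindex_bij_witness[of _ nat int]) auto
  then have 1: "f summable_on {0..}"
    using norm_summable_imp_summable_on[OF assms(1)] by simp
  have "((\<lambda>n. f (- int n)) summable_on UNIV) \<longleftrightarrow> f summable_on {..0}"
    by (rule summable_on_reindex_bij_witness[of _ "\<lambda>k. nat (- k)" "\<lambda>n. - int n"]) auto
  then have "f summable_on {..0}"
    using norm_summable_imp_summable_on[OF assms(2)] by simp
  then have "f summable_on ({..0} - {0})"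
    by (rule summable_on_subset_banach) auto
  with 1 have "f summable_on ({0..} \<union> ({..0} - {0}))"
    by (intro summable_on_Un_disjoint) auto
  moreover have "{0..} \<union> ({..0} - {0}) = (UNIV :: int set)" by auto
  ultimately show ?thesis by simp
qed

lemma sum_int_interval_split:
  fixes f :: "int \<Rightarrow> 'a::comm_monoid_add"
  shows "(\<Sum>k | \<bar>k\<bar> \<le> int N. f k) = f 0 + (\<Sum>n<N. f (int (Suc n)) + f (- int (Suc n)))"
    and "(\<Sum>k | 1 \<le> \<bar>k\<bar> \<and> \<bar>k\<bar> \<le> int N. f k) = (\<Sum>n<N. f (int (Suc n)) + f (- int (Suc n)))"
proof -
  have fin: "finite {k. 1 \<le> \<bar>k\<bar> \<and> \<bar>k\<bar> \<le> int M}" for M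
    by (rule finite_subset[of _ "{- int M..int M}"]) auto
  show 2: "(\<Sum>k | 1 \<le> \<bar>k\<bar> \<and> \<bar>k\<bar> \<le> int N. f k) = (\<Sum>n<N. f (int (Suc n)) + f (- int (Suc n)))"
  proof (induction N)
    case 0
    have "{k::int. 1 \<le> \<bar>k\<bar> \<and> \<bar>k\<bar> \<le> int 0} = {}" by auto
    then show ?case by (simp only: sum.empty lessThan_0)
  next
    case (Suc N)
    have "{k. 1 \<le> \<bar>k\<bar> \<and> \<bar>k\<bar> \<le> int (Suc N)} =
        insert (int (Suc N)) (insert (- int (Suc N)) {k. 1 \<le> \<bar>k\<bar> \<and> \<bar>k\<bar> \<le> int N})"
      by auto
    with Suc fin show ?case by (simp add: add_ac)
  qed
  have "{k. \<bar>k\<bar> \<le> int N} = insert 0 {k. 1 \<le> \<bar>k\<bar> \<and> \<bar>k\<bar> \<le> int N}" by auto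
  with 2 fin show "(\<Sum>k | \<bar>k\<bar> \<le> int N. f k) = f 0 + (\<Sum>n<N. f (int (Suc n)) + f (- int (Suc n)))"
    by simp
qed

lemma eventually_at_not_int: "eventually (\<lambda>w::complex. w \<notin> \<int>) (at z)"
proof -
  have "\<not> z islimpt \<int>"
    by (rule discrete_imp_not_islimpt[OF zero_less_one]) (auto elim!: Ints_cases simp: dist_norm norm_of_int simp flip: of_int_diff)
  then show ?thesis
    by (auto simp: islimpt_iff_eventually)
qed

text \<open>The raw formulas behind \<open>M_fun\<close> and \<open>H_partial\<close> are wrong only
  at the integers, which are isolated, so agreement with an entire function elsewhere determines the
  limits there.\<close>

lemma remove_sings_eq_entire:
  assumes "F holomorphic_on UNIV" "\<And>w. w \<notin> \<int> \<Longrightarrow> g w = F w"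
  shows "remove_sings g z = F z"
proof (rule remove_sings_eqI)
  have "F \<midarrow>z\<rightarrow> F z"
    using assms(1) by (metis continuous_on_eq_continuous_at holomorphic_on_imp_continuous_on isCont_def open_UNIV UNIV_I)
  then show "g \<midarrow>z\<rightarrow> F z"
    by (rule Lim_transform_eventually)
       (use eventually_at_not_int[of z] in eventually_elim, simp add: assms(2))
qed

lemma fejer_eq_divide:
  fixes z :: "'a::{real_normed_field,banach}"
  assumes "z \<noteq> of_int k"
  shows "fejer (z - of_int k) = (sin (of_real pi * z) / of_real pi)\<^sup>2 / (z - of_int k)\<^sup>2"
    and "hfejer (z - of_int k) = (sin (of_real pi * z) / of_real pi)\<^sup>2 / (z - of_int k)"
  using assms mult_fejer[of "z - of_int k"] mult_hfejer[of "z - of_int k"]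
  by (simp_all add: sin_sq_diff_int power_divide eq_divide_eq mult_ac)

lemma fejer_pair_int:
  "fejer_pair n z = fejer (z - of_int (int (Suc n))) + fejer (z - of_int (- int (Suc n)))"
  "hfejer_pair n z = hfejer (z - of_int (int (Suc n))) - hfejer (z - of_int (- int (Suc n)))"
  unfolding fejer_pair_def hfejer_pair_def of_int_minus of_int_of_nat_eq diff_minus_eq_add by (rule refl)+

text \<open>The symmetry of \<open>f_fun\<close> is a premise here and is supplied by the locale
  \<open>laplace_measure\<close>. No slope is prescribed at the node 0, where \<open>f_fun\<close>
  may fail to be differentiable.\<close>

lemma H_partial_eq:
  assumes even: "\<And>x. f_fun \<rho> (- x) = f_fun \<rho> x"
    and odd: "\<And>x. x > 0 \<Longrightarrow> deriv (f_fun \<rho>) (- x) = - deriv (f_fun \<rho>) x"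
  shows "H_partial \<rho> N z = of_real (f_fun \<rho> 0) * fejer z +
    (\<Sum>n<N. of_real (f_fun \<rho> (real (Suc n))) * fejer_pair n z
           + of_real (deriv (f_fun \<rho>) (real (Suc n))) * hfejer_pair n z)"
  unfolding H_partial_def
proof (rule remove_sings_eq_entire)
  show "(\<lambda>z. of_real (f_fun \<rho> 0) * fejer z +
    (\<Sum>n<N. of_real (f_fun \<rho> (real (Suc n))) * fejer_pair n z
           + of_real (deriv (f_fun \<rho>) (real (Suc n))) * hfejer_pair n z)) holomorphic_on UNIV"
    by (intro holomorphic_intros)
  fix w :: complex assume "w \<notin> \<int>"
  then have w: "w \<noteq> of_int k" for k by auto
  define P where "P = (sin (of_real pi * w) / of_real pi)\<^sup>2"
  define f where "f = (\<lambda>n::int. complex_of_real (f_fun \<rho> (of_int n)))"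
  define f' where "f' = (\<lambda>n::int. complex_of_real (deriv (f_fun \<rho>) (of_int n)))"
  have "P * ((\<Sum>n | \<bar>n\<bar> \<le> int N. f n / (w - of_int n)\<^sup>2) + (\<Sum>n | 1 \<le> \<bar>n\<bar> \<and> \<bar>n\<bar> \<le> int N. f' n / (w - of_int n)))
    = (\<Sum>n | \<bar>n\<bar> \<le> int N. f n * fejer (w - of_int n)) + (\<Sum>n | 1 \<le> \<bar>n\<bar> \<and> \<bar>n\<bar> \<le> int N. f' n * hfejer (w - of_int n))"
    using w by (simp add: fejer_eq_divide P_def distrib_left sum_distrib_left mult_ac)
  also have "\<dots> = f 0 * fejer w + (\<Sum>n<N. f (int (Suc n)) * fejer_pair n w + f' (int (Suc n)) * hfejer_pair n w)"
  proof -
    have ev: "f (- int (Suc n)) = f (int (Suc n))" "f' (- int (Suc n)) = - f' (int (Suc n))" for n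
      using even[of "of_int (int (Suc n))"] odd[of "of_int (int (Suc n))"]
      by (simp_all add: f_def f'_def)
    show ?thesis
      unfolding sum_int_interval_split fejer_pair_int ev
      by (simp add: algebra_simps sum.distrib sum_subtractf del: of_nat_Suc of_int_of_nat_eq of_int_minus)
  qed
  finally show "P * ((\<Sum>n | \<bar>n\<bar> \<le> int N. f n / (w - of_int n)\<^sup>2) + (\<Sum>n | 1 \<le> \<bar>n\<bar> \<and> \<bar>n\<bar> \<le> int N. f' n / (w - of_int n)))
    = of_real (f_fun \<rho> 0) * fejer w +
    (\<Sum>n<N. of_real (f_fun \<rho> (real (Suc n))) * fejer_pair n w
           + of_real (deriv (f_fun \<rho>) (real (Suc n))) * hfejer_pair n w)"
    by (simp add: f_def f'_def)
qed

text \<open>The Hermite data of \<open>exp (- l * |x|)\<close> at the nodes plus and minus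
  \<open>n + 1\<close>: equal values, opposite slopes. The polymorphic type lets one series serve on
  the real line and in the complex plane.\<close>

definition M_series_term :: "real \<Rightarrow> nat \<Rightarrow> 'a::{real_normed_field,banach} \<Rightarrow> 'a" where
  "M_series_term l n z = of_real (exp (- l * real (Suc n))) * (fejer_pair n z - of_real l * hfejer_pair n z)"

definition M_series :: "real \<Rightarrow> 'a::{real_normed_field,banach} \<Rightarrow> 'a" where
  "M_series l z = fejer z + (\<Sum>n. M_series_term l n z)"

lemma M_series_minus [simp]: "M_series l (- z) = M_series l z"
  by (simp add: M_series_def M_series_term_def)

lemma M_series_term_of_real: "M_series_term l n (of_real x) = of_real (M_series_term l n x)"
  by (simp add: M_series_term_def fejer_pair_of_real hfejer_pair_of_real)

lemma summable_exp_mult: "l > 0 \<Longrightarrow> summable (\<lambda>n. exp (- l * real (Suc n)))"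
proof -
  assume "l > 0"
  have "exp (- l * real (Suc n)) = exp (- l) * exp (- l) ^ n" for n
    by (simp add: exp_of_nat_mult[symmetric] exp_add[symmetric] algebra_simps)
  then show ?thesis
    using \<open>l > 0\<close> by (simp add: summable_mult summable_geometric)
qed

lemma norm_hfejer_pair_le: "norm (hfejer_pair n z) \<le> 2 * growth z"
proof -
  have "norm (hfejer_pair n z) \<le> norm (hfejer (z - of_nat (Suc n))) + norm (hfejer (z + of_nat (Suc n)))"
    unfolding hfejer_pair_def by (rule norm_triangle_ineq4)
  also have "\<dots> \<le> 2 * exp (2 * pi * \<bar>Im z\<bar>)"
    using norm_hfejer_le[of "z - of_nat (Suc n)"] norm_hfejer_le[of "z + of_nat (Suc n)"] by simp
  also have "\<dots> \<le> 2 * growth z" using exp_le_growth[of 0 z] by simp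
  finally show ?thesis .
qed

text \<open>The exponential factor alone makes the series converge, so the kernels are bounded
  trivially. The sum of these bounds blows up as \<open>l\<close> tends to 0, hence the finer
  \<open>norm_H_term_le\<close> later.\<close>

lemma norm_M_series_term_le:
  assumes "l > 0"
  shows "norm (M_series_term l n z) \<le> exp (- l * real (Suc n)) * ((2 + 2 * l) * growth z)"
proof -
  have "2 * growth z / (real (Suc n))\<^sup>2 \<le> 2 * growth z / 1"
    by (intro divide_left_mono) (auto simp: growth_nonneg)
  then have "norm (fejer_pair n z) \<le> 2 * growth z" using norm_fejer_pair_le[of n z] by linarith
  then have "norm (fejer_pair n z - of_real l * hfejer_pair n z) \<le> 2 * growth z + l * (2 * growth z)"
    using norm_hfejer_pair_le[of n z] assms
    by (intro order_trans[OF norm_triangle_ineq4] add_mono) (auto simp: norm_mult intro: mult_left_mono)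
  then have "exp (- l * real (Suc n)) * norm (fejer_pair n z - of_real l * hfejer_pair n z)
      \<le> exp (- l * real (Suc n)) * (2 * growth z + l * (2 * growth z))"
    by (intro mult_left_mono) auto
  also have "2 * growth z + l * (2 * growth z) = (2 + 2 * l) * growth z"
    by (simp add: algebra_simps)
  finally show ?thesis
    unfolding M_series_term_def norm_mult by simp
qed

lemma growth_mono: "norm z \<le> R \<Longrightarrow> growth z \<le> (1 + R) ^ 4 * exp (2 * pi * R)"
  unfolding growth_def using abs_Im_le_cmod[of z]
  by (intro mult_mono power_mono) (auto simp del: exp_le_cancel_iff simp: exp_le_cancel_iff)

lemma holomorphic_suminf:
  fixes f :: "nat \<Rightarrow> complex \<Rightarrow> complex"
  assumes hol: "\<And>n. f n holomorphic_on UNIV"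
    and bound: "\<And>n z. norm (f n z) \<le> B n * growth z" and "summable B"
  shows "(\<lambda>z. \<Sum>n. f n z) holomorphic_on UNIV"
proof (rule holomorphic_uniform_sequence[OF open_UNIV])
  show "(\<lambda>z. \<Sum>n<k. f n z) holomorphic_on UNIV" for k
    by (intro holomorphic_on_sum hol)
  fix x :: complex
  define C where "C = (2 + norm x) ^ 4 * exp (2 * pi * (1 + norm x))"
  have "uniform_limit (cball x 1) (\<lambda>k z. \<Sum>n<k. f n z) (\<lambda>z. \<Sum>n. f n z) sequentially"
  proof (rule Weierstrass_m_test)
    fix n z assume "z \<in> cball x 1"
    then have "norm z \<le> 1 + norm x"
      using norm_triangle_ineq2[of z x] by (simp add: dist_norm norm_minus_commute)
    then have "growth z \<le> C"
      using growth_mono[of z "1 + norm x"] by (simp add: C_def)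
    \<comment> \<open>The bound at \<open>z = 0\<close>, where \<open>growth\<close> is 1, shows
      that \<open>B\<close> is nonnegative.\<close>
    moreover have "B n \<ge> 0"
      using order_trans[OF norm_ge_zero bound[of n 0]] by (simp add: growth_def)
    ultimately show "norm (f n z) \<le> B n * C"
      using bound[of n z] by (meson mult_left_mono order_trans)
  qed (use \<open>summable B\<close> in \<open>intro summable_mult2\<close>)
  then show "\<exists>d>0. cball x d \<subseteq> UNIV \<and> uniform_limit (cball x d) (\<lambda>k z. \<Sum>n<k. f n z) (\<lambda>z. \<Sum>n. f n z) sequentially"
    by (intro exI[of _ 1]) auto
qed

lemma holomorphic_M_series:
  assumes "l > 0"
  shows "(M_series l :: complex \<Rightarrow> complex) holomorphic_on UNIV"
  unfolding M_series_def
proof (intro holomorphic_intros holomorphic_suminf)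
  show "norm (M_series_term l n z) \<le> (exp (- l * real (Suc n)) * (2 + 2 * l)) * growth z" for n and z :: complex
    using norm_M_series_term_le[OF assms, of n z] by (simp add: mult.assoc)
  show "summable (\<lambda>n. exp (- l * real (Suc n)) * (2 + 2 * l))"
    by (intro summable_mult2 summable_exp_mult assms)
  show "(\<lambda>z::complex. M_series_term l n z) holomorphic_on UNIV" for n
    unfolding M_series_term_def by (intro holomorphic_intros)
qed

lemma summable_M_series_term:
  fixes z :: complex
  assumes "l > 0"
  shows "summable (\<lambda>n. norm (M_series_term l n z))"
  by (rule summable_comparison_test'[where N = 0, OF summable_mult2[OF summable_exp_mult[OF assms]]])
     (use norm_M_series_term_le[OF assms, of _ z] in simp)

lemma summable_M_series_term_real:
  fixes x :: real
  assumes "l > 0"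
  shows "summable (\<lambda>n. \<bar>M_series_term l n x\<bar>)"
  using summable_M_series_term[OF assms, of "of_real x"] by (simp add: M_series_term_of_real)

lemma M_series_of_real:
  assumes "l > 0"
  shows "M_series l (complex_of_real x) = of_real (M_series l x)"
  unfolding M_series_def M_series_term_of_real fejer_of_real of_real_add
  using suminf_of_real[OF summable_rabs_cancel[OF summable_M_series_term_real[OF assms, of x]], where 'a = complex] by simp

lemma M_fun_eq:
  assumes "l > 0"
  shows "M_fun l z = M_series l z"
  unfolding M_fun_def
proof (rule remove_sings_eq_entire[OF holomorphic_M_series[OF assms]])
  fix w :: complex assume "w \<notin> \<int>"
  then have w: "w \<noteq> of_int k" for k by auto
  define P where "P = (sin (of_real pi * w) / of_real pi)\<^sup>2"
  define f where "f = (\<lambda>k::int. complex_of_real (exp (- l * \<bar>of_int k\<bar>)) / (w - of_int k)\<^sup>2)"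
  define g where "g = (\<lambda>k::int. complex_of_real (sgn (of_int k) * exp (- l * \<bar>of_int k\<bar>)) / (w - of_int k))"
  \<comment> \<open>The choices of \<open>s\<close> and \<open>j\<close> cover both halves of the
    integers and both powers in the denominator. Eventually \<open>norm (w + s * n)\<close> is at
    least 1, which leaves the exponential as a majorant.\<close>
  have nz: "(\<lambda>n. exp (- l * real n) * norm (1 / (w + s * of_nat n) ^ j)) sums (\<Sum>n. exp (- l * real n) * norm (1 / (w + s * of_nat n) ^ j))"
    if "s = 1 \<or> s = - 1" "j = 1 \<or> j = 2" for j s
  proof (rule summable_sums, rule summable_comparison_test_ev)
    have "filterlim (\<lambda>n. w + s * of_nat n) at_infinity sequentially"
      using that by (intro tendsto_add_filterlim_at_infinity[OF tendsto_const] tendsto_mult_filterlim_at_infinity[OF tendsto_const] tendsto_of_nat) auto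
    then have "eventually (\<lambda>n. norm (w + s * of_nat n) \<ge> 1) sequentially"
      by (auto simp: filterlim_at_infinity[where c = 0])
    then show "\<forall>\<^sub>F n in sequentially. norm (exp (- l * real n) * norm (1 / (w + s * of_nat n) ^ j)) \<le> exp (- l * real n)"
    proof eventually_elim
      case (elim n)
      then have "norm (w + s * of_nat n) ^ j \<ge> 1" by (rule one_le_power)
      then show ?case by (simp add: norm_divide norm_power field_simps)
    qed
    show "summable (\<lambda>n. exp (- l * real n))"
      using summable_exp_mult[OF assms] by (subst summable_Suc_iff[symmetric])
  qed
  have "f summable_on UNIV"
    by (rule summable_on_int_norm)
       (use nz[of "-1" 2] nz[of 1 2] in \<open>auto simp: f_def norm_divide norm_power sums_iff\<close>)
  then have f: "(f has_sum infsum f UNIV) UNIV" by simp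
  have "g summable_on UNIV"
  proof (rule summable_on_int_norm)
    show "summable (\<lambda>n. norm (g (int n)))"
      by (rule summable_comparison_test'[OF sums_summable[OF nz[of "-1" 1]], of 0])
         (auto simp: g_def norm_divide norm_mult sgn_if)
    show "summable (\<lambda>n. norm (g (- int n)))"
      by (rule summable_comparison_test'[OF sums_summable[OF nz[of "1" 1]], of 0])
         (auto simp: g_def norm_divide norm_mult sgn_if)
  qed
  then have g: "(g has_sum infsum g UNIV) UNIV" by simp
  have "(\<lambda>n. P * ((f (int (Suc n)) + f (- int (Suc n))) - of_real l * (g (int (Suc n)) + g (- int (Suc n)))))
      sums (P * ((infsum f UNIV - f 0) - of_real l * (infsum g UNIV - g 0)))"
    by (intro sums_mult sums_diff has_sum_int_split f g)
  also have "(\<lambda>n. P * ((f (int (Suc n)) + f (- int (Suc n))) - of_real l * (g (int (Suc n)) + g (- int (Suc n)))))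
     = (\<lambda>n. M_series_term l n w)"
  proof
    fix n
    have Pf: "P * f k = of_real (exp (- l * \<bar>of_int k\<bar>)) * fejer (w - of_int k)"
      and Pg: "P * g k = of_real (sgn (of_int k) * exp (- l * \<bar>of_int k\<bar>)) * hfejer (w - of_int k)" for k
      unfolding f_def g_def P_def fejer_eq_divide[OF w] by simp_all
    have "P * ((f (int (Suc n)) + f (- int (Suc n))) - of_real l * (g (int (Suc n)) + g (- int (Suc n))))
      = (P * f (int (Suc n)) + P * f (- int (Suc n))) - of_real l * (P * g (int (Suc n)) + P * g (- int (Suc n)))"
      by (simp add: algebra_simps)
    also have "\<dots> = M_series_term l n w"
      unfolding Pf Pg M_series_term_def fejer_pair_int
      by (simp add: algebra_simps del: of_nat_Suc)
    finally show "P * ((f (int (Suc n)) + f (- int (Suc n))) - of_real l * (g (int (Suc n)) + g (- int (Suc n)))) = M_series_term l n w" .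
  qed
  finally have "(\<Sum>n. M_series_term l n w) = P * ((infsum f UNIV - f 0) - of_real l * (infsum g UNIV - g 0))"
    by (simp add: sums_iff)
  \<comment> \<open>\<open>sgn 0 = 0\<close> removes the slope at the node 0, so only
    \<open>fejer w\<close> remains there.\<close>
  moreover have "g 0 = 0" "P * f 0 = fejer w"
    using fejer_eq_divide(1)[OF w[of 0]] by (simp_all add: g_def f_def P_def)
  ultimately show "P * (infsum f UNIV - of_real l * infsum g UNIV) = M_series l w"
    by (simp add: M_series_def algebra_simps)
qed

section \<open>The partial fraction expansion of the squared cosecant\<close>

text \<open>Logarithmic derivative of the reflection formula for the Gamma function; on the unit
  interval all factors are positive, so the logarithm splits.\<close>

lemma Digamma_reflection_real:
  assumes "0 < x" "x < (1::real)"
  shows "Digamma x - Digamma (1 - x) = - pi * cos (pi * x) / sin (pi * x)"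
proof -
  have refl: "ln_Gamma y + ln_Gamma (1 - y) = ln pi - ln (sin (pi * y))" if "0 < y" "y < 1" for y :: real
  proof -
    have s: "sin (pi * y) > 0" using that by (intro sin_gt_zero) auto
    have "complex_of_real (Gamma y * Gamma (1 - y)) = of_real (pi / sin (pi * y))"
      using Gamma_reflection_complex[of "of_real y"] Gamma_complex_of_real[of y] Gamma_complex_of_real[of "1 - y"]
      by (simp add: sin_of_real flip: of_real_mult)
    then have *: "Gamma y * Gamma (1 - y) = pi / sin (pi * y)"
      by (simp only: of_real_eq_iff)
    have pos: "Gamma y \<noteq> 0" "Gamma (1 - y) \<noteq> 0"
      using that Gamma_real_pos[of y] Gamma_real_pos[of "1 - y"] by linarith+
    have "ln_Gamma y + ln_Gamma (1 - y) = ln (Gamma y * Gamma (1 - y))"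
      using that pos by (simp add: ln_mult ln_Gamma_real_pos)
    also have "\<dots> = ln pi - ln (sin (pi * y))"
      unfolding * using s by (simp add: ln_div)
    finally show ?thesis .
  qed
  have s: "sin (pi * x) > 0" using assms by (intro sin_gt_zero) auto
  have "((\<lambda>y. ln_Gamma y + ln_Gamma (1 - y)) has_real_derivative (Digamma x - Digamma (1 - x))) (at x)"
    using assms by (auto intro!: derivative_eq_intros)
  moreover have "((\<lambda>y. ln pi - ln (sin (pi * y))) has_real_derivative (- pi * cos (pi * x) / sin (pi * x))) (at x)"
    using s by (auto intro!: derivative_eq_intros simp: field_simps)
  then have "((\<lambda>y. ln_Gamma y + ln_Gamma (1 - y)) has_real_derivative (- pi * cos (pi * x) / sin (pi * x))) (at x)"
    by (rule has_field_derivative_transform_within_open[where S = "{0<..<1}"]) (use assms refl in auto)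
  ultimately show ?thesis by (rule DERIV_unique)
qed

lemma Trigamma_reflection_real:
  assumes "0 < x" "x < (1::real)"
  shows "Polygamma 1 x + Polygamma 1 (1 - x) = (pi / sin (pi * x))\<^sup>2"
proof -
  have s: "sin (pi * x) > 0" using assms by (intro sin_gt_zero) auto
  have "((\<lambda>y. Digamma y - Digamma (1 - y)) has_real_derivative (Polygamma 1 x + Polygamma 1 (1 - x))) (at x)"
    using assms by (auto intro!: derivative_eq_intros dest: nonpos_Ints_nonpos)
  moreover have "((\<lambda>y. - pi * cos (pi * y) / sin (pi * y)) has_real_derivative (pi / sin (pi * x))\<^sup>2) (at x)"
  proof -
    define S C where "S = sin (pi * x)" and "C = cos (pi * x)"
    have SC: "C * C = 1 - S * S" "S > 0"
      using sin_cos_squared_add[of "pi * x"] s by (simp_all add: S_def C_def power2_eq_square)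
    have "((\<lambda>y. - pi * cos (pi * y) / sin (pi * y)) has_real_derivative
        (pi * (pi * S) * S + pi * C * (pi * C)) / (S * S)) (at x)"
      using s unfolding S_def C_def by (auto intro!: derivative_eq_intros simp: field_simps)
    moreover have "(pi * (pi * S) * S + pi * C * (pi * C)) / (S * S) = pi * pi * (S * S + C * C) / (S * S)"
      by (simp add: algebra_simps)
    ultimately show ?thesis
      using SC by (simp add: S_def power_divide power2_eq_square)
  qed
  then have "((\<lambda>y. Digamma y - Digamma (1 - y)) has_real_derivative (pi / sin (pi * x))\<^sup>2) (at x)"
    by (rule has_field_derivative_transform_within_open[where S = "{0<..<1}"])
       (use assms Digamma_reflection_real in auto)
  ultimately show ?thesis by (rule DERIV_unique)
qed

text \<open>By periodicity \<open>x\<close> may be replaced by its fractional part \<open>y\<close>.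
  The nodes \<open>k \<le> 0\<close> and \<open>k \<ge> 1\<close> then give the trigamma series at
  \<open>y\<close> and at \<open>1 - y\<close>, joined by the reflection formula.\<close>

lemma cosecant_squared_has_sum:
  fixes x :: real
  assumes "x \<notin> \<int>"
  shows "((\<lambda>k::int. 1 / (x - of_int k)\<^sup>2) has_sum (pi / sin (pi * x))\<^sup>2) UNIV"
proof -
  define y where "y = frac x"
  have y: "0 < y" "y < 1"
    using assms by (auto simp: y_def frac_lt_1 frac_gt_0_iff)
  have "((\<lambda>n. inverse ((y + real n)\<^sup>2)) has_sum Polygamma 1 y) UNIV"
    using Polygamma_LIMSEQ[of y 1] y by (intro sums_nonneg_imp_has_sum) (auto simp: numeral_2_eq_2)
  also have "?this \<longleftrightarrow> ((\<lambda>k::int. 1 / (y - of_int k)\<^sup>2) has_sum Polygamma 1 y) {..0}"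
    by (rule has_sum_reindex_bij_witness[of _ "\<lambda>k. nat (- k)" "\<lambda>n. - int n"])
       (auto simp: inverse_eq_divide)
  finally have 1: "((\<lambda>k::int. 1 / (y - of_int k)\<^sup>2) has_sum Polygamma 1 y) {..0}" .
  have "((\<lambda>n. inverse ((1 - y + real n)\<^sup>2)) has_sum Polygamma 1 (1 - y)) UNIV"
    using Polygamma_LIMSEQ[of "1 - y" 1] y by (intro sums_nonneg_imp_has_sum) (auto simp: numeral_2_eq_2)
  also have "?this \<longleftrightarrow> ((\<lambda>k::int. 1 / (y - of_int k)\<^sup>2) has_sum Polygamma 1 (1 - y)) {1..}"
  proof (rule has_sum_reindex_bij_witness[of _ "\<lambda>k. nat (k - 1)" "\<lambda>n. int n + 1"])
    show "1 / (y - of_int (int n + 1))\<^sup>2 = inverse ((1 - y + real n)\<^sup>2)" for n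
      using power2_commute[of y "1 + real n"] by (simp add: inverse_eq_divide algebra_simps)
  qed auto
  finally have 2: "((\<lambda>k::int. 1 / (y - of_int k)\<^sup>2) has_sum Polygamma 1 (1 - y)) {1..}" .
  have disj: "{..0} \<inter> {1..} = ({} :: int set)" by auto
  have "((\<lambda>k::int. 1 / (y - of_int k)\<^sup>2) has_sum (pi / sin (pi * y))\<^sup>2) ({..0} \<union> {1..})"
    using has_sum_Un_disjoint[OF 1 2 disj] Trigamma_reflection_real[OF y] by auto
  also have "{..0} \<union> {1..} = (UNIV :: int set)" by auto
  also have "((\<lambda>k::int. 1 / (y - of_int k)\<^sup>2) has_sum (pi / sin (pi * y))\<^sup>2) UNIV \<longleftrightarrow>
      ((\<lambda>k::int. 1 / (x - of_int k)\<^sup>2) has_sum (pi / sin (pi * y))\<^sup>2) UNIV"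
    by (rule has_sum_reindex_bij_witness[of _ "\<lambda>k. k - \<lfloor>x\<rfloor>" "\<lambda>k. k + \<lfloor>x\<rfloor>"])
       (auto simp: y_def frac_def algebra_simps)
  also have "(pi / sin (pi * y))\<^sup>2 = (pi / sin (pi * x))\<^sup>2"
    using sin_sq_diff_int[of x "\<lfloor>x\<rfloor>"] by (simp add: y_def frac_def power_divide)
  finally show ?thesis .
qed

lemma sin_pi_nonzero: "x \<notin> \<int> \<Longrightarrow> sin (pi * x) \<noteq> 0"
proof
  assume "x \<notin> \<int>" "sin (pi * x) = 0"
  then obtain i where "pi * x = of_int i * pi" using sin_zero_iff_int2 by metis
  then have "x = of_int i" by simp
  with \<open>x \<notin> \<int>\<close> show False by auto
qed

lemma nsinc_of_int: "nsinc (of_int k :: real) = (if k = 0 then 1 else 0)"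
  using sin_npi_int[of k] by (simp add: nsinc_def mult.commute)

text \<open>Off the integers this is the cosecant expansion times
  \<open>(sin (pi * x) / pi)^2\<close>; at an integer only one translate survives. In other words,
  Hermite interpolation reproduces constants, which lets the normalisation \<open>exp (- l)\<close>
  pass through the series.\<close>

lemma fejer_has_sum: "((\<lambda>k. fejer (x - of_int k)) has_sum 1) UNIV" for x :: real
proof (cases "x \<in> \<int>")
  case True
  then obtain j where j: "x = of_int j" by (auto elim: Ints_cases)
  have "((\<lambda>k. fejer (x - of_int k)) has_sum 1) {j}"
    by (intro has_sum_finiteI) (simp_all add: j fejer_def)
  also have "?this \<longleftrightarrow> ((\<lambda>k. fejer (x - of_int k)) has_sum 1) UNIV"
    by (rule has_sum_cong_neutral) (auto simp: j fejer_def nsinc_of_int simp flip: of_int_diff)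
  finally show ?thesis .
next
  case False
  then have "x \<noteq> of_int k" for k by auto
  then have "fejer (x - of_int k) = (sin (pi * x) / pi)\<^sup>2 * (1 / (x - of_int k)\<^sup>2)" for k
    using fejer_eq_divide[of x k] by simp
  moreover have "(sin (pi * x) / pi)\<^sup>2 * (pi / sin (pi * x))\<^sup>2 = 1"
    using sin_pi_nonzero[OF False] by (simp add: field_simps)
  ultimately show ?thesis
    using has_sum_cmult_right[OF cosecant_squared_has_sum[OF False], of "(sin (pi * x) / pi)\<^sup>2"] by simp
qed

lemma fejer_pair_sums: "(\<lambda>n. fejer_pair n x) sums (1 - fejer x)" for x :: real
  using has_sum_int_split[OF fejer_has_sum[of x]] unfolding fejer_pair_int by simp

text \<open>The function is \<open>v * coth (v / 2)\<close>; the numerator of its derivative is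
  \<open>2 * exp (- v) * (sinh v - v)\<close>.\<close>

lemma mult_coth_mono:
  fixes a b :: real
  assumes "0 < a" "a \<le> b"
  shows "a * (1 + exp (- a)) / (1 - exp (- a)) \<le> b * (1 + exp (- b)) / (1 - exp (- b))"
proof (rule DERIV_nonneg_imp_nondecreasing[OF assms(2)])
  fix v assume "a \<le> v" "v \<le> b"
  then have v: "v > 0" using assms by simp
  then have e: "exp (- v) < 1" by simp
  have "((\<lambda>v. v * (1 + exp (- v)) / (1 - exp (- v))) has_real_derivative
      (1 - exp (- v) * exp (- v) - 2 * v * exp (- v)) / (1 - exp (- v))\<^sup>2) (at v)"
    using e by (auto intro!: derivative_eq_intros simp: power2_eq_square field_simps)
  moreover have "1 - exp (- v) * exp (- v) - 2 * v * exp (- v) \<ge> 0"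
  proof -
    have "sinh 0 - 0 \<le> sinh v - v"
    proof (rule DERIV_nonneg_imp_nondecreasing[of 0 v "\<lambda>v. sinh v - v"])
      show "\<exists>y. ((\<lambda>v. sinh v - v) has_real_derivative y) (at w) \<and> 0 \<le> y" for w :: real
        by (intro exI[of _ "cosh w - 1"] conjI) (auto intro!: derivative_eq_intros simp: cosh_real_ge_1)
    qed (use v in simp)
    then have "v \<le> sinh v" by simp
    then have "exp (- v) * (2 * v) \<le> exp (- v) * (exp v - exp (- v))"
      by (intro mult_left_mono) (auto simp: sinh_field_def)
    then show ?thesis by (simp add: algebra_simps flip: exp_add)
  qed
  ultimately show "\<exists>y. ((\<lambda>v. v * (1 + exp (- v)) / (1 - exp (- v))) has_real_derivative y) (at v) \<and> 0 \<le> y"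
    by (intro exI conjI) auto
qed

text \<open>The generating function of the Bernoulli numbers with \<open>B_1 = 1/2\<close>. Division
  by zero gives it the value 0 at 0 instead of the limit 1; the comparison below leaves that point
  out.\<close>

definition bernoulli_gen :: "real \<Rightarrow> real" where
  "bernoulli_gen u = u / (1 - exp (- u))"

lemma bernoulli_gen_minus: "bernoulli_gen (- u) = bernoulli_gen u - u"
proof (cases "u = 0")
  case False
  then have "1 - exp u \<noteq> 0" "1 - exp (- u) \<noteq> 0" by auto
  then show ?thesis
    by (simp add: bernoulli_gen_def field_simps exp_minus)
qed (simp add: bernoulli_gen_def)

lemma bernoulli_gen_conv: "u \<noteq> 0 \<Longrightarrow> 2 * bernoulli_gen u = u + u * (1 + exp (- u)) / (1 - exp (- u))"
  by (simp add: bernoulli_gen_def field_simps)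

text \<open>Symmetrising via \<open>B(u) = u / 2 + (u / 2) coth (u / 2)\<close>, this says that \<open>u coth (u / 2)\<close> is
  increasing in \<open>\<bar>u\<bar>\<close>.\<close>

lemma bernoulli_gen_le:
  assumes "0 \<le> t" "0 < l" "t \<noteq> l"
  shows "bernoulli_gen (t - l) \<le> bernoulli_gen (t + l) - l"
proof -
  define v where "v = \<bar>t - l\<bar>"
  have v: "0 < v" "v \<le> t + l" using assms by (auto simp: v_def)
  have "2 * bernoulli_gen (t - l) = (t - l) + v * (1 + exp (- v)) / (1 - exp (- v))"
  proof (cases "t > l")
    case True
    then show ?thesis using bernoulli_gen_conv[of v] by (simp add: v_def)
  next
    case False
    then have "t - l = - v" using assms by (simp add: v_def)
    then show ?thesis using bernoulli_gen_conv[of v] v by (simp add: bernoulli_gen_minus)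
  qed
  also have "\<dots> \<le> (t - l) + (t + l) * (1 + exp (- (t + l))) / (1 - exp (- (t + l)))"
    using mult_coth_mono[OF v] by simp
  also have "\<dots> = 2 * (bernoulli_gen (t + l) - l)"
    using bernoulli_gen_conv[of "t + l"] assms by simp
  finally show ?thesis by simp
qed

section \<open>Nonnegativity\<close>

lemma nn_integral_exp_linear:
  assumes "a > 0" "c \<ge> 0"
  shows "(\<integral>\<^sup>+t. ennreal ((t + c) * exp (- a * t)) * indicator {0..} t \<partial>lborel) = ennreal (1 / a\<^sup>2 + c / a)"
proof -
  define F where "F = (\<lambda>t. - ((t + c) / a + 1 / a\<^sup>2) * exp (- a * t))"
  have "(\<integral>\<^sup>+t. ennreal ((t + c) * exp (- a * t)) * indicator {0..} t \<partial>lborel) = ennreal (0 - F 0)"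
  proof (rule nn_integral_FTC_atLeast)
    show "(F has_real_derivative (t + c) * exp (- a * t)) (at t)" for t
      using assms unfolding F_def
      by (auto intro!: derivative_eq_intros simp: field_simps power2_eq_square)
    show "(F \<longlongrightarrow> 0) at_top"
      using assms unfolding F_def by real_asymp
  qed (use assms in auto)
  then show ?thesis by (simp add: F_def add.commute)
qed

lemma nn_integral_exp_shifted:
  assumes "a > 0" "l \<ge> 0"
  shows "(\<integral>\<^sup>+t. ennreal ((t - l) * exp (- a * (t - l))) * indicator {l..} t \<partial>lborel) = ennreal (1 / a\<^sup>2)"
proof -
  define F where "F = (\<lambda>t. - ((t - l) / a + 1 / a\<^sup>2) * exp (- a * (t - l)))"
  have "(\<integral>\<^sup>+t. ennreal ((t - l) * exp (- a * (t - l))) * indicator {l..} t \<partial>lborel) = ennreal (0 - F l)"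
  proof (rule nn_integral_FTC_atLeast)
    show "(F has_real_derivative (t - l) * exp (- a * (t - l))) (at t)" for t
      using assms unfolding F_def
      by (auto intro!: derivative_eq_intros simp: field_simps power2_eq_square)
    show "(F \<longlongrightarrow> 0) at_top"
      using assms unfolding F_def by real_asymp
  qed (use assms in auto)
  then show ?thesis by (simp add: F_def)
qed

text \<open>Here \<open>b\<close> will be \<open>k - x\<close> for a node \<open>k\<close>, of
  either sign, which is harmless on a bounded interval. Nonnegativity is the monotonicity of the
  antiderivative; it keeps \<open>ennreal\<close> from truncating.\<close>

lemma
  assumes "b \<noteq> 0" "l \<ge> (0::real)"
  shows nn_integral_exp_Icc: "(\<integral>\<^sup>+t. ennreal ((l - t) * exp (- b * (l - t))) * indicator {0..l} t \<partial>lborel) =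
      ennreal (1 / b\<^sup>2 - exp (- b * l) * (1 / b\<^sup>2 + l / b))" (is ?int)
    and exp_Icc_nonneg: "0 \<le> 1 / b\<^sup>2 - exp (- b * l) * (1 / b\<^sup>2 + l / b)" (is ?nonneg)
proof -
  define F where "F = (\<lambda>t. ((l - t) / b + 1 / b\<^sup>2) * exp (- b * (l - t)))"
  have F: "(F has_real_derivative (l - t) * exp (- b * (l - t))) (at t)" for t
    using assms unfolding F_def
    by (auto intro!: derivative_eq_intros simp: field_simps power2_eq_square)
  have "(\<integral>\<^sup>+t. ennreal ((l - t) * exp (- b * (l - t))) * indicator {0..l} t \<partial>lborel) = ennreal (F l - F 0)"
    by (rule nn_integral_FTC_Icc[OF _ F]) (use assms in auto)
  then show ?int by (simp add: F_def algebra_simps)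
  have "F 0 \<le> F l"
    by (rule DERIV_nonneg_imp_nondecreasing[OF assms(2)]) (use F in force)
  then show ?nonneg by (simp add: F_def algebra_simps)
qed

lemma geometric_sums_exp:
  assumes "u > 0"
  shows "(\<lambda>m. exp (- real m * u)) sums (1 / (1 - exp (- u)))"
proof -
  have "exp (- real m * u) = exp (- u) ^ m" for m
    by (simp flip: exp_of_nat_mult)
  then show ?thesis using geometric_sums[of "exp (- u)"] assms by simp
qed

lemma bernoulli_gen_sums_pos:
  assumes "u > 0"
  shows "(\<lambda>m. u * exp (- real m * u)) sums bernoulli_gen u"
  using sums_mult[OF geometric_sums_exp[OF assms], of u] by (simp add: bernoulli_gen_def)

text \<open>The symmetry \<open>B (- u) = B u - u\<close> removes exactly the term
  \<open>m = 0\<close> of the geometric series.\<close>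

lemma bernoulli_gen_sums_neg:
  assumes "u > 0"
  shows "(\<lambda>m. u * exp (- real (Suc m) * u)) sums bernoulli_gen (- u)"
proof -
  have "(\<lambda>m. u * exp (- real m * u)) sums (bernoulli_gen (- u) + u * exp (- real 0 * u))"
    using bernoulli_gen_sums_pos[OF assms] by (simp add: bernoulli_gen_minus)
  then show ?thesis by (subst sums_Suc_iff)
qed

text \<open>The subtracted \<open>l\<close> is absorbed into the term \<open>m = 0\<close>, turning
  \<open>t + l\<close> into \<open>t\<close>, so all terms stay nonnegative for
  \<open>t \<ge> 0\<close>.\<close>

lemma bernoulli_gen_sums_shift:
  assumes "t + l > 0"
  shows "(\<lambda>m. (t + (if m = 0 then 0 else l)) * exp (- real m * (t + l))) sums (bernoulli_gen (t + l) - l)"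
proof -
  have "(\<lambda>m. (t + l) * exp (- real m * (t + l)) - (if m = 0 then l else 0)) sums (bernoulli_gen (t + l) - l)"
    by (intro sums_diff bernoulli_gen_sums_pos assms) (use sums_single[of 0 "\<lambda>_. l"] in simp)
  also have "(\<lambda>m. (t + l) * exp (- real m * (t + l)) - (if m = 0 then l else 0)) =
      (\<lambda>m. (t + (if m = 0 then 0 else l)) * exp (- real m * (t + l)))"
    by auto
  finally show ?thesis .
qed

lemma suminf_ennreal_sums: "f sums s \<Longrightarrow> (\<And>n. 0 \<le> f n) \<Longrightarrow> (\<Sum>n. ennreal (f n)) = ennreal s"
  by (metis suminf_ennreal2 sums_iff)

text \<open>With \<open>B(u) = u / (1 - exp (- u))\<close>, the left-hand side is the Laplace transform of
  \<open>B(t - l)\<close> at \<open>x\<close> and the right-hand side is that of \<open>B(t + l) - l\<close>.\<close>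

lemma laplace_sums_le:
  fixes l x :: real
  assumes l: "l > 0" and x: "x > 0" "x \<notin> \<int>"
  defines "\<alpha> \<equiv> (\<lambda>m. exp (- l * real m) * (1 / (x + real m)\<^sup>2 + (if m = 0 then 0 else l) / (x + real m)))"
  defines "\<beta> \<equiv> (\<lambda>m. exp (- l * x) / (x - real (Suc m))\<^sup>2
      - exp (- l * real (Suc m)) * (1 / (x - real (Suc m))\<^sup>2 - l / (x - real (Suc m))))"
  defines "\<gamma> \<equiv> (\<lambda>m. exp (- l * x) / (x + real m)\<^sup>2)"
  assumes a: "\<alpha> sums a" and b: "\<beta> sums b" and c: "\<gamma> sums c"
  shows "b + c \<le> a"
proof -
  define E where "E = (\<lambda>t. exp (- x * t))"
  \<comment> \<open>Termwise expansions, times \<open>exp (- x * t)\<close>: \<open>f1\<close> of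
    \<open>B (t + l) - l\<close>, \<open>f2\<close> of \<open>B (t - l)\<close> for
    \<open>t > l\<close>, and \<open>f3\<close> of the same function for \<open>t < l\<close>. Their
    integrals over the respective ranges are \<alpha>, \<gamma> and \<beta>.\<close>
  define f1 where "f1 = (\<lambda>m t. (t + (if m = 0 then 0 else l)) * exp (- real m * (t + l)) * E t)"
  define f2 where "f2 = (\<lambda>m t. (t - l) * exp (- real m * (t - l)) * E t)"
  define f3 where "f3 = (\<lambda>m t. (l - t) * exp (- real (Suc m) * (l - t)) * E t)"
  define g1 where "g1 = (\<lambda>m t. ennreal (f1 m t) * indicator {0..} t)"
  define g2 where "g2 = (\<lambda>m t. ennreal (f2 m t) * indicator {l..} t)"
  define g3 where "g3 = (\<lambda>m t. ennreal (f3 m t) * indicator {0..l} t)"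
  have Epos: "E t > 0" for t by (simp add: E_def)
  have meas [measurable]: "g1 m \<in> borel_measurable lborel" "g2 m \<in> borel_measurable lborel" "g3 m \<in> borel_measurable lborel" for m
    by (simp_all add: g1_def g2_def g3_def f1_def f2_def f3_def E_def)
  have x': "x \<noteq> real (Suc m)" for m
    using x(2) by (metis Ints_of_nat)
  have i1: "(\<integral>\<^sup>+t. g1 m t \<partial>lborel) = ennreal (\<alpha> m)" for m
  proof -
    define c where "c = (if m = 0 then 0 else l)"
    have "f1 m t = exp (- l * real m) * ((t + c) * exp (- (x + real m) * t))" for t
      by (simp add: f1_def E_def c_def algebra_simps flip: exp_add)
    then have "g1 m = (\<lambda>t. ennreal (exp (- l * real m)) * (ennreal ((t + c) * exp (- (x + real m) * t)) * indicator {0..} t))"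
      by (simp add: g1_def ennreal_mult' mult.assoc)
    then have "(\<integral>\<^sup>+t. g1 m t \<partial>lborel) = ennreal (exp (- l * real m)) * ennreal (1 / (x + real m)\<^sup>2 + c / (x + real m))"
      using nn_integral_exp_linear[of "x + real m" c] x l by (simp add: nn_integral_cmult c_def)
    then show ?thesis by (simp add: \<alpha>_def c_def ennreal_mult')
  qed
  have i2: "(\<integral>\<^sup>+t. g2 m t \<partial>lborel) = ennreal (\<gamma> m)" for m
  proof -
    have "f2 m t = exp (- l * x) * ((t - l) * exp (- (x + real m) * (t - l)))" for t
      by (simp add: f2_def E_def algebra_simps flip: exp_add)
    then have "g2 m = (\<lambda>t. ennreal (exp (- l * x)) * (ennreal ((t - l) * exp (- (x + real m) * (t - l))) * indicator {l..} t))"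
      by (simp add: g2_def ennreal_mult' mult.assoc)
    then have "(\<integral>\<^sup>+t. g2 m t \<partial>lborel) = ennreal (exp (- l * x)) * ennreal (1 / (x + real m)\<^sup>2)"
      using nn_integral_exp_shifted[of "x + real m" l] x l by (simp add: nn_integral_cmult)
    then show ?thesis by (simp add: \<gamma>_def flip: ennreal_mult')
  qed
  have \<beta>: "\<beta> m = exp (- l * x) * (1 / (real (Suc m) - x)\<^sup>2 - exp (- (real (Suc m) - x) * l) * (1 / (real (Suc m) - x)\<^sup>2 + l / (real (Suc m) - x)))" for m
  proof -
    define k where "k = real (Suc m)"
    have "l / (x - k) = - (l / (k - x))"
      by (metis minus_diff_eq minus_divide_right)
    moreover have "exp (- l * x) * exp (- (k - x) * l) = exp (- l * k)"
      by (simp add: algebra_simps flip: exp_add)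
    ultimately show ?thesis
      unfolding \<beta>_def k_def[symmetric] power2_commute[of x k] by (simp add: right_diff_distrib mult.assoc[symmetric])
  qed
  have i3: "(\<integral>\<^sup>+t. g3 m t \<partial>lborel) = ennreal (\<beta> m)" for m
  proof -
    define k where "k = real (Suc m)"
    have k: "k - x \<noteq> 0" using x'[of m] by (simp add: k_def)
    have "f3 m t = exp (- l * x) * ((l - t) * exp (- (k - x) * (l - t)))" for t
      by (simp add: f3_def E_def k_def algebra_simps flip: exp_add)
    then have "g3 m = (\<lambda>t. ennreal (exp (- l * x)) * (ennreal ((l - t) * exp (- (k - x) * (l - t))) * indicator {0..l} t))"
      by (simp add: g3_def ennreal_mult' mult.assoc)
    then have "(\<integral>\<^sup>+t. g3 m t \<partial>lborel) = ennreal (exp (- l * x)) * ennreal (1 / (k - x)\<^sup>2 - exp (- (k - x) * l) * (1 / (k - x)\<^sup>2 + l / (k - x)))"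
      using nn_integral_exp_Icc[OF k, of l] l by (simp add: nn_integral_cmult)
    then show ?thesis by (simp add: \<beta> k_def ennreal_mult')
  qed
  have nonneg: "\<alpha> m \<ge> 0" "\<beta> m \<ge> 0" "\<gamma> m \<ge> 0" for m
    using l x exp_Icc_nonneg[of "real (Suc m) - x" l] x'[of m] by (auto simp: \<alpha>_def \<beta> \<gamma>_def)
  \<comment> \<open>\<open>bernoulli_gen_le\<close> leaves out this point, which has measure
    zero.\<close>
  have "AE t in lborel. t \<noteq> l"
    by (rule AE_lborel_singleton)
  then have "(\<integral>\<^sup>+t. (\<Sum>m. g3 m t) + (\<Sum>m. g2 m t) \<partial>lborel) \<le> (\<integral>\<^sup>+t. (\<Sum>m. g1 m t) \<partial>lborel)"
  proof (intro nn_integral_mono_AE, eventually_elim)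
    case (elim t)
    have s1: "(\<Sum>m. g1 m t) = ennreal ((bernoulli_gen (t + l) - l) * E t)" if "t \<ge> 0"
    proof -
      have "(\<Sum>m. ennreal (f1 m t)) = ennreal ((bernoulli_gen (t + l) - l) * E t)"
        using that l Epos[of t] unfolding f1_def
        by (intro suminf_ennreal_sums sums_mult2 bernoulli_gen_sums_shift) auto
      then show ?thesis using that by (simp add: g1_def)
    qed
    consider "t < 0" | "0 \<le> t" "t < l" | "t > l" using elim by linarith
    then show ?case
    proof cases
      case 1
      then show ?thesis using l by (simp add: g1_def g2_def g3_def)
    next
      case 2
      have "(\<Sum>m. ennreal (f3 m t)) = ennreal (bernoulli_gen (- (l - t)) * E t)"
        using 2 Epos[of t] unfolding f3_def
        by (intro suminf_ennreal_sums sums_mult2 bernoulli_gen_sums_neg) auto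
      moreover have "g2 m t = 0" "g3 m t = ennreal (f3 m t)" for m
        using 2 by (auto simp: g2_def g3_def)
      ultimately have "(\<Sum>m. g3 m t) + (\<Sum>m. g2 m t) = ennreal (bernoulli_gen (t - l) * E t)" by simp
      also have "\<dots> \<le> (\<Sum>m. g1 m t)"
        unfolding s1[OF 2(1)] using bernoulli_gen_le[of t l] 2 l Epos[of t]
        by (intro ennreal_leI mult_right_mono) auto
      finally show ?thesis .
    next
      case 3
      have "(\<Sum>m. ennreal (f2 m t)) = ennreal (bernoulli_gen (t - l) * E t)"
        using 3 Epos[of t] unfolding f2_def
        by (intro suminf_ennreal_sums sums_mult2 bernoulli_gen_sums_pos) auto
      moreover have "g3 m t = 0" "g2 m t = ennreal (f2 m t)" for m
        using 3 l by (auto simp: g2_def g3_def)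
      ultimately have "(\<Sum>m. g3 m t) + (\<Sum>m. g2 m t) = ennreal (bernoulli_gen (t - l) * E t)" by simp
      also have "\<dots> \<le> (\<Sum>m. g1 m t)"
        using s1 bernoulli_gen_le[of t l] 3 l Epos[of t]
        by (auto intro!: ennreal_leI mult_right_mono)
      finally show ?thesis .
    qed
  qed
  then have "(\<Sum>m. ennreal (\<beta> m)) + (\<Sum>m. ennreal (\<gamma> m)) \<le> (\<Sum>m. ennreal (\<alpha> m))"
    by (simp add: nn_integral_add nn_integral_suminf i1 i2 i3)
  then have "ennreal b + ennreal c \<le> ennreal a"
    using suminf_ennreal_sums[OF a nonneg(1)] suminf_ennreal_sums[OF b nonneg(2)] suminf_ennreal_sums[OF c nonneg(3)]
    by simp
  moreover have "b \<ge> 0" "c \<ge> 0" "a \<ge> 0"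
    using a b c nonneg by (metis sums_iff suminf_nonneg)+
  ultimately show ?thesis
    by (simp add: ennreal_le_iff flip: ennreal_plus)
qed

text \<open>At an integer \<open>sin (pi * x)\<close> vanishes and the Laplace argument, which
  divides by its square, does not apply. There interpolation gives equality: every kernel vanishes
  except one value kernel.\<close>

lemma M_series_of_int:
  assumes "l > 0"
  shows "M_series l (of_int k :: real) = exp (- l * \<bar>of_int k\<bar>)"
proof -
  have *: "M_series l (real n) = exp (- l * real n)" for n
  proof (cases n)
    case 0
    have "fejer_pair m 0 = (0::real)" "hfejer_pair m 0 = (0::real)" for m
      using nsinc_of_int[of "int (Suc m)"] by (simp_all add: fejer_pair_def hfejer_pair_def fejer_def hfejer_def add.commute del: nsinc_minus flip: nsinc_minus[of "- 1 - real m"])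
    then show ?thesis using 0 by (simp add: M_series_def M_series_term_def fejer_def)
  next
    case (Suc j)
    have z: "nsinc (real n + real (Suc m)) = 0" "nsinc (real n - real (Suc m)) = (if m = j then 1 else 0)" for m
      using nsinc_of_int[of "int n + int (Suc m)"] nsinc_of_int[of "int n - int (Suc m)"] Suc by auto
    have t: "M_series_term l m (real n) = (if m = j then exp (- l * real n) else 0)" for m
      unfolding M_series_term_def fejer_pair_def hfejer_pair_def fejer_def hfejer_def z of_real_of_nat_eq
      by (simp add: Suc)
    have "(\<Sum>m. M_series_term l m (real n)) = exp (- l * real n)"
      unfolding t using sums_single[of j "\<lambda>_. exp (- l * real n)"] by (simp add: sums_iff)
    moreover have "fejer (real n) = 0"
      using nsinc_of_int[of "int n"] Suc by (simp add: fejer_def)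
    ultimately show ?thesis by (simp add: M_series_def)
  qed
  show ?thesis
    using *[of "nat \<bar>k\<bar>"] M_series_minus[of l "real_of_int k"] by (cases "k \<ge> 0") auto
qed

lemma M_series_ge_exp:
  fixes x :: real
  assumes l: "l > 0"
  shows "exp (- l * \<bar>x\<bar>) \<le> M_series l x"
proof -
  have main: "exp (- l * x) \<le> M_series l x" if x: "x > 0" "x \<notin> \<int>" for x :: real
  proof -
    define P where "P = (sin (pi * x) / pi)\<^sup>2"
    \<comment> \<open>After division by \<open>P\<close>, \<alpha> holds the terms of the majorant
      at the nodes \<open>- m\<close>; \<epsilon> and \<gamma> split the expansion of
      \<open>exp (- l * x)\<close> into positive and nonpositive nodes; \<beta> is \<epsilon> minus
      the terms of the majorant at the positive nodes.\<close>
    define \<alpha> where "\<alpha> = (\<lambda>m. exp (- l * real m) * (1 / (x + real m)\<^sup>2 + (if m = 0 then 0 else l) / (x + real m)))"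
    define \<beta> where "\<beta> = (\<lambda>m. exp (- l * x) / (x - real (Suc m))\<^sup>2
      - exp (- l * real (Suc m)) * (1 / (x - real (Suc m))\<^sup>2 - l / (x - real (Suc m))))"
    define \<gamma> where "\<gamma> = (\<lambda>m. exp (- l * x) / (x + real m)\<^sup>2)"
    define \<epsilon> where "\<epsilon> = (\<lambda>m. exp (- l * x) / (x - real (Suc m))\<^sup>2)"
    have P: "P > 0" using sin_pi_nonzero[OF x(2)] by (simp add: P_def)
    have x0: "x \<noteq> of_int k" for k using x(2) by auto
    have fej: "fejer (x - of_int k) = P / (x - of_int k)\<^sup>2" and hfej: "hfejer (x - of_int k) = P / (x - of_int k)" for k
      using fejer_eq_divide[OF x0] by (simp_all add: P_def)
    have Pc: "P * (pi / sin (pi * x))\<^sup>2 = 1"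
      using sin_pi_nonzero[OF x(2)] by (simp add: P_def field_simps)
    have cs: "((\<lambda>k. exp (- l * x) * (1 / (x - of_int k)\<^sup>2)) has_sum (exp (- l * x) * (pi / sin (pi * x))\<^sup>2)) UNIV"
      by (intro has_sum_cmult_right cosecant_squared_has_sum x)
    have sum_gen: "\<gamma> sums (infsum (\<lambda>k. exp (- l * x) * (1 / (x - of_int k)\<^sup>2)) {..0::int})"
        "\<epsilon> sums (infsum (\<lambda>k. exp (- l * x) * (1 / (x - of_int k)\<^sup>2)) {1::int..})"
    proof -
      have s: "(\<lambda>k. exp (- l * x) * (1 / (x - of_int k)\<^sup>2)) summable_on A" for A :: "int set"
        using cs by (meson has_sum_imp_summable subset_UNIV summable_on_subset_banach)
      have "(\<gamma> has_sum (infsum (\<lambda>k. exp (- l * x) * (1 / (x - of_int k)\<^sup>2)) {..0::int})) UNIV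
         \<longleftrightarrow> ((\<lambda>k. exp (- l * x) * (1 / (x - of_int k)\<^sup>2)) has_sum (infsum (\<lambda>k. exp (- l * x) * (1 / (x - of_int k)\<^sup>2)) {..0::int})) {..0::int}"
        by (rule has_sum_reindex_bij_witness[of _ "\<lambda>k. nat (- k)" "\<lambda>n. - int n"]) (auto simp: \<gamma>_def)
      then show "\<gamma> sums (infsum (\<lambda>k. exp (- l * x) * (1 / (x - of_int k)\<^sup>2)) {..0::int})"
        using s by (auto intro: has_sum_imp_sums)
      have "(\<epsilon> has_sum (infsum (\<lambda>k. exp (- l * x) * (1 / (x - of_int k)\<^sup>2)) {1::int..})) UNIV
         \<longleftrightarrow> ((\<lambda>k. exp (- l * x) * (1 / (x - of_int k)\<^sup>2)) has_sum (infsum (\<lambda>k. exp (- l * x) * (1 / (x - of_int k)\<^sup>2)) {1::int..})) {1::int..}"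
        by (rule has_sum_reindex_bij_witness[of _ "\<lambda>k. nat (k - 1)" "\<lambda>n. int (Suc n)"]) (auto simp: \<epsilon>_def)
      then show "\<epsilon> sums (infsum (\<lambda>k. exp (- l * x) * (1 / (x - of_int k)\<^sup>2)) {1::int..})"
        using s by (auto intro: has_sum_imp_sums)
    qed
    define c where "c = suminf \<gamma>"
    define e where "e = suminf \<epsilon>"
    have c: "\<gamma> sums c" and e: "\<epsilon> sums e" using sum_gen by (auto simp: c_def e_def sums_iff)
    have "(\<lambda>n. exp (- l * x) * (1 / (x - of_int (int (Suc n)))\<^sup>2) + exp (- l * x) * (1 / (x - of_int (- int (Suc n)))\<^sup>2))
       sums (exp (- l * x) * (pi / sin (pi * x))\<^sup>2 - exp (- l * x) * (1 / (x - of_int 0)\<^sup>2))"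
      by (rule has_sum_int_split[OF cs])
    also have "(\<lambda>n. exp (- l * x) * (1 / (x - of_int (int (Suc n)))\<^sup>2) + exp (- l * x) * (1 / (x - of_int (- int (Suc n)))\<^sup>2))
        = (\<lambda>n. \<epsilon> n + \<gamma> (Suc n))"
      unfolding \<epsilon>_def \<gamma>_def of_int_minus of_int_of_nat_eq diff_minus_eq_add by simp
    finally have ce: "(\<lambda>n. \<epsilon> n + \<gamma> (Suc n)) sums (exp (- l * x) * (pi / sin (pi * x))\<^sup>2 - \<gamma> 0)"
      by (simp add: \<gamma>_def)
    have "(\<lambda>n. \<epsilon> n + \<gamma> (Suc n)) sums (e + (c - \<gamma> 0))"
      using c by (intro sums_add e) (simp add: sums_Suc_iff)
    with ce have "e + c = exp (- l * x) * (pi / sin (pi * x))\<^sup>2"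
      using sums_unique2 by fastforce
    then have Pce: "P * (e + c) = exp (- l * x)"
      using Pc by (simp add: mult_ac)
    have "summable \<alpha>"
    proof (rule summable_comparison_test'[where N = 0])
      show "summable (\<lambda>m. exp (- real m * l) * (1 / x\<^sup>2 + l / x))"
        by (intro summable_mult2 sums_summable[OF geometric_sums_exp] l)
      fix m :: nat
      have "1 / (x + real m)\<^sup>2 + (if m = 0 then 0 else l) / (x + real m) \<le> 1 / x\<^sup>2 + l / x"
        using l x by (intro add_mono frac_le power_mono) auto
      then show "norm (\<alpha> m) \<le> exp (- real m * l) * (1 / x\<^sup>2 + l / x)"
        using l x by (auto simp: \<alpha>_def abs_mult mult_ac intro!: mult_left_mono)
    qed
    define a where "a = suminf \<alpha>"
    have a: "\<alpha> sums a" using \<open>summable \<alpha>\<close> by (simp add: a_def summable_sums)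
    have a': "(\<lambda>n. \<alpha> (Suc n)) sums (a - \<alpha> 0)" using a by (simp add: sums_Suc_iff)
    have M_term: "M_series_term l n x = P * (\<alpha> (Suc n) + \<epsilon> n - \<beta> n)" for n
      unfolding M_series_term_def fejer_pair_int fej hfej \<alpha>_def \<beta>_def \<epsilon>_def
      by (simp add: algebra_simps add_divide_distrib)
    have M: "(\<lambda>n. M_series_term l n x) sums (M_series l x - fejer x)"
      using summable_rabs_cancel[OF summable_M_series_term_real[OF l, of x]] by (simp add: M_series_def summable_sums)
    \<comment> \<open>The convergence of \<beta> is read off from three convergent series, which
      also yields its sum.\<close>
    have "(\<lambda>n. \<alpha> (Suc n) + \<epsilon> n - M_series_term l n x / P) sums (a - \<alpha> 0 + e - (M_series l x - fejer x) / P)"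
      by (intro sums_diff sums_add a' e sums_divide M)
    also have "(\<lambda>n. \<alpha> (Suc n) + \<epsilon> n - M_series_term l n x / P) = \<beta>"
      using P by (auto simp: M_term)
    finally have b: "\<beta> sums (a - \<alpha> 0 + e - (M_series l x - fejer x) / P)" .
    have "fejer x = P * \<alpha> 0" using fej[of 0] by (simp add: \<alpha>_def)
    then have b': "a - \<alpha> 0 + e - (M_series l x - fejer x) / P = a + e - M_series l x / P"
      using P by (simp add: field_simps)
    \<comment> \<open>With this value of \<open>b\<close>, the inequality
      \<open>b + c \<le> a\<close> says \<open>P * (e + c) \<le> M_series l x\<close>, and
      \<open>P * (e + c)\<close> is \<open>exp (- l * x)\<close>.\<close>
    have "a + e - M_series l x / P + c \<le> a"
      using laplace_sums_le[OF l x, of a "a + e - M_series l x / P" c] a b[unfolded b'] c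
      unfolding \<alpha>_def \<beta>_def \<gamma>_def by simp
    then have "P * (e + c) \<le> M_series l x" using P by (simp add: field_simps)
    then show ?thesis by (simp add: Pce)
  qed
  show ?thesis
  proof (cases "x \<in> \<int>")
    case True
    then show ?thesis using M_series_of_int[OF l] by (auto elim!: Ints_cases)
  next
    case False
    then have "x \<noteq> 0" "\<bar>x\<bar> \<notin> \<int>" by (auto simp: abs_if)
    with main[of "\<bar>x\<bar>"] show ?thesis by (cases "x \<ge> 0") simp_all
  qed
qed

section \<open>The interpolation function of a measure\<close>

text \<open>\<open>l / (l + 1)\<close> is comparable to \<open>min l 1\<close> and the factor 2 pays
  for that: small \<open>l\<close> uses \<open>1 - exp (- v) \<le> v\<close>, large \<open>l\<close>
  the trivial bound 1.\<close>

lemma one_minus_exp_le: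
  fixes a l :: real
  assumes "a \<ge> 0" "l > 0"
  shows "0 \<le> 1 - exp (- l * a)" "1 - exp (- l * a) \<le> 2 * (1 + a) * (l / (l + 1))"
proof -
  show "0 \<le> 1 - exp (- l * a)" using assms by simp
  show "1 - exp (- l * a) \<le> 2 * (1 + a) * (l / (l + 1))"
  proof (cases "l \<le> 1")
    case True
    have "1 - exp (- l * a) \<le> l * a" using exp_ge_add_one_self[of "- l * a"] by simp
    also have "\<dots> \<le> l * (2 * (1 + a) / (l + 1))"
    proof (intro mult_left_mono)
      have "a * (l + 1) \<le> a * 2" using assms True by (intro mult_left_mono) auto
      then show "a \<le> 2 * (1 + a) / (l + 1)" using assms by (simp add: field_simps)
    qed (use assms in simp)
    finally show ?thesis by (simp add: mult_ac)
  next
    case False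
    have "1 - exp (- l * a) \<le> 1 * 1" by simp
    also have "\<dots> \<le> (1 + a) * (2 * (l / (l + 1)))"
      using assms False by (intro mult_mono) (auto simp: field_simps)
    finally show ?thesis by (simp add: mult_ac)
  qed
qed

lemma mult_exp_le:
  fixes l a :: real
  assumes "l > 0" "a \<ge> 1"
  shows "l * exp (- l * a) \<le> l / (l + 1)"
proof -
  have "exp (- l * a) \<le> exp (- l)" using assms by simp
  also have "\<dots> \<le> 1 / (l + 1)"
    using exp_ge_add_one_self[of l] assms by (simp add: exp_minus field_simps)
  finally show ?thesis using assms mult_left_mono[of "exp (- l * a)" "1 / (l + 1)" l] by simp
qed

text \<open>Serves to differentiate \<open>f_fun\<close> under the integral sign; there the factor
  \<open>exp |v|\<close> is absorbed by half of the decay of \<open>exp (- l * x)\<close>.\<close>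

lemma exp_minus_one_minus_le:
  fixes v :: real
  shows "\<bar>exp v - 1 - v\<bar> \<le> v\<^sup>2 * exp \<bar>v\<bar>"
proof -
  have 1: "exp v - 1 \<le> v * exp v"
    using mult_left_mono[OF exp_ge_add_one_self[of "- v"], of "exp v"] by (simp add: exp_minus algebra_simps)
  have "exp v - 1 - v \<le> v * (exp v - 1)" using 1 by (simp add: algebra_simps)
  also have "\<dots> \<le> v\<^sup>2 * exp \<bar>v\<bar>"
  proof (cases "v \<ge> 0")
    case True
    then show ?thesis using mult_left_mono[OF 1, of v] by (simp add: power2_eq_square mult_ac)
  next
    case False
    have "v * (exp v - 1) = - v * (1 - exp v)" by (simp add: algebra_simps)
    also have "\<dots> \<le> - v * (- v)"
      using False exp_ge_add_one_self[of v] by (intro mult_left_mono) linarith+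
    also have "\<dots> \<le> v\<^sup>2 * exp \<bar>v\<bar>"
      using mult_left_mono[of 1 "exp \<bar>v\<bar>" "v * v"] by (simp add: power2_eq_square)
    finally show ?thesis .
  qed
  finally show ?thesis using exp_ge_add_one_self[of v] by linarith
qed

lemma sum_inverse_squares_le: "(\<Sum>n<N. 1 / (real (Suc n))\<^sup>2) \<le> 3"
proof -
  have s: "(\<lambda>n. 1 / (real (Suc n))\<^sup>2) sums (pi\<^sup>2 / 6)"
    using inverse_squares_sums by (simp add: add.commute)
  have "(\<Sum>n<N. 1 / (real (Suc n))\<^sup>2) \<le> pi\<^sup>2 / 6"
    using sum_le_suminf[OF sums_summable[OF s], of "{..<N}"] sums_unique[OF s] by simp
  also have "pi\<^sup>2 \<le> 4\<^sup>2" using pi_less_4 by (intro power_mono) auto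
  finally show ?thesis by simp
qed

text \<open>The larger of \<open>m\<close> and \<open>1 / l\<close> is at least half of their sum
  \<open>s\<close>, so the minimum is at most \<open>4 / s^2\<close>. Enlarging this to
  \<open>4 / (s * (s - 1))\<close> makes it telescope.\<close>

lemma min_inverse_square_le:
  fixes l m :: real
  assumes "l > 0" "m \<ge> 1"
  shows "min (1 / m\<^sup>2) (l\<^sup>2) \<le> 4 * (1 / (m - 1 + 1 / l) - 1 / (m + 1 / l))"
proof -
  define s where "s = m + 1 / l"
  have pos: "1 / l > 0" "m > 0" using assms by simp_all
  have s: "s > 1" "s - 1 > 0" using assms pos unfolding s_def by linarith+
  have "min (1 / m\<^sup>2) (l\<^sup>2) \<le> 4 / s\<^sup>2"
  proof (cases "m \<ge> 1 / l")
    case True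
    then have "s\<^sup>2 \<le> (2 * m)\<^sup>2" using s by (intro power_mono) (auto simp: s_def)
    then have "1 / m\<^sup>2 \<le> 4 / s\<^sup>2" using pos s by (simp add: field_simps power_mult_distrib)
    then show ?thesis by simp
  next
    case False
    then have "s\<^sup>2 \<le> (2 / l)\<^sup>2" using s by (intro power_mono) (auto simp: s_def)
    then have "l\<^sup>2 \<le> 4 / s\<^sup>2" using assms s by (simp add: field_simps power_divide)
    then show ?thesis by simp
  qed
  also have "\<dots> \<le> 4 / (s * (s - 1))"
    using s by (intro divide_left_mono) (auto simp: power2_eq_square)
  also have "\<dots> = 4 * (1 / (s - 1) - 1 / s)" using s by (simp add: field_simps)
  finally show ?thesis by (simp add: s_def algebra_simps)
qed

lemma sum_min_inverse_squares_le:
  assumes "l > 0"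
  shows "(\<Sum>n<N. min (1 / (real (Suc n))\<^sup>2) (l\<^sup>2)) \<le> 8 * (l / (l + 1))"
proof -
  define g where "g = (\<lambda>n. 1 / (real n + 1 / l))"
  have "(\<Sum>n<N. min (1 / (real (Suc n))\<^sup>2) (l\<^sup>2)) \<le> (\<Sum>n<N. 4 * (g n - g (Suc n)))"
  proof (rule sum_mono)
    fix n
    show "min (1 / (real (Suc n))\<^sup>2) (l\<^sup>2) \<le> 4 * (g n - g (Suc n))"
      using min_inverse_square_le[OF assms, of "real (Suc n)"] by (simp add: g_def)
  qed
  also have "\<dots> = 4 * (g 0 - g N)"
    by (simp only: sum_distrib_left[symmetric] sum_lessThan_telescope')
  \<comment> \<open>The telescoped sum starts at \<open>g 0 = l\<close>, which gives the linear
    bound needed for small \<open>l\<close>; for large \<open>l\<close> the bound 3 is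
    better.\<close>
  also have "\<dots> \<le> 4 * l" using assms by (simp add: g_def)
  finally have 1: "(\<Sum>n<N. min (1 / (real (Suc n))\<^sup>2) (l\<^sup>2)) \<le> 4 * l" .
  have 2: "(\<Sum>n<N. min (1 / (real (Suc n))\<^sup>2) (l\<^sup>2)) \<le> 3"
    using sum_mono[of "{..<N}" "\<lambda>n. min (1 / (real (Suc n))\<^sup>2) (l\<^sup>2)" "\<lambda>n. 1 / (real (Suc n))\<^sup>2"]
      sum_inverse_squares_le[of N] by simp
  show ?thesis
  proof (cases "l \<le> 1")
    case True
    have "4 * l \<le> 8 * (l / (l + 1))" using assms True by (simp add: field_simps)
    with 1 show ?thesis by simp
  next
    case False
    have "4 \<le> 8 * (l / (l + 1))" using assms False by (simp add: field_simps)
    with 2 show ?thesis by simp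
  qed
qed

section \<open>Interpolation terms and a bound summable with total of order
  \<open>l / (l + 1)\<close>\<close>

definition H_term :: "real \<Rightarrow> nat \<Rightarrow> 'a::{real_normed_field,banach} \<Rightarrow> 'a" where
  "H_term l n z = of_real (exp (- l * real (Suc n)) - exp (- l)) * fejer_pair n z
     - of_real (l * exp (- l * real (Suc n))) * hfejer_pair n z"

text \<open>The constants are those of \<open>norm_H_term_le\<close>: 34 = 8 + 24 + 2 from the
  remainders, and the truncated inverse square from what survives of the leading parts. Summed over
  \<open>n\<close> they give 34 * 3 + 2 * 8 = 118.\<close>

definition H_weight :: "real \<Rightarrow> nat \<Rightarrow> real" where
  "H_weight l n = 34 * (l / (l + 1)) / (real (Suc n))\<^sup>2 + 2 * min (1 / (real (Suc n))\<^sup>2) (l\<^sup>2)"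

lemma H_weight_nonneg: "l > 0 \<Longrightarrow> 0 \<le> H_weight l n"
  by (simp add: H_weight_def)

lemma sum_H_weight_le:
  assumes "l > 0"
  shows "(\<Sum>n<N. H_weight l n) \<le> 118 * (l / (l + 1))"
proof -
  define L where "L = l / (l + 1)"
  have "L \<ge> 0" using assms by (simp add: L_def)
  have "(\<Sum>n<N. H_weight l n) = 34 * L * (\<Sum>n<N. 1 / (real (Suc n))\<^sup>2) + 2 * (\<Sum>n<N. min (1 / (real (Suc n))\<^sup>2) (l\<^sup>2))"
    unfolding H_weight_def L_def sum.distrib sum_distrib_left by simp
  also have "\<dots> \<le> 34 * L * 3 + 2 * (8 * L)"
    using sum_min_inverse_squares_le[OF assms, of N] \<open>L \<ge> 0\<close>
    by (intro add_mono mult_left_mono sum_inverse_squares_le) (auto simp: L_def)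
  finally show ?thesis by (simp add: L_def)
qed

lemma H_weight_le: "l > 0 \<Longrightarrow> H_weight l n \<le> 118 * (l / (l + 1))"
  using sum_H_weight_le[of l "Suc n"] sum_nonneg[of "{..<n}" "H_weight l"] H_weight_nonneg[of l] by simp

text \<open>The terms \<open>f(n) / (z - n)\<^sup>2\<close> and \<open>f'(n) / (z - n)\<close> need not be separately summable after
  integration over \<open>l\<close>; their leading parts cancel up to
  \<open>(1 - exp (- l n) - l n exp (- l n)) / n\<^sup>2\<close>, which sums to \<open>O(l)\<close>.\<close>

lemma norm_H_term_le:
  fixes z :: complex
  assumes l: "l > 0"
  shows "norm (H_term l n z) \<le> H_weight l n * growth z"
proof -
  define m where "m = real (Suc n)"
  define P where "P = (sin (of_real pi * z) / of_real pi)\<^sup>2"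
  define E where "E = exp (- l * m)"
  define L where "L = l / (l + 1)"
  define G where "G = growth z"
  have m: "m \<ge> 1" by (simp add: m_def)
  have L: "L \<ge> 0" using l by (simp add: L_def)
  have G: "G \<ge> 0" by (simp add: G_def growth_nonneg)
  have E: "0 < E" "E \<le> 1" using l m by (simp_all add: E_def)
  have e1: "0 \<le> 1 - exp (- l)" "1 - exp (- l) \<le> 4 * L"
    using one_minus_exp_le[of 1 l] l by (auto simp: L_def)
  \<comment> \<open>The growing factor \<open>m\<close> is the reason why the remainder of
    \<open>fejer_pair\<close> has to be of order \<open>m^(-3)\<close>.\<close>
  have e2: "0 \<le> 1 - E" "1 - E \<le> 4 * m * L"
  proof -
    show "0 \<le> 1 - E" using E by simp
    have "1 - E \<le> 2 * (1 + m) * L" using one_minus_exp_le[of m l] l m by (simp add: E_def L_def)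
    also have "\<dots> \<le> 2 * (m + m) * L" using m L by (intro mult_right_mono) auto
    finally show "1 - E \<le> 4 * m * L" by simp
  qed
  have e3: "l * E \<le> L" using mult_exp_le[OF l m] by (simp add: E_def L_def)
  \<comment> \<open>With \<open>v = l * m\<close> this is \<open>1 - (1 + v) * exp (- v)\<close>,
    which lies between 0 and \<open>min 1 (v^2)\<close>.\<close>
  define Q where "Q = 1 - E - l * m * E"
  have Q: "0 \<le> Q" "Q \<le> 1" "Q \<le> (l * m)\<^sup>2"
  proof -
    have "(1 + l * m) * E \<le> exp (l * m) * E"
      using E exp_ge_add_one_self[of "l * m"] by (intro mult_right_mono) auto
    also have "\<dots> = 1" by (simp add: E_def flip: exp_add)
    finally show "0 \<le> Q" by (simp add: Q_def algebra_simps)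
    have "0 \<le> l * m * E" using E l m by simp
    then show "Q \<le> 1" using E by (simp add: Q_def)
    have E': "1 - l * m \<le> E" using exp_ge_add_one_self[of "- (l * m)"] by (simp add: E_def)
    have "Q \<le> l * m - l * m * E" using E' by (simp add: Q_def)
    also have "\<dots> = l * m * (1 - E)" by (simp add: algebra_simps)
    also have "\<dots> \<le> l * m * (l * m)" using l m E' by (intro mult_left_mono) auto
    finally show "Q \<le> (l * m)\<^sup>2" by (simp add: power2_eq_square)
  qed
  have Qm: "Q / m\<^sup>2 \<le> min (1 / m\<^sup>2) (l\<^sup>2)"
    using Q m by (auto simp: field_simps power_mult_distrib)
  define a where "a = fejer_pair n z"
  define b where "b = hfejer_pair n z"
  have a: "norm a \<le> 2 * G / m\<^sup>2" and a': "norm (a - 2 * P / of_real (m\<^sup>2)) \<le> 6 * G / m ^ 3"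
    and b: "norm (b + 2 * P / of_real m) \<le> 2 * G / m\<^sup>2"
    unfolding a_def b_def G_def m_def P_def
    by (rule norm_fejer_pair_le norm_fejer_pair_minus_le norm_hfejer_pair_plus_le)+
  have P: "norm P \<le> G" unfolding P_def G_def by (rule norm_sin_pi_sq_le_growth)
  \<comment> \<open>The leading parts are subtracted and added back; their contributions
    \<open>- 2 * P * (1 - E) / m^2\<close> and \<open>2 * P * l * E / m\<close> combine to
    \<open>- 2 * P * Q / m^2\<close>.\<close>
  have "H_term l n z = of_real (1 - exp (- l)) * a - of_real (1 - E) * (a - 2 * P / of_real (m\<^sup>2))
      - of_real (l * E) * (b + 2 * P / of_real m) - 2 * P * of_real (Q / m\<^sup>2)"
    using m unfolding H_term_def Q_def a_def[symmetric] b_def[symmetric] m_def[symmetric] E_def[symmetric]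
    by (simp add: field_simps power2_eq_square)
  also have "norm \<dots> \<le> (1 - exp (- l)) * norm a + (1 - E) * norm (a - 2 * P / of_real (m\<^sup>2))
      + l * E * norm (b + 2 * P / of_real m) + 2 * norm P * (Q / m\<^sup>2)"
    (is "norm (?A - ?B - ?C - ?D) \<le> _")
  proof -
    have "norm (?A - ?B - ?C - ?D) \<le> norm ?A + norm ?B + norm ?C + norm ?D"
      by (meson norm_triangle_ineq4 add_right_mono order_trans)
    also have "\<dots> = (1 - exp (- l)) * norm a + (1 - E) * norm (a - 2 * P / of_real (m\<^sup>2))
      + l * E * norm (b + 2 * P / of_real m) + 2 * norm P * (Q / m\<^sup>2)"
      unfolding norm_mult norm_of_real using e1 e2 Q l E by simp
    finally show ?thesis .
  qed
  also have "\<dots> \<le> (4 * L) * (2 * G / m\<^sup>2) + (4 * m * L) * (6 * G / m ^ 3) + L * (2 * G / m\<^sup>2) + 2 * G * min (1 / m\<^sup>2) (l\<^sup>2)"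
    using a a' b P e1 e2 e3 Q Qm L G l E m
    by (intro add_mono mult_mono) auto
  also have "\<dots> = (34 * L / m\<^sup>2 + 2 * min (1 / m\<^sup>2) (l\<^sup>2)) * G"
    using m by (simp add: field_simps power3_eq_cube power2_eq_square)
  finally show ?thesis by (simp add: H_weight_def G_def L_def m_def)
qed

lemma H_term_of_real: "H_term l n (of_real x) = of_real (H_term l n x)"
  by (simp add: H_term_def fejer_pair_of_real hfejer_pair_of_real)

text \<open>By \<open>fejer_pair_sums\<close>, lowering all values by \<open>exp (- l)\<close>
  lowers the interpolant by the same constant. The term with \<open>fejer x\<close> belongs to the
  node 0, where the value is \<open>1 - exp (- l)\<close>.\<close>

lemma H_term_sums:
  fixes x :: real
  assumes "l > 0"
  shows "(\<lambda>n. H_term l n x) sums (M_series l x - exp (- l) - (1 - exp (- l)) * fejer x)"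
proof -
  have M: "(\<lambda>n. M_series_term l n x) sums (M_series l x - fejer x)"
    using summable_rabs_cancel[OF summable_M_series_term_real[OF assms, of x]] by (simp add: M_series_def summable_sums)
  have "(\<lambda>n. M_series_term l n x - exp (- l) * fejer_pair n x) sums (M_series l x - fejer x - exp (- l) * (1 - fejer x))"
    by (intro sums_diff sums_mult M fejer_pair_sums)
  also have "(\<lambda>n. M_series_term l n x - exp (- l) * fejer_pair n x) = (\<lambda>n. H_term l n x)"
    by (simp add: M_series_term_def H_term_def algebra_simps)
  finally show ?thesis by (simp add: algebra_simps)
qed

section \<open>Integration of the interpolation series against a measure\<close>

locale laplace_measure =
  fixes \<rho> :: "real measure"
  assumes sets_eq: "sets \<rho> = sets (restrict_space borel {0<..})"
    and finite_integral: "(\<integral>\<^sup>+l. ennreal (l / (l + 1)) \<partial>\<rho>) < \<infinity>"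
begin

lemma space_eq: "space \<rho> = {0<..}"
  using sets_eq_imp_space_eq[OF sets_eq] by (simp add: space_restrict_space)

lemma measurable_ident_borel [measurable]: "(\<lambda>l. l) \<in> borel_measurable \<rho>"
  unfolding measurable_cong_sets[OF sets_eq refl] by (rule measurable_restrict_space1) simp

lemma integrable_weight: "integrable \<rho> (\<lambda>l. l / (l + 1))"
proof (rule integrableI_bounded)
  have "(\<integral>\<^sup>+l. ennreal (norm (l / (l + 1))) \<partial>\<rho>) = (\<integral>\<^sup>+l. ennreal (l / (l + 1)) \<partial>\<rho>)"
    by (intro nn_integral_cong) (simp add: space_eq)
  with finite_integral show "(\<integral>\<^sup>+l. ennreal (norm (l / (l + 1))) \<partial>\<rho>) < \<infinity>" by simp
qed measurable

lemma integrable_weight_bound: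
  fixes f :: "real \<Rightarrow> 'b::{banach,second_countable_topology}"
  assumes "f \<in> borel_measurable \<rho>" "\<And>l. l > 0 \<Longrightarrow> norm (f l) \<le> C * (l / (l + 1))"
  shows "integrable \<rho> f"
proof (rule Bochner_Integration.integrable_bound)
  show "integrable \<rho> (\<lambda>l. C * (l / (l + 1)))" by (intro integrable_mult_right integrable_weight)
  show "AE l in \<rho>. norm (f l) \<le> norm (C * (l / (l + 1)))"
    unfolding real_norm_def by (intro AE_I2 order_trans[OF assms(2) abs_ge_self]) (simp add: space_eq)
qed (use assms in simp)

lemma integrable_exp_diff: "a \<ge> 0 \<Longrightarrow> b \<ge> 0 \<Longrightarrow> integrable \<rho> (\<lambda>l. exp (- l * a) - exp (- l * b))"
proof (rule integrable_weight_bound)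
  fix l :: real assume "a \<ge> 0" "b \<ge> 0" "l > 0"
  then show "norm (exp (- l * a) - exp (- l * b)) \<le> (2 * (1 + a) + 2 * (1 + b)) * (l / (l + 1))"
    using one_minus_exp_le[OF \<open>a \<ge> 0\<close> \<open>l > 0\<close>] one_minus_exp_le[OF \<open>b \<ge> 0\<close> \<open>l > 0\<close>]
    by (simp only: distrib_right real_norm_def)
qed measurable

lemma integrable_mult_exp: "a > 0 \<Longrightarrow> integrable \<rho> (\<lambda>l. l * exp (- l * a))"
proof (rule integrable_weight_bound)
  fix l :: real assume a: "a > 0" and l: "l > 0"
  have "(l + 1) * exp (- l * a) \<le> (1 + 1 / a) * (exp (l * a) * exp (- l * a))"
  proof -
    have "(1 + 1 / a) * (1 + l * a) \<ge> l + 1" using a l by (simp add: field_simps)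
    moreover have "(1 + 1 / a) * (1 + l * a) \<le> (1 + 1 / a) * exp (l * a)"
      using a exp_ge_add_one_self[of "l * a"] by (intro mult_left_mono) auto
    ultimately have "l + 1 \<le> (1 + 1 / a) * exp (l * a)" by linarith
    then have "(l + 1) * exp (- l * a) \<le> ((1 + 1 / a) * exp (l * a)) * exp (- l * a)"
      by (intro mult_right_mono) auto
    then show ?thesis by (simp only: mult.assoc)
  qed
  then have "(l + 1) * exp (- l * a) \<le> 1 + 1 / a" by (simp flip: exp_add)
  then have "l * ((l + 1) * exp (- l * a)) \<le> l * (1 + 1 / a)" using l by (intro mult_left_mono) auto
  then have "l * exp (- l * a) * (l + 1) \<le> (1 + 1 / a) * l" by (simp only: mult_ac)
  then have "l * exp (- l * a) \<le> (1 + 1 / a) * l / (l + 1)" using l by (subst pos_le_divide_eq) auto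
  then show "norm (l * exp (- l * a)) \<le> (1 + 1 / a) * (l / (l + 1))" using l by simp
qed measurable

lemma f_fun_even: "f_fun \<rho> (- x) = f_fun \<rho> x"
  by (simp add: f_fun_def)

lemma f_fun_has_derivative:
  assumes x: "x > 0"
  shows "(f_fun \<rho> has_real_derivative - (LINT l|\<rho>. l * exp (- l * x))) (at x)"
proof -
  \<comment> \<open>\<open>C\<close> bounds \<open>l * (l + 1) * exp (- (l * x / 2))\<close>: the
    exponential is split into two equal factors, one spent on \<open>l\<close> and one on
    \<open>l + 1\<close>.\<close>
  define C where "C = (4 / x) * (4 / x + 1)"
  define I where "I = (LINT l|\<rho>. l / (l + 1))"
  have bound: "l * l * exp (- (l * x / 2)) \<le> C * (l / (l + 1))" if l: "l > 0" for l
  proof -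
    define E where "E = exp (- (l * x / 4))"
    have e: "1 + l * x / 4 \<le> 1 / E" using exp_ge_add_one_self[of "l * x / 4"] by (simp add: E_def exp_minus field_simps)
    have E: "0 < E" "E \<le> 1" using l x by (auto simp: E_def)
    have "l * x / 4 \<le> 1 / E" using e by simp
    then have 1: "l * E \<le> 4 / x" using E x by (simp add: field_simps)
    then have 2: "(l + 1) * E \<le> 4 / x + 1" using E by (simp add: distrib_right)
    have "exp (- (l * x / 2)) = E * E" by (simp add: E_def flip: exp_add)
    then have "l * (l + 1) * exp (- (l * x / 2)) = (l * E) * ((l + 1) * E)" by simp
    also have "\<dots> \<le> C" unfolding C_def using 1 2 l E x by (intro mult_mono) auto
    finally have "l * (l * (l + 1) * exp (- (l * x / 2))) \<le> l * C" using l by (intro mult_left_mono) auto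
    then show ?thesis using l by (simp add: field_simps)
  qed
  have quot: "\<bar>(f_fun \<rho> (x + h) - f_fun \<rho> x) / h + (LINT l|\<rho>. l * exp (- l * x))\<bar> \<le> C * I * \<bar>h\<bar>"
    if h: "h \<noteq> 0" "\<bar>h\<bar> < x / 2" for h
  proof -
    have xh: "x + h > 0" using h by linarith
    define q where "q = (\<lambda>l. exp (- l * (x + h)) - exp (- l * x) + h * (l * exp (- l * x)))"
    have int: "integrable \<rho> (\<lambda>l. exp (- l * (x + h)) - exp (- l * x))" "integrable \<rho> (\<lambda>l. l * exp (- l * x))"
      using xh x by (intro integrable_exp_diff integrable_mult_exp; simp)+
    have "f_fun \<rho> (x + h) - f_fun \<rho> x = (LINT l|\<rho>. (exp (- l * (x + h)) - exp (- l * 1)) - (exp (- l * x) - exp (- l * 1)))"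
      unfolding f_fun_def using xh x integrable_exp_diff[of "x + h" 1] integrable_exp_diff[of x 1]
      by (subst Bochner_Integration.integral_diff) auto
    then have "f_fun \<rho> (x + h) - f_fun \<rho> x + h * (LINT l|\<rho>. l * exp (- l * x)) = (LINT l|\<rho>. q l)"
      unfolding q_def using int by (subst Bochner_Integration.integral_add) auto
    also have "\<bar>\<dots>\<bar> \<le> (LINT l|\<rho>. h\<^sup>2 * (C * (l / (l + 1))))"
    proof (rule Bochner_Integration.integral_abs_bound_integral)
      show "integrable \<rho> q" unfolding q_def using int by simp
      show "integrable \<rho> (\<lambda>l. h\<^sup>2 * (C * (l / (l + 1))))"
        by (intro integrable_mult_right integrable_weight)
      fix l assume "l \<in> space \<rho>"
      then have l: "l > 0" by (simp add: space_eq)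
      have "q l = exp (- l * x) * (exp (- l * h) - 1 - (- l * h))"
        by (simp add: q_def algebra_simps flip: exp_add)
      then have "\<bar>q l\<bar> = exp (- l * x) * \<bar>exp (- l * h) - 1 - (- l * h)\<bar>" by (simp add: abs_mult)
      also have "\<dots> \<le> exp (- l * x) * ((- l * h)\<^sup>2 * exp \<bar>- l * h\<bar>)"
        by (intro mult_left_mono exp_minus_one_minus_le) simp
      also have "\<dots> = h\<^sup>2 * (l * l * (exp (- l * x) * exp \<bar>- l * h\<bar>))"
        by (simp add: power2_eq_square mult_ac)
      \<comment> \<open>As \<open>|h| < x / 2\<close>, half of the decay survives the factor
        \<open>exp (l * |h|)\<close>.\<close>
      also have "exp (- l * x) * exp \<bar>- l * h\<bar> \<le> exp (- (l * x / 2))"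
      proof -
        have "l * \<bar>h\<bar> \<le> l * (x / 2)" using l h by (intro mult_left_mono) auto
        then have "exp (- l * x + l * \<bar>h\<bar>) \<le> exp (- (l * x / 2))" by simp
        then show ?thesis using l by (simp only: exp_add abs_mult abs_minus_cancel abs_of_pos)
      qed
      also have "l * l * exp (- (l * x / 2)) \<le> C * (l / (l + 1))" by (rule bound[OF l])
      finally show "\<bar>q l\<bar> \<le> h\<^sup>2 * (C * (l / (l + 1)))" using l by (simp add: mult_left_mono)
    qed
    also have "\<dots> = h\<^sup>2 * (C * I)" unfolding I_def by (simp only: integral_mult_right_zero)
    also have "\<dots> = \<bar>h\<bar> * (C * I * \<bar>h\<bar>)" using abs_mult_self_eq[of h] by (simp only: power2_eq_square mult_ac)
    finally have *: "\<bar>f_fun \<rho> (x + h) - f_fun \<rho> x + h * (LINT l|\<rho>. l * exp (- l * x))\<bar> \<le> \<bar>h\<bar> * (C * I * \<bar>h\<bar>)" .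
    have "\<bar>h\<bar> * \<bar>(f_fun \<rho> (x + h) - f_fun \<rho> x) / h + (LINT l|\<rho>. l * exp (- l * x))\<bar>
      = \<bar>f_fun \<rho> (x + h) - f_fun \<rho> x + h * (LINT l|\<rho>. l * exp (- l * x))\<bar>"
      using h by (simp add: distrib_left flip: abs_mult)
    with * have "\<bar>h\<bar> * \<bar>(f_fun \<rho> (x + h) - f_fun \<rho> x) / h + (LINT l|\<rho>. l * exp (- l * x))\<bar> \<le> \<bar>h\<bar> * (C * I * \<bar>h\<bar>)"
      by simp
    then show ?thesis using h by simp
  qed
  have "((\<lambda>h. (f_fun \<rho> (x + h) - f_fun \<rho> x) / h + (LINT l|\<rho>. l * exp (- l * x))) \<longlongrightarrow> 0) (at 0)"
  proof (rule Lim_null_comparison)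
    have "eventually (\<lambda>h::real. h \<noteq> 0 \<and> \<bar>h\<bar> < x / 2) (at 0)"
      using x by (auto simp: eventually_at dist_real_def intro!: exI[of _ "x / 2"])
    then show "\<forall>\<^sub>F h in at 0. norm ((f_fun \<rho> (x + h) - f_fun \<rho> x) / h + (LINT l|\<rho>. l * exp (- l * x))) \<le> C * I * \<bar>h\<bar>"
      by eventually_elim (use quot in auto)
    show "((\<lambda>h. C * I * \<bar>h\<bar>) \<longlongrightarrow> 0) (at 0)"
      by (auto intro!: tendsto_eq_intros)
  qed
  then have "((\<lambda>h. (f_fun \<rho> (x + h) - f_fun \<rho> x) / h) \<longlongrightarrow> - (LINT l|\<rho>. l * exp (- l * x))) (at 0)"
    by (subst LIM_zero_iff[symmetric]) simp
  then show ?thesis by (simp add: DERIV_def)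
qed

lemma deriv_f_fun: "x > 0 \<Longrightarrow> deriv (f_fun \<rho>) x = - (LINT l|\<rho>. l * exp (- l * x))"
  by (rule DERIV_imp_deriv[OF f_fun_has_derivative])

lemma deriv_f_fun_odd:
  assumes "x > 0"
  shows "deriv (f_fun \<rho>) (- x) = - deriv (f_fun \<rho>) x"
proof -
  have "(f_fun \<rho> has_real_derivative - (- (LINT l|\<rho>. l * exp (- l * x)))) (at (- x))"
    using f_fun_has_derivative[OF assms] unfolding DERIV_mirror by (simp add: f_fun_even)
  then show ?thesis
    using deriv_f_fun[OF assms] by (simp add: DERIV_imp_deriv)
qed

lemma H_term_measurable [measurable]:
  fixes z :: complex
  shows "(\<lambda>l. H_term l n z) \<in> borel_measurable \<rho>"
  unfolding H_term_def by measurable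

lemma H_weight_integrable: "integrable \<rho> (\<lambda>l. H_weight l n)"
proof (rule integrable_weight_bound)
  show "l > 0 \<Longrightarrow> norm (H_weight l n) \<le> 118 * (l / (l + 1))" for l
    using H_weight_nonneg[of l n] H_weight_le[of l n] by simp
  show "(\<lambda>l. H_weight l n) \<in> borel_measurable \<rho>" unfolding H_weight_def by measurable
qed

text \<open>Summation is done before integration: the partial sums of \<open>H_weight\<close> are at
  most \<open>118 * (l / (l + 1))\<close> uniformly in \<open>N\<close>.\<close>

lemma summable_H_weight: "summable (\<lambda>n. LINT l|\<rho>. H_weight l n)"
proof (rule summableI_nonneg_bounded)
  show "0 \<le> (LINT l|\<rho>. H_weight l n)" for n
    by (intro integral_nonneg_AE AE_I2) (simp add: space_eq H_weight_nonneg)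
  show "(\<Sum>n<N. (LINT l|\<rho>. H_weight l n)) \<le> (LINT l|\<rho>. 118 * (l / (l + 1)))" for N
  proof -
    have "(\<Sum>n<N. (LINT l|\<rho>. H_weight l n)) = (LINT l|\<rho>. (\<Sum>n<N. H_weight l n))"
      by (simp add: H_weight_integrable)
    also have "\<dots> \<le> (LINT l|\<rho>. 118 * (l / (l + 1)))"
      by (intro integral_mono Bochner_Integration.integrable_sum integrable_mult_right integrable_weight
          H_weight_integrable sum_H_weight_le) (simp add: space_eq)
    finally show ?thesis .
  qed
qed

lemma H_term_integrable:
  fixes z :: complex
  shows "integrable \<rho> (\<lambda>l. H_term l n z)"
proof (rule Bochner_Integration.integrable_bound)
  show "integrable \<rho> (\<lambda>l. H_weight l n * growth z)" by (simp add: H_weight_integrable)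
  show "AE l in \<rho>. norm (H_term l n z) \<le> norm (H_weight l n * growth z)"
    using norm_H_term_le[of _ n z] by (intro AE_I2) (force simp: space_eq)
qed measurable

lemma norm_integral_H_term_le:
  fixes z :: complex
  shows "norm (LINT l|\<rho>. H_term l n z) \<le> (LINT l|\<rho>. H_weight l n) * growth z"
proof -
  have "norm (LINT l|\<rho>. H_term l n z) \<le> (LINT l|\<rho>. H_weight l n * growth z)"
    by (rule Bochner_Integration.integral_norm_bound_integral[OF H_term_integrable])
       (auto simp: H_weight_integrable space_eq norm_H_term_le)
  then show ?thesis by simp
qed

lemma integral_H_term_eq:
  fixes z :: complex
  shows "(LINT l|\<rho>. H_term l n z) =
     of_real (f_fun \<rho> (real (Suc n))) * fejer_pair n z + of_real (deriv (f_fun \<rho>) (real (Suc n))) * hfejer_pair n z"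
proof -
  have i: "integrable \<rho> (\<lambda>l. exp (- l * real (Suc n)) - exp (- l * 1))" "integrable \<rho> (\<lambda>l. l * exp (- l * real (Suc n)))"
    by (intro integrable_exp_diff integrable_mult_exp; simp)+
  have "(LINT l|\<rho>. H_term l n z) = (LINT l|\<rho>. complex_of_real (exp (- l * real (Suc n)) - exp (- l * 1)) * fejer_pair n z)
     - (LINT l|\<rho>. complex_of_real (l * exp (- l * real (Suc n))) * hfejer_pair n z)"
    unfolding H_term_def using i
    by (subst Bochner_Integration.integral_diff[symmetric]) (auto simp del: of_real_diff of_real_mult)
  also have "\<dots> = of_real (LINT l|\<rho>. exp (- l * real (Suc n)) - exp (- l * 1)) * fejer_pair n z
     - of_real (LINT l|\<rho>. l * exp (- l * real (Suc n))) * hfejer_pair n z"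
    by (simp only: integral_mult_left_zero integral_complex_of_real)
  finally show ?thesis
    by (simp add: f_fun_def deriv_f_fun del: of_real_diff of_nat_Suc)
qed

lemma H_fun_eq: "H_fun \<rho> z = of_real (f_fun \<rho> 0) * fejer z + (\<Sum>n. LINT l|\<rho>. H_term l n z)"
proof -
  have s: "summable (\<lambda>n. LINT l|\<rho>. H_term l n z)"
    by (rule summable_comparison_test'[OF summable_mult2[OF summable_H_weight, of "growth z"], of 0])
       (rule norm_integral_H_term_le)
  have "(\<lambda>N. of_real (f_fun \<rho> 0) * fejer z + (\<Sum>n<N. (LINT l|\<rho>. H_term l n z))) \<longlonglongrightarrow>
      of_real (f_fun \<rho> 0) * fejer z + (\<Sum>n. LINT l|\<rho>. H_term l n z)"
    by (intro tendsto_intros summable_LIMSEQ s)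
  then have "(\<lambda>N. H_partial \<rho> N z) \<longlonglongrightarrow> of_real (f_fun \<rho> 0) * fejer z + (\<Sum>n. LINT l|\<rho>. H_term l n z)"
    using H_partial_eq[of \<rho>, OF f_fun_even deriv_f_fun_odd] unfolding integral_H_term_eq by simp
  then show ?thesis unfolding H_fun_def by (rule limI)
qed

lemma H_fun_holomorphic: "H_fun \<rho> holomorphic_on UNIV"
proof -
  have "(\<lambda>z. \<Sum>n. LINT l|\<rho>. H_term l n z) holomorphic_on UNIV"
  proof (rule holomorphic_suminf[OF _ norm_integral_H_term_le summable_H_weight])
    show "(\<lambda>z. LINT l|\<rho>. H_term l n z) holomorphic_on UNIV" for n
      unfolding integral_H_term_eq by (intro holomorphic_intros)
  qed
  then have "(\<lambda>z. of_real (f_fun \<rho> 0) * fejer z + (\<Sum>n. LINT l|\<rho>. H_term l n z)) holomorphic_on UNIV"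
    by (intro holomorphic_intros)
  then show ?thesis using H_fun_eq by presburger
qed

lemma H_fun_growth: "\<exists>C\<ge>0. \<forall>z. norm (H_fun \<rho> z) \<le> C * growth z"
proof (intro exI conjI allI)
  define W where "W = (\<Sum>n. LINT l|\<rho>. H_weight l n)"
  have Wn: "0 \<le> (LINT l|\<rho>. H_weight l n)" for n
    by (intro integral_nonneg_AE AE_I2) (simp add: space_eq H_weight_nonneg)
  show "0 \<le> \<bar>f_fun \<rho> 0\<bar> + W"
    unfolding W_def by (intro add_nonneg_nonneg suminf_nonneg summable_H_weight Wn) simp
  fix z
  have "norm (\<Sum>n. LINT l|\<rho>. H_term l n z) \<le> (\<Sum>n. (LINT l|\<rho>. H_weight l n) * growth z)"
    by (intro norm_suminf_le norm_integral_H_term_le summable_mult2 summable_H_weight)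
  also have "\<dots> = W * growth z" by (simp add: W_def suminf_mult2[OF summable_H_weight])
  finally have "norm (\<Sum>n. LINT l|\<rho>. H_term l n z) \<le> W * growth z" .
  moreover have "norm (of_real (f_fun \<rho> 0) * fejer z) \<le> \<bar>f_fun \<rho> 0\<bar> * growth z"
    by (simp add: norm_mult mult_left_mono norm_fejer_le_growth)
  ultimately show "norm (H_fun \<rho> z) \<le> (\<bar>f_fun \<rho> 0\<bar> + W) * growth z"
    unfolding H_fun_eq distrib_right by (meson norm_triangle_ineq add_mono order_trans)
qed

text \<open>The majorant alone need not be integrable near \<open>l = 0\<close> (at
  \<open>x = 0\<close> it is constantly 1). Removing \<open>exp (- l)\<close> leaves a series
  dominated by \<open>H_weight\<close>, and this domination justifies exchanging sum and
  integral.\<close>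

lemma
  fixes x :: real
  shows M_series_diff_integrable: "integrable \<rho> (\<lambda>l. M_series l x - exp (- l))"
    and H_fun_of_real: "H_fun \<rho> (of_real x) = of_real (LINT l|\<rho>. M_series l x - exp (- l))"
proof -
  have bd: "\<bar>H_term l n x\<bar> \<le> H_weight l n * growth (of_real x)" if "l > 0" for l n
    using norm_H_term_le[OF that, of n "of_real x"] unfolding H_term_of_real by simp
  have [measurable]: "(\<lambda>l. H_term l n x) \<in> borel_measurable \<rho>" for n
    unfolding H_term_def by measurable
  have int: "integrable \<rho> (\<lambda>l. H_term l n x)" for n
  proof (rule Bochner_Integration.integrable_bound)
    show "integrable \<rho> (\<lambda>l. H_weight l n * growth (of_real x))" by (simp add: H_weight_integrable)
    show "AE l in \<rho>. norm (H_term l n x) \<le> norm (H_weight l n * growth (of_real x))"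
      using bd[of _ n] by (intro AE_I2) (force simp: space_eq)
  qed measurable
  have s: "summable (\<lambda>n. norm (H_term l n x))" if "l > 0" for l
  proof (rule summable_comparison_test')
    show "norm (norm (H_term l n x)) \<le> H_weight l n * growth (of_real x)" for n using bd[OF that, of n] by simp
    have "summable (H_weight l)"
      by (rule summableI_nonneg_bounded[OF H_weight_nonneg[OF that] sum_H_weight_le[OF that]])
    then show "summable (\<lambda>n. H_weight l n * growth (of_real x))" by (rule summable_mult2)
  qed
  have sI: "summable (\<lambda>n. LINT l|\<rho>. norm (H_term l n x))"
  proof (rule summable_comparison_test'[OF summable_mult2[OF summable_H_weight, of "growth (of_real x)"]])
    fix n :: nat
    have "(LINT l|\<rho>. norm (H_term l n x)) \<le> (LINT l|\<rho>. H_weight l n * growth (of_real x))"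
      using bd[of _ n] int[of n] by (intro integral_mono) (auto simp: space_eq H_weight_integrable)
    then show "norm (LINT l|\<rho>. norm (H_term l n x)) \<le> (LINT l|\<rho>. H_weight l n) * growth (of_real x)" by simp
  qed
  have AE: "AE l in \<rho>. summable (\<lambda>n. norm (H_term l n x))"
    using s by (intro AE_I2) (simp add: space_eq)
  have i0: "integrable \<rho> (\<lambda>l. (1 - exp (- l)) * fejer x)"
    using integrable_exp_diff[of 0 1] by simp
  have iS: "integrable \<rho> (\<lambda>l. \<Sum>n. H_term l n x)"
    by (rule integrable_suminf[OF int AE sI])
  have eq: "(\<Sum>n. H_term l n x) + (1 - exp (- l)) * fejer x = M_series l x - exp (- l)" if "l \<in> space \<rho>" for l
    using sums_unique[OF H_term_sums[of l x]] that by (simp add: space_eq)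
  show "integrable \<rho> (\<lambda>l. M_series l x - exp (- l))"
    using Bochner_Integration.integrable_add[OF iS i0]
    by (subst (asm) Bochner_Integration.integrable_cong[OF refl eq])
  have "(LINT l|\<rho>. M_series l x - exp (- l)) = (LINT l|\<rho>. (\<Sum>n. H_term l n x) + (1 - exp (- l)) * fejer x)"
    by (intro Bochner_Integration.integral_cong refl eq[symmetric])
  also have "\<dots> = (LINT l|\<rho>. (\<Sum>n. H_term l n x)) + f_fun \<rho> 0 * fejer x"
    using Bochner_Integration.integral_add[OF iS i0] by (simp add: f_fun_def)
  also have "(LINT l|\<rho>. (\<Sum>n. H_term l n x)) = (\<Sum>n. LINT l|\<rho>. H_term l n x)"
    by (rule integral_suminf[OF int AE sI])
  finally have "complex_of_real (LINT l|\<rho>. M_series l x - exp (- l)) =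
      of_real (\<Sum>n. LINT l|\<rho>. H_term l n x) + of_real (f_fun \<rho> 0) * fejer (of_real x)"
    by (simp add: fejer_of_real)
  also have "of_real (\<Sum>n. LINT l|\<rho>. H_term l n x) = (\<Sum>n. complex_of_real (LINT l|\<rho>. H_term l n x))"
    by (rule suminf_of_real[OF summable_integral[OF int AE sI]])
  finally show "H_fun \<rho> (of_real x) = of_real (LINT l|\<rho>. M_series l x - exp (- l))"
    by (simp add: H_fun_eq H_term_of_real add.commute)
qed

end

section \<open>Integrals over the real line\<close>

lemma nsinc_measurable [measurable]: "(nsinc :: real \<Rightarrow> real) \<in> borel_measurable borel"
  unfolding nsinc_def by measurable

lemma fejer_measurable [measurable]: "(fejer :: real \<Rightarrow> real) \<in> borel_measurable borel"
  unfolding fejer_def by measurable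

lemma hfejer_measurable [measurable]: "(hfejer :: real \<Rightarrow> real) \<in> borel_measurable borel"
  unfolding hfejer_def by measurable

lemma fejer_pair_measurable [measurable]: "(fejer_pair n :: real \<Rightarrow> real) \<in> borel_measurable borel"
  unfolding fejer_pair_def by measurable

lemma hfejer_pair_measurable [measurable]: "(hfejer_pair n :: real \<Rightarrow> real) \<in> borel_measurable borel"
  unfolding hfejer_pair_def by measurable

lemma fejer_nonneg: "0 \<le> fejer (x::real)"
  by (simp add: fejer_def)

text \<open>Every real lies in exactly one integer translate of \<open>{0..<1}\<close>, the one
  indexed by its floor.\<close>

lemma nn_integral_periodization:
  fixes g :: "real \<Rightarrow> ennreal"
  assumes [measurable]: "g \<in> borel_measurable borel"
  shows "(\<integral>\<^sup>+x. g x \<partial>lborel) = (\<integral>\<^sup>+x. (\<integral>\<^sup>+k. g (of_int k + x) \<partial>count_space UNIV) * indicator {0..<1} x \<partial>lborel)"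
proof -
  have "(\<integral>\<^sup>+k. g x * indicator {0..<1} (x - of_int k) \<partial>count_space UNIV) = g x" for x
  proof -
    have "indicator {0..<1} (x - of_int k) = (indicator {\<lfloor>x\<rfloor>} k :: ennreal)" for k
    proof -
      have "x - of_int k \<in> {0..<1} \<longleftrightarrow> k \<in> {\<lfloor>x\<rfloor>}"
        using floor_eq_iff[of x k] by (auto simp: algebra_simps)
      then show ?thesis by (simp only: indicator_def)
    qed
    then show ?thesis by (simp add: nn_integral_cmult)
  qed
  then have "(\<integral>\<^sup>+x. g x \<partial>lborel) = (\<integral>\<^sup>+x. (\<integral>\<^sup>+k. g x * indicator {0..<1} (x - of_int k) \<partial>count_space UNIV) \<partial>lborel)"
    by simp
  also have "\<dots> = (\<integral>\<^sup>+k. (\<integral>\<^sup>+x. g x * indicator {0..<1} (x - of_int k) \<partial>lborel) \<partial>count_space UNIV)"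
    by (intro nn_integral_count_space_nn_integral) auto
  also have "\<dots> = (\<integral>\<^sup>+k. (\<integral>\<^sup>+x. g (of_int k + x) * indicator {0..<1} x \<partial>lborel) \<partial>count_space UNIV)"
  proof (rule nn_integral_cong)
    fix k :: int
    show "(\<integral>\<^sup>+x. g x * indicator {0..<1} (x - of_int k) \<partial>lborel) = (\<integral>\<^sup>+x. g (of_int k + x) * indicator {0..<1} x \<partial>lborel)"
      by (subst nn_integral_real_affine[where c = 1 and t = "of_int k"]) auto
  qed
  also have "\<dots> = (\<integral>\<^sup>+x. (\<integral>\<^sup>+k. g (of_int k + x) * indicator {0..<1} x \<partial>count_space UNIV) \<partial>lborel)"
    by (intro nn_integral_count_space_nn_integral[symmetric]) auto
  finally show ?thesis by (simp add: nn_integral_multc)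
qed

text \<open>Folding the line onto one period replaces the integrand by the sum of its integer
  translates, which is 1 by \<open>fejer_has_sum\<close>.\<close>

lemma has_bochner_integral_fejer: "has_bochner_integral lborel (fejer :: real \<Rightarrow> real) 1"
proof (rule has_bochner_integral_nn_integral)
  have 1: "(\<integral>\<^sup>+k. ennreal (fejer (of_int k + x)) \<partial>count_space UNIV) = 1" for x
  proof -
    have "((\<lambda>k. fejer (- x - of_int k)) has_sum 1) UNIV" by (rule fejer_has_sum)
    moreover have "fejer (- x - of_int k) = fejer (of_int k + x)" for k
      using fejer_minus[of "of_int k + x"] by (simp add: add.commute del: fejer_minus)
    ultimately have s: "((\<lambda>k. fejer (of_int k + x)) has_sum 1) UNIV" by simp
    then have "(\<lambda>k. norm (fejer (of_int k + x))) summable_on UNIV"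
      by (simp add: fejer_nonneg has_sum_imp_summable)
    then have a: "Infinite_Set_Sum.abs_summable_on (\<lambda>k. fejer (of_int k + x)) UNIV"
      unfolding abs_summable_equivalent[symmetric] .
    then have "(\<integral>\<^sup>+k. ennreal (fejer (of_int k + x)) \<partial>count_space UNIV) = ennreal (infsetsum (\<lambda>k. fejer (of_int k + x)) UNIV)"
      by (rule nn_integral_conv_infsetsum) (simp add: fejer_nonneg)
    also have "infsetsum (\<lambda>k. fejer (of_int k + x)) UNIV = 1"
      using infsetsum_infsum[OF a] infsumI[OF s] by simp
    finally show ?thesis by simp
  qed
  show "(\<integral>\<^sup>+x. ennreal (fejer (x::real)) \<partial>lborel) = ennreal 1"
    by (subst nn_integral_periodization) (simp_all add: 1)
qed (auto simp: fejer_nonneg)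

lemma has_bochner_integral_translate:
  fixes f :: "real \<Rightarrow> real"
  assumes "has_bochner_integral lborel f I"
  shows "has_bochner_integral lborel (\<lambda>x. f (x + c)) I"
  using lborel_has_bochner_integral_real_affine_iff[of 1 f I c] assms by (simp add: add.commute)

lemma has_bochner_integral_fejer_pair: "has_bochner_integral lborel (fejer_pair n :: real \<Rightarrow> real) 2"
proof -
  have "has_bochner_integral lborel (\<lambda>x. fejer (x + (- real (Suc n))) + fejer (x + real (Suc n))) (1 + 1 :: real)"
    by (intro has_bochner_integral_add has_bochner_integral_translate has_bochner_integral_fejer)
  then show ?thesis by (simp add: fejer_pair_def[abs_def] del: of_nat_Suc)
qed

text \<open>A single translate of \<open>hfejer\<close> decays only like \<open>1 / x\<close>. The
  shift by \<open>2 * m\<close> leaves the sine unchanged, so the difference collapses to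
  \<open>2 * m * u * v\<close> with two sinc factors, and
  \<open>|2 * u * v| \<le> u^2 + v^2\<close>.\<close>

lemma abs_hfejer_pair_le: "\<bar>hfejer_pair n x\<bar> \<le> real (Suc n) * fejer_pair n (x::real)"
proof -
  define m where "m = real (Suc n)"
  define u v where "u = nsinc (x - m)" and "v = nsinc (x + m)"
  have "sin (pi * (x + m)) = sin (pi * (x - m) + of_nat (Suc n) * (2 * of_real pi))"
    by (simp add: m_def algebra_simps)
  then have "sin (pi * (x + m)) = sin (pi * (x - m))"
    by (simp only: sin.plus_of_nat)
  then have S: "(x + m) * v = (x - m) * u"
    unfolding u_def v_def mult_nsinc by simp
  have "hfejer_pair n x = u * ((x - m) * u) - v * ((x + m) * v)"
    by (simp add: hfejer_pair_def hfejer_def u_def v_def m_def power2_eq_square)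
  also have "\<dots> = u * ((x + m) * v) - v * ((x - m) * u)"
    by (simp only: S)
  also have "\<dots> = m * (2 * (u * v))" by (simp add: algebra_simps)
  finally have "\<bar>hfejer_pair n x\<bar> = m * \<bar>2 * (u * v)\<bar>" by (simp add: abs_mult m_def)
  also have "\<bar>2 * (u * v)\<bar> \<le> u\<^sup>2 + v\<^sup>2"
    using zero_le_power2[of "u - v"] zero_le_power2[of "u + v"] unfolding power2_diff power2_sum by (simp add: abs_if)
  also have "u\<^sup>2 + v\<^sup>2 = fejer_pair n x" by (simp add: fejer_pair_def fejer_def u_def v_def m_def)
  finally show ?thesis by (simp add: m_def mult_left_mono)
qed

lemma integral_hfejer_pair_abs:
  shows "integrable lborel (hfejer_pair n :: real \<Rightarrow> real)"
    and "(LINT x|lborel. \<bar>hfejer_pair n x :: real\<bar>) \<le> 2 * real (Suc n)"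
proof -
  have f: "has_bochner_integral lborel (\<lambda>x. real (Suc n) * fejer_pair n x) (real (Suc n) * 2)"
    by (intro has_bochner_integral_mult_right has_bochner_integral_fejer_pair)
  then have f': "integrable lborel (\<lambda>x. real (Suc n) * fejer_pair n x)"
    by (rule integrable.intros)
  then show i: "integrable lborel (hfejer_pair n :: real \<Rightarrow> real)"
  proof (rule Bochner_Integration.integrable_bound)
    show "AE x in lborel. norm (hfejer_pair n x) \<le> norm (real (Suc n) * fejer_pair n (x::real))"
      unfolding real_norm_def by (intro AE_I2 order_trans[OF abs_hfejer_pair_le abs_ge_self])
  qed simp
  have "(LINT x|lborel. \<bar>hfejer_pair n x :: real\<bar>) \<le> (LINT x|lborel. real (Suc n) * fejer_pair n x)"
    by (intro integral_mono integrable_abs abs_hfejer_pair_le i f')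
  then show "(LINT x|lborel. \<bar>hfejer_pair n x :: real\<bar>) \<le> 2 * real (Suc n)"
    using has_bochner_integral_integral_eq[OF f] by simp
qed

lemma integral_eq_lim_antiderivative:
  fixes f F :: "real \<Rightarrow> 'a::euclidean_space"
  assumes F: "\<And>x. (F has_vector_derivative f x) (at x)" and f: "continuous_on UNIV f"
    and int: "integrable lborel f" and lim: "(\<lambda>n. F (real n) - F (- real n)) \<longlonglongrightarrow> L"
  shows "(LINT x|lborel. f x) = L"
proof -
  have "(\<lambda>n. LINT x|lborel. indicator {- real n..real n} x *\<^sub>R f x) \<longlonglongrightarrow> (LINT x|lborel. f x)"
  proof (rule integral_dominated_convergence)
    show "integrable lborel (\<lambda>x. norm (f x))" using int by (rule integrable_norm)
    show "AE x in lborel. (\<lambda>n. indicator {- real n..real n} x *\<^sub>R f x) \<longlonglongrightarrow> f x"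
    proof (rule AE_I2)
      fix x
      have "eventually (\<lambda>n. indicator {- real n..real n} x *\<^sub>R f x = f x) sequentially"
        using eventually_ge_at_top[of "nat \<lceil>\<bar>x\<bar>\<rceil>"]
        by eventually_elim (auto simp: indicator_def nat_le_iff; linarith)
      then show "(\<lambda>n. indicator {- real n..real n} x *\<^sub>R f x) \<longlonglongrightarrow> f x"
        by (rule tendsto_eventually)
    qed
    show "f \<in> borel_measurable lborel" using int by auto
    then show "\<And>i. (\<lambda>x. indicator {- real i..real i} x *\<^sub>R f x) \<in> borel_measurable lborel" by auto
  qed (auto simp: indicator_def)
  moreover have "(LINT x|lborel. indicator {- real n..real n} x *\<^sub>R f x) = F (real n) - F (- real n)" for n
    by (rule integral_FTC_atLeastAtMost)
       (auto intro: has_vector_derivative_at_within F continuous_on_subset[OF f])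
  ultimately show ?thesis using lim LIMSEQ_unique by simp
qed

lemma continuous_hfejer: "continuous_on UNIV (hfejer :: real \<Rightarrow> real)"
proof -
  have "continuous_on UNIV (hfejer :: complex \<Rightarrow> complex)"
    by (intro holomorphic_on_imp_continuous_on holomorphic_intros)
  then have "continuous_on UNIV (\<lambda>x::real. Re (hfejer (complex_of_real x)))"
    by (intro continuous_on_Re) (rule continuous_on_compose2[where f = of_real], auto)
  then show ?thesis by (simp add: hfejer_of_real)
qed

lemma abs_hfejer_le: "x > 0 \<Longrightarrow> \<bar>hfejer x\<bar> \<le> 1 / (x::real)"
proof -
  assume x: "x > 0"
  have "x * \<bar>hfejer x\<bar> = (sin (pi * x) / pi)\<^sup>2"
    using arg_cong[OF mult_hfejer[of x], of abs] x by (simp add: abs_mult)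
  also have "\<dots> \<le> 1"
  proof -
    have "\<bar>sin (pi * x) / pi\<bar> \<le> 1 / 1" unfolding abs_divide using pi_gt3 by (intro frac_le) auto
    then show ?thesis by (simp add: abs_square_le_1)
  qed
  finally show ?thesis using x by (simp add: field_simps)
qed

text \<open>The integrand is a difference of two translates of the odd function \<open>hfejer\<close>, which is
  \<open>O(1 / x)\<close> and has an even antiderivative.\<close>

lemma integral_hfejer_pair: "(LINT x|lborel. hfejer_pair n x :: real) = 0"
proof -
  define m where "m = real (Suc n)"
  have m0: "m > 0" by (simp add: m_def)
  have "isCont (hfejer :: real \<Rightarrow> real) x" for x
    using continuous_hfejer by (simp add: continuous_on_eq_continuous_at)
  then obtain \<Phi> where "\<And>x. (\<Phi> has_vector_derivative hfejer x) (at (x::real))"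
    using einterval_antiderivative[of "-\<infinity>" "\<infinity>" "hfejer :: real \<Rightarrow> real"] by auto
  then have \<Phi>: "(\<Phi> has_real_derivative hfejer x) (at x)" for x
    by (simp add: has_real_derivative_iff_has_vector_derivative)
  have mvt: "\<bar>\<Phi> b - \<Phi> a\<bar> \<le> (b - a) * (1 / a)" if "0 < a" and "a < b" for a b
  proof -
    obtain z where z: "a < z" "z < b" "\<Phi> b - \<Phi> a = (b - a) * hfejer z"
      using MVT2[OF \<open>a < b\<close>, of \<Phi> hfejer] \<Phi> by blast
    have "\<bar>hfejer z\<bar> \<le> 1 / z" using abs_hfejer_le z \<open>0 < a\<close> by simp
    also have "\<dots> \<le> 1 / a" using z \<open>0 < a\<close> by (intro frac_le) auto
    finally have "(b - a) * \<bar>hfejer z\<bar> \<le> (b - a) * (1 / a)" using \<open>a < b\<close> by (intro mult_left_mono) auto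
    then show ?thesis using z \<open>a < b\<close> by (simp add: abs_mult)
  qed
  \<comment> \<open>The derivative is \<open>hfejer x + hfejer (- x)\<close>, which vanishes because
    \<open>hfejer\<close> is odd.\<close>
  have "((\<lambda>x. \<Phi> x - \<Phi> (- x)) has_real_derivative 0) (at x)" for x
    using DERIV_diff[OF \<Phi>[of x] DERIV_chain2[OF \<Phi> DERIV_minus[OF DERIV_ident]]] by simp
  then have "\<Phi> x - \<Phi> (- x) = \<Phi> 0 - \<Phi> (- 0)" for x
    by (intro DERIV_isconst_all allI)
  then have even: "\<Phi> (- x) = \<Phi> x" for x by simp
  define G where "G = (\<lambda>x. \<Phi> (x - m) - \<Phi> (x + m))"
  show ?thesis
  proof (rule integral_eq_lim_antiderivative)
    show "(G has_vector_derivative hfejer_pair n x) (at x)" for x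
      unfolding has_real_derivative_iff_has_vector_derivative[symmetric] G_def hfejer_pair_def m_def
      using DERIV_diff[OF \<Phi>[of "x + - m", unfolded DERIV_shift] \<Phi>[of "x + m", unfolded DERIV_shift]]
      by (simp add: m_def del: of_nat_Suc)
    show "continuous_on UNIV (hfejer_pair n :: real \<Rightarrow> real)"
      unfolding hfejer_pair_def
      by (intro continuous_intros continuous_on_compose2[OF continuous_hfejer]) auto
    show "integrable lborel (hfejer_pair n :: real \<Rightarrow> real)" by (rule integral_hfejer_pair_abs)
    \<comment> \<open>By evenness the two ends contribute equally, each through an interval of
      length \<open>2 * m\<close> around \<open>N\<close>, on which \<open>|hfejer|\<close> is at
      most \<open>1 / (N - m)\<close>.\<close>
    have G: "G (real N) - G (- real N) = - 2 * (\<Phi> (real N + m) - \<Phi> (real N - m))" for N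
    proof -
      have "- real N - m = - (real N + m)" "- real N + m = - (real N - m)" by simp_all
      then have "G (- real N) = \<Phi> (real N + m) - \<Phi> (real N - m)" unfolding G_def by (simp only: even)
      then show ?thesis by (simp add: G_def)
    qed
    show "(\<lambda>N. G (real N) - G (- real N)) \<longlonglongrightarrow> 0"
    proof (rule Lim_null_comparison)
      show "\<forall>\<^sub>F N in sequentially. norm (G (real N) - G (- real N)) \<le> 4 * m * (1 / (real N - m))"
        using eventually_gt_at_top[of "Suc n"]
      proof eventually_elim
        case (elim N)
        then have "0 < real N - m" by (simp add: m_def)
        then have "\<bar>\<Phi> (real N + m) - \<Phi> (real N - m)\<bar> \<le> (real N + m - (real N - m)) * (1 / (real N - m))"
          by (intro mvt) (simp_all add: m_def)
        then show ?case unfolding G real_norm_def abs_mult by simp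
      qed
      show "(\<lambda>N. 4 * m * (1 / (real N - m))) \<longlonglongrightarrow> 0" using m0 by real_asymp
    qed
  qed
qed

lemma M_series_term_measurable [measurable]:
  "(\<lambda>x. M_series_term l n x :: real) \<in> borel_measurable borel"
  unfolding M_series_term_def by measurable

lemma has_bochner_integral_M_series_term:
  "has_bochner_integral lborel (\<lambda>x. M_series_term l n x :: real) (2 * exp (- l * real (Suc n)))"
proof -
  have h: "has_bochner_integral lborel (hfejer_pair n :: real \<Rightarrow> real) 0"
    using integral_hfejer_pair[of n] integral_hfejer_pair_abs(1)[of n] by (simp add: has_bochner_integral_iff)
  have "has_bochner_integral lborel (\<lambda>x. exp (- l * real (Suc n)) * (fejer_pair n x - l * hfejer_pair n x))
     (exp (- l * real (Suc n)) * (2 - l * 0))"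
    by (intro has_bochner_integral_mult_right has_bochner_integral_diff has_bochner_integral_fejer_pair h)
  then show ?thesis by (simp add: M_series_term_def mult.commute)
qed

lemma summable_mult_exp:
  assumes l: "l > 0"
  shows "summable (\<lambda>n. real (Suc n) * exp (- l * real (Suc n)))"
proof (rule summable_comparison_test'[where N = 0])
  show "summable (\<lambda>n. 2 / l * exp (- (l / 2) * real (Suc n)))"
    using l by (intro summable_mult summable_exp_mult) auto
  fix n
  define m where "m = real (Suc n)"
  have "m * (l / 2) \<le> exp (l / 2 * m)" using exp_ge_add_one_self[of "l / 2 * m"] by (simp only: mult.commute)
  then have "m \<le> exp (l / 2 * m) / (l / 2)" using l by (subst pos_le_divide_eq) auto
  then have "m \<le> 2 / l * exp (l / 2 * m)" by (simp add: mult.commute)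
  then have "m * exp (- l * m) \<le> 2 / l * exp (l / 2 * m) * exp (- l * m)" by (intro mult_right_mono) auto
  also have "\<dots> = 2 / l * exp (- (l / 2) * m)" by (simp add: mult.assoc flip: exp_add)
  finally show "norm (real (Suc n) * exp (- l * real (Suc n))) \<le> 2 / l * exp (- (l / 2) * real (Suc n))"
    by (simp add: m_def)
qed

lemma coth_half:
  assumes l: "l > 0"
  shows "coth (l / 2) = 1 + 2 / (exp l - 1)"
proof -
  define E where "E = exp (l / 2)"
  have E: "E > 1" "exp l = E * E" "exp (- (l / 2)) = 1 / E"
    using l by (simp_all add: E_def exp_minus field_simps flip: exp_add)
  have "E * E > 1" using E by (simp add: less_1_mult)
  then show ?thesis
    using E unfolding coth_def cosh_field_def sinh_field_def E E_def[symmetric]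
    by (simp add: field_simps)
qed

text \<open>Slopes contribute nothing and each value \<open>exp (- l * |k|)\<close> contributes
  itself, so the integral is a two-sided geometric series. The absolute integrals of the slope
  kernels are bounded only linearly in the node, hence \<open>summable_mult_exp\<close>.\<close>

lemma has_bochner_integral_M_series:
  assumes l: "l > 0"
  shows "has_bochner_integral lborel (M_series l :: real \<Rightarrow> real) (coth (l / 2))"
proof -
  define t where "t = (\<lambda>n x. M_series_term l n x :: real)"
  have i: "integrable lborel (t n)" for n
    unfolding t_def using has_bochner_integral_M_series_term by (rule integrable.intros)
  have AE: "AE x in lborel. summable (\<lambda>n. norm (t n x))"
    unfolding t_def using summable_M_series_term_real[OF l] by (intro AE_I2) simp
  have S: "summable (\<lambda>n. LINT x|lborel. norm (t n x))"
  proof (rule summable_comparison_test'[where N = 0])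
    show "summable (\<lambda>n. (2 + 2 * l) * (real (Suc n) * exp (- l * real (Suc n))))"
      by (intro summable_mult summable_mult_exp l)
    fix n
    define m where "m = real (Suc n)"
    have m: "m \<ge> 1" by (simp add: m_def)
    have "(LINT x|lborel. norm (t n x)) \<le> (LINT x|lborel. exp (- l * m) * (fejer_pair n x + l * \<bar>hfejer_pair n x\<bar>))"
    proof (rule integral_mono)
      show "integrable lborel (\<lambda>x. norm (t n x))" using i by (rule integrable_norm)
      show "integrable lborel (\<lambda>x. exp (- l * m) * (fejer_pair n x + l * \<bar>hfejer_pair n x\<bar>))"
        by (intro integrable_mult_right Bochner_Integration.integrable_add integrable_abs integral_hfejer_pair_abs
              integrable.intros[OF has_bochner_integral_fejer_pair])
      fix x :: real
      have "\<bar>fejer_pair n x - l * hfejer_pair n x\<bar> \<le> fejer_pair n x + l * \<bar>hfejer_pair n x\<bar>"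
        using l fejer_nonneg by (intro order_trans[OF abs_triangle_ineq4]) (simp add: abs_mult fejer_pair_def)
      then show "norm (t n x) \<le> exp (- l * m) * (fejer_pair n x + l * \<bar>hfejer_pair n x\<bar>)"
        by (simp add: t_def M_series_term_def abs_mult m_def)
    qed
    also have "\<dots> = exp (- l * m) * (2 + l * (LINT x|lborel. \<bar>hfejer_pair n x\<bar>))"
      using has_bochner_integral_integral_eq[OF has_bochner_integral_fejer_pair[of n]]
      by (simp add: integral_hfejer_pair_abs(1) integrable.intros[OF has_bochner_integral_fejer_pair])
    also have "\<dots> \<le> exp (- l * m) * (2 * m + l * (2 * m))"
      using integral_hfejer_pair_abs(2)[of n] l m
      by (intro mult_left_mono add_mono) (auto simp: m_def)
    finally show "norm (LINT x|lborel. norm (t n x)) \<le> (2 + 2 * l) * (real (Suc n) * exp (- l * real (Suc n)))"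
      by (simp add: m_def algebra_simps)
  qed
  have e: "(\<lambda>n. 2 * exp (- l * real (Suc n))) sums (2 / (exp l - 1))"
  proof -
    have "(\<lambda>n. exp (- real n * l)) sums (1 / (1 - exp (- l)))" by (rule geometric_sums_exp[OF l])
    then have "(\<lambda>n. 2 * exp (- l) * exp (- real n * l)) sums (2 * exp (- l) * (1 / (1 - exp (- l))))"
      by (rule sums_mult)
    moreover have "(\<lambda>n. 2 * exp (- l) * exp (- real n * l)) = (\<lambda>n. 2 * exp (- l * real (Suc n)))"
    proof
      have "exp (- l) * exp (- real n * l) = exp (- l * real (Suc n))" for n
        by (simp add: algebra_simps flip: exp_add)
      then show "2 * exp (- l) * exp (- real n * l) = 2 * exp (- l * real (Suc n))" for n
        by (simp only: mult.assoc)
    qed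
    moreover have "2 * exp (- l) * (1 / (1 - exp (- l))) = 2 / (exp l - 1)"
      using l by (simp add: exp_minus field_simps)
    ultimately show ?thesis by (simp only:)
  qed
  have "(LINT x|lborel. (\<Sum>n. t n x)) = (\<Sum>n. LINT x|lborel. t n x)"
    by (rule integral_suminf[OF i AE S])
  also have "\<dots> = 2 / (exp l - 1)"
    using sums_unique[OF e] has_bochner_integral_integral_eq[OF has_bochner_integral_M_series_term[of l]]
    by (simp add: t_def)
  finally have "has_bochner_integral lborel (\<lambda>x. \<Sum>n. t n x) (2 / (exp l - 1))"
    using integrable_suminf[OF i AE S] by (simp add: has_bochner_integral_iff)
  then have "has_bochner_integral lborel (\<lambda>x. fejer x + (\<Sum>n. t n x)) (1 + 2 / (exp l - 1))"
    by (intro has_bochner_integral_add has_bochner_integral_fejer)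
  then show ?thesis by (simp add: M_series_def[abs_def] t_def coth_half[OF l])
qed

section \<open>The Fourier transform of the two-sided exponential\<close>

lemma has_bochner_integral_exp_atLeast:
  fixes c :: complex
  assumes c: "Re c > 0"
  shows "has_bochner_integral lborel (\<lambda>x. indicator {0..} x *\<^sub>R exp (- c * of_real x)) (1 / c)"
proof -
  define f where "f = (\<lambda>x. indicator {0..} x *\<^sub>R exp (- c * of_real x))"
  have nn: "(\<integral>\<^sup>+x. ennreal (exp (- Re c * x)) * indicator {0..} x \<partial>lborel) = ennreal (0 - (- exp (- Re c * 0) / Re c))"
  proof (rule nn_integral_FTC_atLeast)
    show "((\<lambda>x. - exp (- Re c * x) / Re c) has_real_derivative exp (- Re c * x)) (at x)" for x
      using c by (auto intro!: derivative_eq_intros)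
    show "((\<lambda>x. - exp (- Re c * x) / Re c) \<longlongrightarrow> 0) at_top" using c by real_asymp
  qed auto
  have norm: "ennreal (norm (f x)) = ennreal (exp (- Re c * x)) * indicator {0..} x" for x
    by (simp add: f_def norm_exp_eq_Re indicator_def)
  have cont: "continuous_on A (\<lambda>x. exp (- c * of_real x))" for A
    by (intro continuous_intros)
  have meas: "f \<in> borel_measurable lborel"
    unfolding f_def by (intro borel_measurable_scaleR borel_measurable_indicator)
      (use borel_measurable_continuous_onI[OF cont] in auto)
  have int: "integrable lborel f"
  proof (rule integrableI_bounded)
    show "(\<integral>\<^sup>+x. ennreal (norm (f x)) \<partial>lborel) < \<infinity>"
      unfolding norm nn by simp
  qed (rule meas)
  have "(\<lambda>n. LINT x|lborel. indicator {0..real n} x *\<^sub>R exp (- c * of_real x)) \<longlonglongrightarrow> (LINT x|lborel. f x)"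
  proof (rule integral_dominated_convergence)
    show "integrable lborel (\<lambda>x. norm (f x))" using int by (rule integrable_norm)
    show "AE x in lborel. (\<lambda>n. indicator {0..real n} x *\<^sub>R exp (- c * of_real x)) \<longlonglongrightarrow> f x"
    proof (rule AE_I2)
      fix x
      have "eventually (\<lambda>n. indicator {0..real n} x *\<^sub>R exp (- c * of_real x) = f x) sequentially"
        using eventually_ge_at_top[of "nat \<lceil>\<bar>x\<bar>\<rceil>"]
        by eventually_elim (auto simp: f_def indicator_def nat_le_iff; linarith)
      then show "(\<lambda>n. indicator {0..real n} x *\<^sub>R exp (- c * of_real x)) \<longlonglongrightarrow> f x"
        by (rule tendsto_eventually)
    qed
    show "(\<lambda>x. indicator {0..real i} x *\<^sub>R exp (- c * of_real x)) \<in> borel_measurable lborel" for i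
      by (intro borel_measurable_scaleR borel_measurable_indicator)
        (use borel_measurable_continuous_onI[OF cont] in auto)
  qed (auto simp: f_def indicator_def intro: meas)
  moreover have "(LINT x|lborel. indicator {0..real n} x *\<^sub>R exp (- c * of_real x)) = (1 - exp (- c * of_real (real n))) / c" for n
  proof -
    have "(LINT x|lborel. indicator {0..real n} x *\<^sub>R exp (- c * of_real x)) =
       - exp (- c * of_real (real n)) / c - (- exp (- c * of_real 0) / c)"
    proof (rule integral_FTC_atLeastAtMost)
      fix x
      have "((\<lambda>z. - exp (- c * z) / c) has_field_derivative exp (- c * of_real x)) (at (of_real x))"
        using c by (auto intro!: derivative_eq_intros)
      then have "((\<lambda>z. - exp (- c * z) / c) \<circ> of_real has_vector_derivative 1 * exp (- c * of_real x)) (at x)"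
        by (intro field_vector_diff_chain_at) (auto intro!: derivative_eq_intros)
      then show "((\<lambda>x. - exp (- c * of_real x) / c) has_vector_derivative exp (- c * of_real x)) (at x within {0..real n})"
        by (auto simp: o_def intro: has_vector_derivative_at_within)
    qed (simp, rule cont)
    then show ?thesis by (simp add: diff_divide_distrib)
  qed
  moreover have "(\<lambda>n. (1 - exp (- c * of_real (real n))) / c) \<longlonglongrightarrow> (1 - 0) / c"
  proof (intro tendsto_intros)
    have "(\<lambda>n. exp (- Re c * real n)) \<longlonglongrightarrow> 0" using c by real_asymp
    then show "(\<lambda>n. exp (- c * of_real (real n))) \<longlonglongrightarrow> 0"
      by (intro tendsto_norm_zero_cancel[where f = "\<lambda>n. exp (- c * of_real (real n))"]) (simp add: norm_exp_eq_Re)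
  qed (use c in auto)
  ultimately have "(LINT x|lborel. f x) = 1 / c" using LIMSEQ_unique by simp
  with int show ?thesis by (simp add: has_bochner_integral_iff f_def)
qed

lemma has_bochner_integral_exp_abs:
  fixes l t :: real
  assumes l: "l > 0"
  shows "has_bochner_integral lborel (\<lambda>x. of_real (exp (- l * \<bar>x\<bar>)) * e_char (of_real (- t * x)))
    (of_real (2 * l / (l\<^sup>2 + 4 * pi\<^sup>2 * t\<^sup>2)))"
proof -
  \<comment> \<open>The half-lines contribute \<open>1 / c\<close> and \<open>1 / cnj c\<close>,
    whose sum is \<open>2 * Re c / |c|^2\<close>.\<close>
  define c where "c = Complex l (2 * pi * t)"
  define g where "g = (\<lambda>c x. indicator {0..} x *\<^sub>R exp (- c * complex_of_real x))"
  have c: "Re c > 0" "Re (cnj c) > 0" using l by (simp_all add: c_def)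
  have "has_bochner_integral lborel (g (cnj c)) (1 / cnj c)"
    unfolding g_def by (rule has_bochner_integral_exp_atLeast) (rule c)
  then have "has_bochner_integral lborel (\<lambda>x. g (cnj c) (- x)) (1 / cnj c)"
    using lborel_has_bochner_integral_real_affine_iff[of "- 1" "g (cnj c)" "1 / cnj c" 0] by simp
  moreover have "has_bochner_integral lborel (g c) (1 / c)"
    unfolding g_def by (rule has_bochner_integral_exp_atLeast) (rule c)
  ultimately have sum: "has_bochner_integral lborel (\<lambda>x. g c x + g (cnj c) (- x)) (1 / c + 1 / cnj c)"
    by (intro has_bochner_integral_add)
  \<comment> \<open>Both indicators contain 0, so the decomposition counts that point twice.\<close>
  have "AE x in lborel. x \<noteq> (0::real)" by (rule AE_lborel_singleton)
  then have AE: "AE x in lborel. g c x + g (cnj c) (- x) = of_real (exp (- l * \<bar>x\<bar>)) * e_char (of_real (- t * x))"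
  proof eventually_elim
    case (elim x)
    have "of_real (exp (- l * \<bar>x\<bar>)) * e_char (of_real (- t * x)) = exp (complex_of_real (- l * \<bar>x\<bar>) + 2 * of_real pi * \<i> * of_real (- t * x))"
      by (simp only: e_char_def exp_add exp_of_real)
    moreover have "x > 0 \<Longrightarrow> complex_of_real (- l * \<bar>x\<bar>) + 2 * of_real pi * \<i> * of_real (- t * x) = - c * of_real x"
      "x < 0 \<Longrightarrow> complex_of_real (- l * \<bar>x\<bar>) + 2 * of_real pi * \<i> * of_real (- t * x) = - cnj c * of_real (- x)"
      by (auto simp: c_def complex_eq_iff)
    ultimately show ?case using elim by (cases "x > 0") (auto simp: g_def)
  qed
  have "1 / c + 1 / cnj c = (c + cnj c) / (c * cnj c)"
    using c by (cases "c = 0") (auto simp: field_simps)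
  also have "\<dots> = of_real (2 * Re c) / of_real ((Re c)\<^sup>2 + (Im c)\<^sup>2)"
    by (simp only: complex_add_cnj complex_mult_cnj)
  also have "\<dots> = of_real (2 * l / (l\<^sup>2 + 4 * pi\<^sup>2 * t\<^sup>2))"
    by (simp add: c_def power_mult_distrib)
  finally have "has_bochner_integral lborel (\<lambda>x. g c x + g (cnj c) (- x)) (of_real (2 * l / (l\<^sup>2 + 4 * pi\<^sup>2 * t\<^sup>2)))"
    using sum by simp
  moreover from this have "(\<lambda>x. g c x + g (cnj c) (- x)) \<in> borel_measurable lborel"
    by (rule borel_measurable_has_bochner_integral)
  moreover have "(\<lambda>x. of_real (exp (- l * \<bar>x\<bar>)) * e_char (of_real (- t * x))) \<in> borel_measurable lborel"
    unfolding e_char_def by measurable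
  ultimately show ?thesis
    using has_bochner_integral_cong_AE[OF _ _ AE] by blast
qed

section \<open>Averaging over the measure\<close>

lemma norm_e_char_of_real [simp]: "norm (e_char (of_real r)) = 1"
  by (simp add: e_char_def norm_exp_eq_Re)

lemma e_char_measurable [measurable]: "(\<lambda>x. e_char (complex_of_real x)) \<in> borel_measurable borel"
  unfolding e_char_def by measurable

definition majorant_gap :: "real \<Rightarrow> real \<Rightarrow> real" where
  "majorant_gap l x = M_series l x - exp (- l * \<bar>x\<bar>)"

lemma majorant_gap_nonneg: "l > 0 \<Longrightarrow> 0 \<le> majorant_gap l x"
  using M_series_ge_exp[of l x] by (simp add: majorant_gap_def)

lemma integrable_mult_e_char:
  assumes "integrable lborel f"
  shows "integrable lborel (\<lambda>x. complex_of_real (f x) * e_char (of_real (- t * x)))"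
proof (rule Bochner_Integration.integrable_bound[OF assms])
  show "(\<lambda>x. complex_of_real (f x) * e_char (of_real (- t * x))) \<in> borel_measurable lborel"
    using borel_measurable_integrable[OF assms] by measurable
  show "AE x in lborel. norm (complex_of_real (f x) * e_char (of_real (- t * x))) \<le> norm (f x)"
    by (simp add: norm_mult del: of_real_mult of_real_minus)
qed

lemma
  assumes l: "l > 0"
  shows has_bochner_integral_majorant_gap:
      "has_bochner_integral lborel (majorant_gap l) (coth (l / 2) - 2 / l)"
    and has_bochner_integral_majorant_gap_e_char:
      "has_bochner_integral lborel (\<lambda>x. complex_of_real (majorant_gap l x) * e_char (of_real (- t * x)))
         (M_hat l t - of_real (2 * l / (l\<^sup>2 + 4 * pi\<^sup>2 * t\<^sup>2)))"
proof -
  have M: "has_bochner_integral lborel (\<lambda>x. M_series l x) (coth (l / 2))"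
    by (rule has_bochner_integral_M_series[OF l])
  \<comment> \<open>The case \<open>t = 0\<close> of the transform yields the real integral
    \<open>2 / l\<close>.\<close>
  have "has_bochner_integral lborel (\<lambda>x. complex_of_real (exp (- l * \<bar>x\<bar>)) * e_char (of_real (- 0 * x)))
      (complex_of_real (2 * l / (l\<^sup>2 + 4 * pi\<^sup>2 * 0\<^sup>2)))"
    by (rule has_bochner_integral_exp_abs[OF l])
  then have "has_bochner_integral lborel (\<lambda>x. complex_of_real (exp (- l * \<bar>x\<bar>))) (complex_of_real (2 / l))"
    using l by (simp add: e_char_def power2_eq_square)
  then have "has_bochner_integral lborel (\<lambda>x. exp (- l * \<bar>x\<bar>)) (2 / l)"
    by (simp only: has_bochner_integral_iff complex_of_real_integrable_eq integral_complex_of_real of_real_eq_iff)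
  then show "has_bochner_integral lborel (majorant_gap l) (coth (l / 2) - 2 / l)"
    unfolding majorant_gap_def by (intro has_bochner_integral_diff M)
  have "integrable lborel (\<lambda>x. complex_of_real (M_series l x) * e_char (of_real (- t * x)))"
    using M by (intro integrable_mult_e_char integrable.intros)
  moreover have "M_hat l t = (LINT x|lborel. complex_of_real (M_series l x) * e_char (of_real (- t * x)))"
    by (simp only: M_hat_def M_fun_eq[OF l] M_series_of_real[OF l])
  ultimately have "has_bochner_integral lborel (\<lambda>x. complex_of_real (M_series l x) * e_char (of_real (- t * x))) (M_hat l t)"
    by (simp add: has_bochner_integral_iff)
  then have "has_bochner_integral lborel
      (\<lambda>x. complex_of_real (M_series l x) * e_char (of_real (- t * x)) - complex_of_real (exp (- l * \<bar>x\<bar>)) * e_char (of_real (- t * x)))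
      (M_hat l t - of_real (2 * l / (l\<^sup>2 + 4 * pi\<^sup>2 * t\<^sup>2)))"
    by (intro has_bochner_integral_diff has_bochner_integral_exp_abs l)
  then show "has_bochner_integral lborel (\<lambda>x. complex_of_real (majorant_gap l x) * e_char (of_real (- t * x)))
         (M_hat l t - of_real (2 * l / (l\<^sup>2 + 4 * pi\<^sup>2 * t\<^sup>2)))"
    by (simp add: majorant_gap_def left_diff_distrib del: of_real_mult of_real_minus)
qed

text \<open>The lower bound holds because this is the integral of the nonnegative
  \<open>majorant_gap\<close>; the upper one follows from
  \<open>exp l \<ge> 1 + l + l^2 / 2\<close>. The latter makes the gap integrable over the product
  space.\<close>

lemma coth_minus_inverse_bounds:
  assumes l: "l > 0"
  shows "0 \<le> coth (l / 2) - 2 / l" "coth (l / 2) - 2 / l \<le> l / (l + 1)"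
proof -
  show "0 \<le> coth (l / 2) - 2 / l"
    unfolding has_bochner_integral_integral_eq[OF has_bochner_integral_majorant_gap[OF l], symmetric]
    by (intro integral_nonneg_AE AE_I2 majorant_gap_nonneg l)
  have "coth (l / 2) = 1 + 2 / (exp l - 1)" by (rule coth_half[OF l])
  also have "\<dots> \<le> 1 + 2 / (l + l\<^sup>2 / 2)"
    using exp_lower_Taylor_quadratic[of l] l by (intro add_left_mono divide_left_mono) (auto intro!: mult_pos_pos add_pos_pos)
  also have "\<dots> = 2 / l + l / (l + 2)"
  proof -
    have "l + l\<^sup>2 / 2 = l * (l + 2) / 2" by (simp add: power2_eq_square algebra_simps)
    moreover have "1 + 2 / (l * (l + 2) / 2) = 2 / l + l / (l + 2)"
      using l by (simp add: divide_simps) (simp add: algebra_simps)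
    ultimately show ?thesis by (simp only:)
  qed
  also have "l / (l + 2) \<le> l / (l + 1)" using l by (intro divide_left_mono) auto
  finally show "coth (l / 2) - 2 / l \<le> l / (l + 1)" by simp
qed

context laplace_measure
begin

text \<open>Required for Fubini's theorem, as \<rho> may have infinite mass near 0. The superlevel
  sets of \<open>l / (l + 1)\<close> have finite measure by Markov's inequality and exhaust the
  space.\<close>

lemma sigma_finite: "sigma_finite_measure \<rho>"
proof
  define A where "A = (\<lambda>n. {l \<in> space \<rho>. 1 \<le> ennreal (real (Suc n)) * ennreal (l / (l + 1))})"
  have "emeasure \<rho> (A n) \<noteq> \<infinity>" for n
  proof -
    have "emeasure \<rho> (A n) \<le> ennreal (real (Suc n)) * (\<integral>\<^sup>+l. ennreal (l / (l + 1)) * indicator (space \<rho>) l \<partial>\<rho>)"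
      using nn_integral_Markov_inequality[of "\<lambda>l. ennreal (l / (l + 1))" "space \<rho>" \<rho> "ennreal (real (Suc n))"]
      by (simp add: A_def)
    also have "(\<integral>\<^sup>+l. ennreal (l / (l + 1)) * indicator (space \<rho>) l \<partial>\<rho>) = (\<integral>\<^sup>+l. ennreal (l / (l + 1)) \<partial>\<rho>)"
      by (intro nn_integral_cong) simp
    also have "ennreal (real (Suc n)) * \<dots> < \<infinity>"
      using finite_integral by (simp add: ennreal_mult_less_top del: of_nat_Suc)
    finally show ?thesis by simp
  qed
  moreover have "A n \<in> sets \<rho>" for n unfolding A_def by measurable
  moreover have "(\<Union>n. A n) = space \<rho>"
  proof (intro equalityI subsetI)
    fix l assume l: "l \<in> space \<rho>"
    then have "l > 0" by (simp add: space_eq)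
    then obtain n where "1 / (l / (l + 1)) < real n" using reals_Archimedean2 by blast
    then have "1 / (l / (l + 1)) \<le> real (Suc n)" by simp
    then have "1 \<le> real (Suc n) * (l / (l + 1))" using \<open>l > 0\<close> by (simp add: field_simps)
    then have "ennreal 1 \<le> ennreal (real (Suc n) * (l / (l + 1)))" by (rule ennreal_leI)
    moreover have "ennreal (real (Suc n) * (l / (l + 1))) = ennreal (real (Suc n)) * ennreal (l / (l + 1))"
      using \<open>l > 0\<close> by (intro ennreal_mult) auto
    ultimately have "1 \<le> ennreal (real (Suc n)) * ennreal (l / (l + 1))" by (simp only: ennreal_1)
    then have "l \<in> A n" using l by (simp add: A_def)
    then show "l \<in> (\<Union>n. A n)" by blast
  qed (auto simp: A_def)
  ultimately show "\<exists>A. countable A \<and> A \<subseteq> sets \<rho> \<and> \<Union>A = space \<rho> \<and> (\<forall>a\<in>A. emeasure \<rho> a \<noteq> \<infinity>)"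
    by (intro exI[of _ "range A"]) auto
qed

lemma majorant_gap_measurable_pair:
  "(\<lambda>p. majorant_gap (fst p) (snd p)) \<in> borel_measurable (\<rho> \<Otimes>\<^sub>M lborel)"
proof -
  have [measurable]: "(\<lambda>p. fst p) \<in> borel_measurable (\<rho> \<Otimes>\<^sub>M lborel)"
    by (rule measurable_compose[OF measurable_fst measurable_ident_borel])
  have [measurable]: "(\<lambda>p. snd p) \<in> borel_measurable (\<rho> \<Otimes>\<^sub>M (lborel :: real measure))"
    by measurable
  show ?thesis
    unfolding majorant_gap_def M_series_def M_series_term_def by measurable
qed

lemma
  shows majorant_gap_integrable: "integrable \<rho> (\<lambda>l. majorant_gap l x)"
    and H_fun_minus_f_fun:
      "H_fun \<rho> (of_real x) - of_real (f_fun \<rho> x) = of_real (LINT l|\<rho>. majorant_gap l x)"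
proof -
  have i: "integrable \<rho> (\<lambda>l. exp (- l * \<bar>x\<bar>) - exp (- l))"
    using integrable_exp_diff[of "\<bar>x\<bar>" 1] by simp
  have eq: "majorant_gap l x = (M_series l x - exp (- l)) - (exp (- l * \<bar>x\<bar>) - exp (- l))" for l
    by (simp add: majorant_gap_def)
  show "integrable \<rho> (\<lambda>l. majorant_gap l x)"
    unfolding eq by (intro Bochner_Integration.integrable_diff M_series_diff_integrable i)
  have "(LINT l|\<rho>. majorant_gap l x) = (LINT l|\<rho>. M_series l x - exp (- l)) - f_fun \<rho> x"
    unfolding eq f_fun_def by (intro Bochner_Integration.integral_diff M_series_diff_integrable i)
  then show "H_fun \<rho> (of_real x) - of_real (f_fun \<rho> x) = of_real (LINT l|\<rho>. majorant_gap l x)"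
    by (simp add: H_fun_of_real)
qed

lemma coth_integrable: "integrable \<rho> (\<lambda>l. coth (l / 2) - 2 / l)"
proof (rule integrable_weight_bound)
  show "l > 0 \<Longrightarrow> norm (coth (l / 2) - 2 / l) \<le> 1 * (l / (l + 1))" for l
    using coth_minus_inverse_bounds[of l] by simp
  show "(\<lambda>l. coth (l / 2) - 2 / l) \<in> borel_measurable \<rho>"
    unfolding coth_def cosh_field_def sinh_field_def by measurable
qed

text \<open>Because the gap is nonnegative, the integral of its norm over \<open>x\<close> is the
  known value \<open>coth (l / 2) - 2 / l\<close>, which is integrable over \<rho>; the character
  has modulus 1.\<close>

lemma majorant_gap_e_char_integrable_pair:
  "integrable (\<rho> \<Otimes>\<^sub>M lborel) (\<lambda>(l, x). complex_of_real (majorant_gap l x) * e_char (of_real (- t * x)))"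
proof -
  interpret sigma_finite_measure \<rho> by (rule sigma_finite)
  interpret pair_sigma_finite \<rho> "lborel :: real measure" ..
  note [measurable] = majorant_gap_measurable_pair
  have 1: "integrable (\<rho> \<Otimes>\<^sub>M lborel) (\<lambda>p. majorant_gap (fst p) (snd p))"
  proof (rule Fubini_integrable[OF majorant_gap_measurable_pair])
    have "(LINT y|lborel. norm (majorant_gap (fst (l, y)) (snd (l, y)))) = coth (l / 2) - 2 / l" if "l \<in> space \<rho>" for l
      using that has_bochner_integral_integral_eq[OF has_bochner_integral_majorant_gap[of l]] majorant_gap_nonneg[of l]
      by (simp add: space_eq)
    then show "integrable \<rho> (\<lambda>l. LINT y|lborel. norm (majorant_gap (fst (l, y)) (snd (l, y))))"
      using coth_integrable by (simp cong: Bochner_Integration.integrable_cong)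
    show "AE l in \<rho>. integrable lborel (\<lambda>y. majorant_gap (fst (l, y)) (snd (l, y)))"
      using integrable.intros[OF has_bochner_integral_majorant_gap] by (intro AE_I2) (auto simp: space_eq)
  qed
  show ?thesis
    unfolding split_beta
  proof (rule Bochner_Integration.integrable_bound[OF 1])
    have [measurable]: "(\<lambda>p. snd p) \<in> borel_measurable (\<rho> \<Otimes>\<^sub>M (lborel :: real measure))"
      by measurable
    show "(\<lambda>p. complex_of_real (majorant_gap (fst p) (snd p)) * e_char (of_real (- t * snd p))) \<in> borel_measurable (\<rho> \<Otimes>\<^sub>M lborel)"
      by measurable
  qed (simp add: norm_mult del: of_real_mult of_real_minus)
qed

text \<open>The two parts of \<open>h\<close> stay together so that \<open>t = 0\<close> is covered:
  there the second part is \<open>2 / l\<close>, which need not be integrable over \<rho>.\<close>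

lemma
  defines "g \<equiv> (\<lambda>t x. (H_fun \<rho> (of_real x) - of_real (f_fun \<rho> x)) * e_char (of_real (- t * x)))"
    and "h \<equiv> (\<lambda>t l. M_hat l t - complex_of_real (2 * l / (l\<^sup>2 + 4 * pi\<^sup>2 * t\<^sup>2)))"
  shows H_gap_e_char_integrable: "integrable lborel (g t)"
    and M_hat_diff_integrable: "integrable \<rho> (h t)"
    and integral_H_gap_e_char: "(LINT x|lborel. g t x) = (LINT l|\<rho>. h t l)"
proof -
  interpret sigma_finite_measure \<rho> by (rule sigma_finite)
  interpret pair_sigma_finite \<rho> "lborel :: real measure" ..
  define F where "F = (\<lambda>l x. complex_of_real (majorant_gap l x) * e_char (of_real (- t * x)))"
  have F: "integrable (\<rho> \<Otimes>\<^sub>M lborel) (case_prod F)"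
    unfolding F_def by (rule majorant_gap_e_char_integrable_pair)
  have h: "(LINT x|lborel. F l x) = h t l" if "l \<in> space \<rho>" for l
    using has_bochner_integral_integral_eq[OF has_bochner_integral_majorant_gap_e_char[of l t]] that
    by (simp add: F_def h_def space_eq)
  have g: "(LINT l|\<rho>. F l x) = g t x" for x
    unfolding F_def g_def H_fun_minus_f_fun by (simp only: integral_mult_left_zero integral_complex_of_real)
  show "integrable \<rho> (h t)"
    using integrable_fst'[OF F] by (simp add: h cong: Bochner_Integration.integrable_cong)
  show "integrable lborel (g t)"
    using integrable_snd[OF F] by (simp add: g)
  have "(LINT x|lborel. g t x) = (LINT x|lborel. LINT l|\<rho>. F l x)" by (simp add: g)
  also have "\<dots> = (LINT l|\<rho>. LINT x|lborel. F l x)" by (rule Fubini_integral[OF F])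
  also have "\<dots> = (LINT l|\<rho>. h t l)" by (intro Bochner_Integration.integral_cong refl h)
  finally show "(LINT x|lborel. g t x) = (LINT l|\<rho>. h t l)" .
qed

lemma
  shows H_gap_integrable: "integrable lborel (\<lambda>x. H_fun \<rho> (of_real x) - of_real (f_fun \<rho> x))"
    and integral_H_gap:
      "(LINT x|lborel. H_fun \<rho> (of_real x) - of_real (f_fun \<rho> x)) = of_real (LINT l|\<rho>. coth (l / 2) - 2 / l)"
proof -
  have e: "e_char 0 = 1" by (simp add: e_char_def)
  show "integrable lborel (\<lambda>x. H_fun \<rho> (of_real x) - of_real (f_fun \<rho> x))"
    using H_gap_e_char_integrable[of 0] by (simp add: e)
  have "M_hat l 0 - complex_of_real (2 * l / (l\<^sup>2 + 4 * pi\<^sup>2 * 0\<^sup>2)) = of_real (coth (l / 2) - 2 / l)" if "l \<in> space \<rho>" for l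
  proof -
    have l: "l > 0" using that by (simp add: space_eq)
    have "M_hat l 0 - complex_of_real (2 * l / (l\<^sup>2 + 4 * pi\<^sup>2 * 0\<^sup>2)) = (LINT x|lborel. complex_of_real (majorant_gap l x))"
      using has_bochner_integral_integral_eq[OF has_bochner_integral_majorant_gap_e_char[OF l, of 0]] by (simp add: e)
    also have "\<dots> = of_real (coth (l / 2) - 2 / l)"
      unfolding integral_complex_of_real has_bochner_integral_integral_eq[OF has_bochner_integral_majorant_gap[OF l]] ..
    finally show ?thesis .
  qed
  then have "(LINT l|\<rho>. M_hat l 0 - complex_of_real (2 * l / (l\<^sup>2 + 4 * pi\<^sup>2 * 0\<^sup>2))) = (LINT l|\<rho>. complex_of_real (coth (l / 2) - 2 / l))"
    by (intro Bochner_Integration.integral_cong refl)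
  also have "\<dots> = of_real (LINT l|\<rho>. coth (l / 2) - 2 / l)" by (rule integral_complex_of_real)
  finally show "(LINT x|lborel. H_fun \<rho> (of_real x) - of_real (f_fun \<rho> x)) = of_real (LINT l|\<rho>. coth (l / 2) - 2 / l)"
    using integral_H_gap_e_char[of 0] by (simp add: e)
qed

lemma lorentz_integrable:
  assumes t: "t \<noteq> 0"
  shows "integrable \<rho> (\<lambda>l. 2 * l / (l\<^sup>2 + 4 * pi\<^sup>2 * t\<^sup>2))"
proof (rule integrable_weight_bound)
  fix l :: real assume l: "l > 0"
  define q where "q = 4 * pi\<^sup>2 * t\<^sup>2"
  have q: "q > 0" using t by (simp add: q_def)
  have "l * 1 \<le> (l\<^sup>2 + 1) / 2 " using zero_le_power2[of "l - 1"] by (simp add: power2_eq_square algebra_simps)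
  then have "2 * (l + 1) \<le> l\<^sup>2 + 3" by simp
  \<comment> \<open>The product expands to \<open>l^2 + q + 3 * l^2 / q + 3\<close>. Here
    \<open>t \<noteq> 0\<close> enters, through \<open>q > 0\<close>.\<close>
  also have "\<dots> \<le> (1 + 3 / q) * (l\<^sup>2 + q)" using q by (simp add: field_simps)
  finally have "2 * (l + 1) / (l\<^sup>2 + q) \<le> 1 + 3 / q"
    using q by (subst pos_divide_le_eq) (auto intro: add_nonneg_pos)
  then have *: "l / (l + 1) * (2 * (l + 1) / (l\<^sup>2 + q)) \<le> l / (l + 1) * (1 + 3 / q)"
    using l by (intro mult_left_mono) auto
  then show "norm (2 * l / (l\<^sup>2 + 4 * pi\<^sup>2 * t\<^sup>2)) \<le> (1 + 3 / q) * (l / (l + 1))"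
  proof -
    have "2 * l / (l\<^sup>2 + q) = l / (l + 1) * (2 * (l + 1) / (l\<^sup>2 + q))"
    proof -
      have "2 * (l + 1) / (l\<^sup>2 + q) = (l + 1) * (2 / (l\<^sup>2 + q))"
        by (simp only: times_divide_eq_right mult.commute)
      moreover have "l / (l + 1) * (l + 1) = l" using l by simp
      ultimately show ?thesis by (simp only: mult.assoc[symmetric]) (simp add: mult.commute)
    qed
    moreover have "norm (2 * l / (l\<^sup>2 + q)) = 2 * l / (l\<^sup>2 + q)" using l q by simp
    ultimately show ?thesis using * unfolding q_def by (simp only: mult.commute)
  qed
qed measurable

lemma
  assumes t: "t \<noteq> 0"
  shows M_hat_integrable: "integrable \<rho> (\<lambda>l. M_hat l t)"
    and integral_H_gap_e_char_nonzero:
      "(LINT x|lborel. (H_fun \<rho> (of_real x) - of_real (f_fun \<rho> x)) * e_char (of_real (- t * x))) =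
        (LINT l|\<rho>. M_hat l t) - of_real (LINT l|\<rho>. 2 * l / (l\<^sup>2 + 4 * pi\<^sup>2 * t\<^sup>2))"
proof -
  have i: "integrable \<rho> (\<lambda>l. complex_of_real (2 * l / (l\<^sup>2 + 4 * pi\<^sup>2 * t\<^sup>2)))"
    using lorentz_integrable[OF t] by (subst complex_of_real_integrable_eq)
  show M: "integrable \<rho> (\<lambda>l. M_hat l t)"
    using Bochner_Integration.integrable_add[OF M_hat_diff_integrable[of t] i] by simp
  show "(LINT x|lborel. (H_fun \<rho> (of_real x) - of_real (f_fun \<rho> x)) * e_char (of_real (- t * x))) =
        (LINT l|\<rho>. M_hat l t) - of_real (LINT l|\<rho>. 2 * l / (l\<^sup>2 + 4 * pi\<^sup>2 * t\<^sup>2))"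
    unfolding integral_H_gap_e_char Bochner_Integration.integral_diff[OF M i] integral_complex_of_real ..
qed

lemma H_fun_exp_type:
  assumes "d > 0" "e > 0"
  shows "\<exists>C. \<forall>z. norm (H_fun \<rho> (of_real d * z)) \<le> C * exp ((2 * pi * d + e) * norm z)"
proof -
  obtain C where C: "C \<ge> 0" "\<And>z. norm (H_fun \<rho> z) \<le> C * growth z"
    using H_fun_growth by blast
  \<comment> \<open>\<open>k\<close> is chosen so that \<open>k * (1 + e * r / 4)\<close> dominates
    \<open>1 + d * r\<close> for all \<open>r \<ge> 0\<close>. The divisor 4 matches the fourth
    power in \<open>growth\<close>, so the polynomial factor costs exactly
    \<open>exp (e * norm z)\<close>.\<close>
  define k where "k = 1 + 4 * d / e"
  have "growth (of_real d * z) \<le> k ^ 4 * exp ((2 * pi * d + e) * norm z)" for z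
  proof -
    have "1 + d * norm z \<le> k * (1 + e * norm z / 4)"
      using assms by (simp add: k_def field_simps)
    also have "\<dots> \<le> k * exp (e * norm z / 4)"
      using assms by (intro mult_left_mono exp_ge_add_one_self) (simp add: k_def)
    finally have "(1 + d * norm z) ^ 4 \<le> (k * exp (e * norm z / 4)) ^ 4"
      using assms by (intro power_mono) auto
    then have 1: "(1 + d * norm z) ^ 4 \<le> k ^ 4 * exp (e * norm z)"
      by (simp add: power_mult_distrib flip: exp_of_nat_mult)
    have 2: "exp (2 * pi * (d * \<bar>Im z\<bar>)) \<le> exp (2 * pi * d * norm z)"
      using abs_Im_le_cmod[of z] assms by simp
    have "growth (of_real d * z) = (1 + d * norm z) ^ 4 * exp (2 * pi * (d * \<bar>Im z\<bar>))"
      using assms by (simp add: growth_def norm_mult abs_mult)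
    also have "\<dots> \<le> (k ^ 4 * exp (e * norm z)) * exp (2 * pi * d * norm z)"
      using 1 2 assms by (intro mult_mono) (auto simp: k_def)
    also have "\<dots> = k ^ 4 * exp ((2 * pi * d + e) * norm z)"
      by (simp add: algebra_simps flip: exp_add)
    finally show ?thesis .
  qed
  then have "norm (H_fun \<rho> (of_real d * z)) \<le> (C * k ^ 4) * exp ((2 * pi * d + e) * norm z)" for z
    using C(2)[of "of_real d * z"] mult_left_mono[OF _ C(1)] by (metis (no_types, opaque_lifting) mult.assoc order_trans)
  then show ?thesis by blast
qed

end

section \<open>Rescaling from \<nu> to \<mu>\<close>

theorem theorem1p4:
  fixes \<mu> \<nu> :: "real measure" and \<delta> :: real
  assumes "borel_measure_pos \<mu>"
    and "0 < (\<integral>\<^sup>+l. ennreal (l / (l + 1)) \<partial>\<mu>)"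
    and "(\<integral>\<^sup>+l. ennreal (l / (l + 1)) \<partial>\<mu>) < \<infinity>"
    and "0 < \<delta>"
    and "borel_measure_pos \<nu>"
    and "\<And>E. E \<in> sets \<nu> \<Longrightarrow> emeasure \<nu> E = emeasure \<mu> ((\<lambda>x. \<delta> * x) ` E)"
  shows
    "(real_entire (\<lambda>z. H_fun \<nu> (of_real \<delta> * z)) \<and>
      exp_type_at_most (\<lambda>z. H_fun \<nu> (of_real \<delta> * z)) (2 * pi * \<delta>))
   \<and> (\<forall>x::real.
        (\<forall>l>0. M_fun (l / \<delta>) (of_real (\<delta> * x)) - of_real (exp (- l * \<bar>x\<bar>)) \<in> \<real>\<^sub>\<ge>\<^sub>0) \<and>
        integrable \<mu> (\<lambda>l. M_fun (l / \<delta>) (of_real (\<delta> * x)) - of_real (exp (- l * \<bar>x\<bar>))))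
   \<and> (\<forall>x::real.
        H_fun \<nu> (of_real (\<delta> * x)) + of_real (f_fun \<mu> (1 / \<delta>)) - of_real (f_fun \<mu> x) \<in> \<real>\<^sub>\<ge>\<^sub>0 \<and>
        H_fun \<nu> (of_real (\<delta> * x)) + of_real (f_fun \<mu> (1 / \<delta>)) - of_real (f_fun \<mu> x) =
          (LINT l|\<mu>. M_fun (l / \<delta>) (of_real (\<delta> * x)) - of_real (exp (- l * \<bar>x\<bar>))))
   \<and> (integrable lborel
        (\<lambda>x::real. H_fun \<nu> (of_real (\<delta> * x)) + of_real (f_fun \<mu> (1 / \<delta>)) - of_real (f_fun \<mu> x)) \<and>
      integrable \<mu> (\<lambda>l. 1 / \<delta> * coth (l / (2 * \<delta>)) - 2 / l) \<and>
      (LINT x|lborel. H_fun \<nu> (of_real (\<delta> * x)) + of_real (f_fun \<mu> (1 / \<delta>)) - of_real (f_fun \<mu> x)) =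
        of_real (LINT l|\<mu>. 1 / \<delta> * coth (l / (2 * \<delta>)) - 2 / l))
   \<and> (\<forall>t::real. t \<noteq> 0 \<longrightarrow>
        integrable \<mu> (\<lambda>l. M_hat (l / \<delta>) (t / \<delta>)) \<and>
        integrable \<mu> (\<lambda>l. 2 * l / (l\<^sup>2 + 4 * pi\<^sup>2 * t\<^sup>2)) \<and>
        (LINT x|lborel. (H_fun \<nu> (of_real (\<delta> * x)) + of_real (f_fun \<mu> (1 / \<delta>)) - of_real (f_fun \<mu> x))
            * e_char (of_real (- t * x))) =
          of_real (1 / \<delta>) * (LINT l|\<mu>. M_hat (l / \<delta>) (t / \<delta>))
          - of_real (LINT l|\<mu>. 2 * l / (l\<^sup>2 + 4 * pi\<^sup>2 * t\<^sup>2)))"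
proof -
  note \<mu>_sets = assms(1) and \<mu>_fin = assms(3) and \<delta> = assms(4) and \<nu>_sets = assms(5) and \<nu>_eq = assms(6)
  interpret M: laplace_measure \<mu>
    using \<mu>_sets \<mu>_fin by unfold_locales (simp_all add: borel_measure_pos_def)
  have sets\<nu>: "sets \<nu> = sets (restrict_space borel {0<..})"
    using \<nu>_sets by (simp add: borel_measure_pos_def)
  have space\<nu>: "space \<nu> = {0<..}"
    using sets_eq_imp_space_eq[OF sets\<nu>] by (simp add: space_restrict_space)
  have scale: "(\<lambda>l. l / \<delta>) \<in> measurable \<mu> \<nu>"
    unfolding measurable_cong_sets[OF refl sets\<nu>]
    by (rule measurable_restrict_space2) (use \<delta> in \<open>auto simp: M.space_eq\<close>)
  \<comment> \<open>The preimage of \<open>E\<close> under division by \<delta> is the dilate of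
    \<open>E\<close> by \<delta>, so the hypothesis on \<nu> describes an image measure.\<close>
  have \<nu>: "\<nu> = distr \<mu> \<nu> (\<lambda>l. l / \<delta>)"
  proof (rule measure_eqI)
    fix E assume E: "E \<in> sets \<nu>"
    then have "E \<subseteq> {0<..}" using sets.sets_into_space[OF E] by (simp add: space\<nu>)
    then have "(\<lambda>l. l / \<delta>) -` E \<inter> space \<mu> = (\<lambda>x. \<delta> * x) ` E"
      using \<delta> by (force simp: M.space_eq image_iff)
    then show "emeasure \<nu> E = emeasure (distr \<mu> \<nu> (\<lambda>l. l / \<delta>)) E"
      using \<nu>_eq[OF E] emeasure_distr[OF scale E] by simp
  qed simp
  have integral_\<nu>: "(LINT l|\<nu>. f l) = (LINT l|\<mu>. f (l / \<delta>))" if "f \<in> borel_measurable \<nu>"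
    for f :: "real \<Rightarrow> 'b::{banach,second_countable_topology}"
    by (subst \<nu>) (rule integral_distr[OF scale that])
  have integrable_\<nu>: "integrable \<mu> (\<lambda>l. f (l / \<delta>))" if "integrable \<nu> f"
    for f :: "real \<Rightarrow> 'b::{banach,second_countable_topology}"
    using that by (subst (asm) \<nu>) (rule integrable_distr[OF scale])
  interpret N: laplace_measure \<nu>
  proof
    have "(\<integral>\<^sup>+l. ennreal (l / (l + 1)) \<partial>\<nu>) = (\<integral>\<^sup>+l. ennreal (l / (l + 1)) \<partial>distr \<mu> \<nu> (\<lambda>l. l / \<delta>))"
      by (subst (1) \<nu>) (rule refl)
    also have "\<dots> = (\<integral>\<^sup>+l. ennreal (l / \<delta> / (l / \<delta> + 1)) \<partial>\<mu>)"
    proof (rule nn_integral_distr[OF scale])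
      have "(\<lambda>l. l) \<in> borel_measurable (distr \<mu> \<nu> (\<lambda>l. l / \<delta>))"
        unfolding measurable_distr_eq1 measurable_cong_sets[OF sets\<nu> refl] by (rule measurable_restrict_space1) simp
      then show "(\<lambda>l. ennreal (l / (l + 1))) \<in> borel_measurable (distr \<mu> \<nu> (\<lambda>l. l / \<delta>))"
        by measurable
    qed
    also have "\<dots> \<le> (\<integral>\<^sup>+l. ennreal (1 + 1 / \<delta>) * ennreal (l / (l + 1)) \<partial>\<mu>)"
    proof (rule nn_integral_mono)
      fix l assume "l \<in> space \<mu>"
      then have l: "l > 0" by (simp add: M.space_eq)
      have "l / \<delta> / (l / \<delta> + 1) = l / (l + \<delta>)" using \<delta> by (simp add: field_simps)
      also have "\<dots> \<le> (1 + 1 / \<delta>) * (l / (l + 1))"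
      proof -
        \<comment> \<open>The right side expands to \<open>l + \<delta> + l / \<delta> + 1\<close>,
          which explains the constant.\<close>
        have "l + 1 \<le> (1 + 1 / \<delta>) * (l + \<delta>)" using \<delta> l by (simp add: field_simps)
        then have "1 / (l + \<delta>) \<le> (1 + 1 / \<delta>) / (l + 1)" using l \<delta> by (simp add: divide_le_eq pos_le_divide_eq mult.commute)
        from mult_left_mono[OF this, of l] show ?thesis using l by (simp add: mult.commute)
      qed
      finally show "ennreal (l / \<delta> / (l / \<delta> + 1)) \<le> ennreal (1 + 1 / \<delta>) * ennreal (l / (l + 1))"
        using l \<delta> by (subst ennreal_mult[symmetric]) (auto intro: ennreal_leI simp del: ennreal_plus)
    qed
    also have "\<dots> = ennreal (1 + 1 / \<delta>) * (\<integral>\<^sup>+l. ennreal (l / (l + 1)) \<partial>\<mu>)"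
      by (rule nn_integral_cmult) measurable
    also have "\<dots> < \<infinity>" using \<mu>_fin by (simp add: ennreal_mult_less_top)
    finally show "(\<integral>\<^sup>+l. ennreal (l / (l + 1)) \<partial>\<nu>) < \<infinity>" .
  qed (rule sets\<nu>)
  \<comment> \<open>\<open>f_fun \<nu>\<close> is normalised to vanish at 1, which corresponds to
    \<open>x = 1 / \<delta>\<close>; this is the origin of the constant
    \<open>f_fun \<mu> (1 / \<delta>)\<close>.\<close>
  have f_\<nu>: "f_fun \<nu> (\<delta> * x) = f_fun \<mu> x - f_fun \<mu> (1 / \<delta>)" for x
  proof -
    have "f_fun \<nu> (\<delta> * x) = (LINT l|\<mu>. exp (- (l / \<delta>) * \<bar>\<delta> * x\<bar>) - exp (- (l / \<delta>)))"
      unfolding f_fun_def by (rule integral_\<nu>) measurable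
    also have "\<dots> = (LINT l|\<mu>. (exp (- l * \<bar>x\<bar>) - exp (- l * 1)) - (exp (- l * (1 / \<delta>)) - exp (- l * 1)))"
      using \<delta> by (simp add: abs_mult)
    also have "\<dots> = (LINT l|\<mu>. exp (- l * \<bar>x\<bar>) - exp (- l * 1)) - (LINT l|\<mu>. exp (- l * (1 / \<delta>)) - exp (- l * 1))"
      using \<delta> by (intro Bochner_Integration.integral_diff M.integrable_exp_diff) auto
    also have "\<dots> = f_fun \<mu> x - f_fun \<mu> (1 / \<delta>)" using \<delta> by (simp add: f_fun_def)
    finally show ?thesis .
  qed
  define G where "G = (\<lambda>y. H_fun \<nu> (of_real y) - of_real (f_fun \<nu> y))"
  have G: "H_fun \<nu> (of_real (\<delta> * x)) + of_real (f_fun \<mu> (1 / \<delta>)) - of_real (f_fun \<mu> x) = G (\<delta> * x)" for x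
    unfolding G_def f_\<nu> by simp
  have gap: "M_fun (l / \<delta>) (of_real (\<delta> * x)) - of_real (exp (- l * \<bar>x\<bar>)) = of_real (majorant_gap (l / \<delta>) (\<delta> * x))"
    if "l > 0" for l x
  proof -
    have "l / \<delta> > 0" using that \<delta> by simp
    then show ?thesis
      using \<delta> by (simp add: majorant_gap_def M_fun_eq M_series_of_real abs_mult del: of_real_mult)
  qed
  have scaled_integral: "(LINT x|lborel. f (\<delta> * x)) = of_real (1 / \<delta>) * (LINT x|lborel. f x)" for f :: "real \<Rightarrow> complex"
    using lborel_integral_real_affine[of \<delta> f 0] \<delta> by (simp add: scaleR_conv_of_real)
  have coth_eq: "1 / \<delta> * coth (l / (2 * \<delta>)) - 2 / l = 1 / \<delta> * (coth (l / \<delta> / 2) - 2 / (l / \<delta>))" for l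
    using \<delta> by (simp add: right_diff_distrib mult.commute)
  \<comment> \<open>The kernel is homogeneous of degree -1 in \<open>l\<close> and \<open>t\<close>
    together, so the Jacobian \<open>1 / \<delta>\<close> of the substitution in \<open>x\<close> is
    absorbed exactly.\<close>
  have lorentz_eq: "2 * l / (l\<^sup>2 + 4 * pi\<^sup>2 * t\<^sup>2) = 1 / \<delta> * (2 * (l / \<delta>) / ((l / \<delta>)\<^sup>2 + 4 * pi\<^sup>2 * (t / \<delta>)\<^sup>2))" for l t
  proof -
    have "(l / \<delta>)\<^sup>2 + 4 * pi\<^sup>2 * (t / \<delta>)\<^sup>2 = (l\<^sup>2 + 4 * pi\<^sup>2 * t\<^sup>2) / \<delta>\<^sup>2"
      by (simp add: power_divide add_divide_distrib)
    then show ?thesis using \<delta> by (simp add: power2_eq_square)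
  qed
  have gap_integrable: "integrable \<mu> (\<lambda>l. majorant_gap (l / \<delta>) (\<delta> * x))" for x
    by (rule integrable_\<nu>) (rule N.majorant_gap_integrable)
  have gap_integral: "G (\<delta> * x) = of_real (LINT l|\<mu>. majorant_gap (l / \<delta>) (\<delta> * x))" for x
    unfolding G_def N.H_fun_minus_f_fun
    using integral_\<nu>[OF borel_measurable_integrable[OF N.majorant_gap_integrable]] by simp
  have gap_integral': "(LINT l|\<mu>. M_fun (l / \<delta>) (of_real (\<delta> * x)) - of_real (exp (- l * \<bar>x\<bar>))) = G (\<delta> * x)" for x
  proof -
    have "(LINT l|\<mu>. M_fun (l / \<delta>) (of_real (\<delta> * x)) - of_real (exp (- l * \<bar>x\<bar>))) =
        (LINT l|\<mu>. complex_of_real (majorant_gap (l / \<delta>) (\<delta> * x)))"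
      using gap[of _ x] by (intro Bochner_Integration.integral_cong refl) (simp add: M.space_eq)
    then show ?thesis by (simp add: gap_integral)
  qed

  have "(\<lambda>z. H_fun \<nu> (of_real \<delta> * z)) holomorphic_on UNIV"
    using holomorphic_on_compose_gen[OF _ N.H_fun_holomorphic, of "\<lambda>z. of_real \<delta> * z" UNIV]
    by (auto simp: o_def intro: holomorphic_intros)
  moreover have "H_fun \<nu> (of_real \<delta> * of_real x) \<in> \<real>" for x
    using N.H_fun_of_real[of "\<delta> * x"] by simp
  ultimately have part1: "real_entire (\<lambda>z. H_fun \<nu> (of_real \<delta> * z))"
    "exp_type_at_most (\<lambda>z. H_fun \<nu> (of_real \<delta> * z)) (2 * pi * \<delta>)"
    using N.H_fun_exp_type[OF \<delta>] by (auto simp: real_entire_def exp_type_at_most_def)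

  have part2: "M_fun (l / \<delta>) (of_real (\<delta> * x)) - of_real (exp (- l * \<bar>x\<bar>)) \<in> \<real>\<^sub>\<ge>\<^sub>0" if "l > 0" for l x
    unfolding gap[OF that] using that \<delta> by (simp add: majorant_gap_nonneg)
  have part2': "integrable \<mu> (\<lambda>l. M_fun (l / \<delta>) (of_real (\<delta> * x)) - of_real (exp (- l * \<bar>x\<bar>)))" for x
  proof -
    have "integrable \<mu> (\<lambda>l. complex_of_real (majorant_gap (l / \<delta>) (\<delta> * x)))"
      using gap_integrable[of x] by (subst complex_of_real_integrable_eq)
    then show ?thesis
      using gap[of _ x] by (subst Bochner_Integration.integrable_cong[OF refl]) (simp_all add: M.space_eq)
  qed
  have part3: "G (\<delta> * x) \<in> \<real>\<^sub>\<ge>\<^sub>0" for x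
    unfolding gap_integral using \<delta>
    by (auto intro!: integral_nonneg_AE AE_I2 majorant_gap_nonneg simp: M.space_eq)

  have part4: "integrable lborel (\<lambda>x. G (\<delta> * x))"
    using lborel_integrable_real_affine[OF N.H_gap_integrable, of \<delta> 0] \<delta> by (simp add: G_def)
  have coth_int: "integrable \<mu> (\<lambda>l. coth (l / \<delta> / 2) - 2 / (l / \<delta>))"
    by (rule integrable_\<nu>) (rule N.coth_integrable)
  then have part4': "integrable \<mu> (\<lambda>l. 1 / \<delta> * coth (l / (2 * \<delta>)) - 2 / l)"
    unfolding coth_eq by (intro integrable_mult_right)
  have part4'': "(LINT x|lborel. G (\<delta> * x)) = of_real (LINT l|\<mu>. 1 / \<delta> * coth (l / (2 * \<delta>)) - 2 / l)"
    unfolding coth_eq integral_mult_right_zero of_real_mult scaled_integral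
    using N.integral_H_gap integral_\<nu>[OF borel_measurable_integrable[OF N.coth_integrable]] by (simp add: G_def)

  have part5: "integrable \<mu> (\<lambda>l. M_hat (l / \<delta>) (t / \<delta>))"
    "integrable \<mu> (\<lambda>l. 2 * l / (l\<^sup>2 + 4 * pi\<^sup>2 * t\<^sup>2))"
    "(LINT x|lborel. G (\<delta> * x) * e_char (of_real (- t * x))) =
        of_real (1 / \<delta>) * (LINT l|\<mu>. M_hat (l / \<delta>) (t / \<delta>)) - of_real (LINT l|\<mu>. 2 * l / (l\<^sup>2 + 4 * pi\<^sup>2 * t\<^sup>2))"
    if t: "t \<noteq> 0" for t
  proof -
    have t': "t / \<delta> \<noteq> 0" using t \<delta> by simp
    show "integrable \<mu> (\<lambda>l. M_hat (l / \<delta>) (t / \<delta>))"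
      by (rule integrable_\<nu>) (rule N.M_hat_integrable[OF t'])
    show "integrable \<mu> (\<lambda>l. 2 * l / (l\<^sup>2 + 4 * pi\<^sup>2 * t\<^sup>2))"
      by (rule M.lorentz_integrable[OF t])
    have lorentz: "(LINT l|\<mu>. 2 * l / (l\<^sup>2 + 4 * pi\<^sup>2 * t\<^sup>2)) =
        1 / \<delta> * (LINT l|\<mu>. 2 * (l / \<delta>) / ((l / \<delta>)\<^sup>2 + 4 * pi\<^sup>2 * (t / \<delta>)\<^sup>2))"
      by (subst integral_mult_right_zero[symmetric]) (intro Bochner_Integration.integral_cong refl lorentz_eq)
    have "(LINT x|lborel. G (\<delta> * x) * e_char (of_real (- t * x))) =
        (LINT x|lborel. G (\<delta> * x) * e_char (of_real (- (t / \<delta>) * (\<delta> * x))))"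
      using \<delta> by simp
    also have "\<dots> = of_real (1 / \<delta>) * (LINT x|lborel. G x * e_char (of_real (- (t / \<delta>) * x)))"
      by (rule scaled_integral)
    also have "\<dots> = of_real (1 / \<delta>) * ((LINT l|\<nu>. M_hat l (t / \<delta>)) - of_real (LINT l|\<nu>. 2 * l / (l\<^sup>2 + 4 * pi\<^sup>2 * (t / \<delta>)\<^sup>2)))"
      unfolding G_def N.integral_H_gap_e_char_nonzero[OF t'] ..
    also have "(LINT l|\<nu>. M_hat l (t / \<delta>)) = (LINT l|\<mu>. M_hat (l / \<delta>) (t / \<delta>))"
      by (rule integral_\<nu>) (rule borel_measurable_integrable[OF N.M_hat_integrable[OF t']])
    also have "(LINT l|\<nu>. 2 * l / (l\<^sup>2 + 4 * pi\<^sup>2 * (t / \<delta>)\<^sup>2)) = (LINT l|\<mu>. 2 * (l / \<delta>) / ((l / \<delta>)\<^sup>2 + 4 * pi\<^sup>2 * (t / \<delta>)\<^sup>2))"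
      by (rule integral_\<nu>) (rule borel_measurable_integrable[OF N.lorentz_integrable[OF t']])
    finally show "(LINT x|lborel. G (\<delta> * x) * e_char (of_real (- t * x))) =
        of_real (1 / \<delta>) * (LINT l|\<mu>. M_hat (l / \<delta>) (t / \<delta>)) - of_real (LINT l|\<mu>. 2 * l / (l\<^sup>2 + 4 * pi\<^sup>2 * t\<^sup>2))"
      unfolding lorentz of_real_mult right_diff_distrib .
  qed
  show ?thesis
    unfolding G gap_integral'
    by (intro conjI allI impI part1 part2 part2' part3 part4 part4' part4'' part5 refl)
qed

end
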